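(* Let $\mathcal I\subset\mathbb K[x^*,y]$ be an $N$-admissible ideal. If $S=\{D^{(i)}\}_{i=0}^\infty$ is an infinite $\omega$-sequence for $\mathcal I$, then $\mathbf{ser}(S)$ is an $\omega$-solution of $\mathcal I$.
   Context: Let $\mathbb K$ be an algebraically closed field of characteristic zero, $N,M$ positive integers, $\omega\in\mathbb R^N$ with coordinates linearly independent over $\mathbb Q$. $S_\omega$ is the field of $\omega$-positive Puiseux series: formal sums $\sum_{\alpha\in\mathbb Q^N}c_\alpha x^\alpha$ ($c_\alpha\in\mathbb K$) with exponent set contained in $\frac1k\mathbb Z^N$ for some $k$ and with $\mathcal E(x^\gamma\phi)\subset\sigma$ for some $\gamma\in\mathbb Q^N$ and some rational polyhedral cone $\sigma$ with $v\cdot\omega\ge0$ on $\sigma$. Conventions $\infty\cdot a=\infty$ ($a\ne0$), $\infty\cdot0=0$, $\infty>r$; $\Lambda(\eta)=\{i:\eta_i\ne\infty\}$. $\mathbb K[x^*,y]=\mathbb K[x_1^{\pm1},\dots,x_N^{\pm1},y_1,\dots,y_M]$. For $\omega'\in\mathbb R^N$, $\eta\in(\mathbb R\cup\{\infty\})^M$, $f=\sum a_{\alpha,\beta}x^\alpha y^\beta$: $\operatorname{ord}_{\omega',\eta}(f)=\min_{a_{\alpha,\beta}\ne0}(\omega'\cdot\alpha+\eta\cdot\beta)$; $\operatorname{in}_{\omega',\eta}(f)$ the sum of terms attaining it if finite, else $0$; $\operatorname{In}_{\omega',\eta}\mathcal J$ generated by $\{\operatorname{in}_{\omega',\eta}f:f\in\mathcal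 J\}\cup\{y_i:i\notin\Lambda(\eta)\}$. $\tau(\mathcal J)=\{(\omega',\eta): \operatorname{In}_{\omega',\eta}\mathcal J\cap\mathbb K[x^*,(y_i)_{i\in\Lambda(\eta)}]\text{ contains no monomial } cx^\alpha y^\beta, c\ne0\}$. An $\omega$-solution of $\mathcal J$ is $\varphi\in S_\omega^M$ with $f(x,\varphi)=0$ for all $f\in\mathcal J$. $\mathcal I$ is $N$-admissible if, for $J=\mathcal I\cap\mathbb K[x_1,\dots,x_N,y]$, the projection $(x,y)\mapsto x$ from the zero set of $J$ in $\mathbb K^{N+M}$ to $\mathbb K^N$ is dominant with finite generic fibre. An $\omega$-set is $D=\{\eta,\Gamma,c\}$, $\eta\in(\mathbb R\cup\{\infty\})^M$, $\Gamma$ an $M\times N$ matrix over $\mathbb Q\cup\{\infty\}$, $c\in\mathbb K^M$, with: for $i\in\Lambda(\eta)$, $\Gamma_{i,*}\in\mathbb Q^N$, $\omega\cdot\Gamma_{i,*}=\eta_i$, $c_i\ne0$; for $i\notin\Lambda(\eta)$, $\Gamma_{i,*}=(\infty,\dots,\infty)$, $c_i=0$. $\mathfrak M_D=(c_ix^{\Gamma_{i,*}})_i$ (entry $0$ if $i\notin\Lambda(\eta)$). A starting $\omega$-set for $\mathcal J$: an $\omega$-set with $(\omega,\eta)\in\tau(\mathcal J)$ and $c$ a common zero of $\{f(1,\dots,1,y):f\in\operatorname{In}_{\omega,\eta}\mathcal J\}$. $\mathbf d\Gamma$: least positive integer $k$ with $k\Gamma_{i,j}\in\mathbb Z$ for all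 finite entries; for $r\in\mathbb Q_{>0}$, $x^{rI}=(x_1^r,\dots,x_N^r)$; $\mathcal J_D$ is generated by $\{f(x^{\mathbf d\Gamma I},y+\mathfrak M_D(x^{\mathbf d\Gamma I})):f\in\mathcal J\}$. With $\mathcal I^{(0)}=\mathcal I$, $\mathcal I^{(i)}=(\mathcal I^{(i-1)})_{D^{(i-1)}}$, a sequence of $\omega$-sets $D^{(i)}=\{\eta^{(i)},\Gamma^{(i)},c^{(i)}\}$ is an $\omega$-sequence for $\mathcal I$ if each $D^{(i)}$ is a starting $\omega$-set for $\mathcal I^{(i)}$ and, for $i\ge1$, $\eta^{(i)}_j>\mathbf d\Gamma^{(i-1)}\eta^{(i-1)}_j$ for all $j\in\Lambda(\eta^{(i)})$. Put $r^{(0)}=1$, $r^{(i)}=1/\prod_{j=0}^{i-1}\mathbf d\Gamma^{(j)}$ for $i>0$; the series defined by $S$ is $\mathbf{ser}(S)=\sum_{i\ge0}\mathfrak M_{D^{(i)}}(x^{r^{(i)}I})\in$ ($M$-tuples of fractional power series). *)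

theory Defs
  imports "HOL-Library.Extended_Real" "HOL-Computational_Algebra.Polynomial"
begin

text \<open>Variables are indexed from 0: x_0..x_{N-1}, y_0..y_{M-1}.
  An exponent is a pair (alpha, beta) with alpha : nat => int (zero for i >= N)
  and beta : nat => nat (zero for j >= M). A polynomial is its coefficient function.\<close>

type_synonym lexp = "(nat \<Rightarrow> int) \<times> (nat \<Rightarrow> nat)"
type_synonym 'k lpol = "lexp \<Rightarrow> 'k"

definition supp :: "('a \<Rightarrow> 'k::zero) \<Rightarrow> 'a set" where
  "supp p = {e. p e \<noteq> 0}"

definition lpoly :: "nat \<Rightarrow> nat \<Rightarrow> 'k::zero lpol \<Rightarrow> bool" where
  "lpoly N M p \<longleftrightarrow> finite (supp p) \<and>
     (\<forall>e\<in>supp p. (\<forall>i\<ge>N. fst e i = 0) \<and> (\<forall>j\<ge>M. snd e j = 0))"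

definition lexp_add :: "lexp \<Rightarrow> lexp \<Rightarrow> lexp" where
  "lexp_add a b = ((\<lambda>i. fst a i + fst b i), (\<lambda>j. snd a j + snd b j))"

definition lpol_add :: "'k::comm_ring_1 lpol \<Rightarrow> 'k lpol \<Rightarrow> 'k lpol" where
  "lpol_add p q = (\<lambda>e. p e + q e)"

definition lpol_mult :: "'k::comm_ring_1 lpol \<Rightarrow> 'k lpol \<Rightarrow> 'k lpol" where
  "lpol_mult p q = (\<lambda>e. \<Sum>(a, b)\<in>{(a, b). a \<in> supp p \<and> b \<in> supp q \<and> lexp_add a b = e}. p a * q b)"

definition is_monomial :: "'k::zero lpol \<Rightarrow> bool" where
  "is_monomial p \<longleftrightarrow> (\<exists>e. supp p = {e})"

definition yvar :: "nat \<Rightarrow> 'k::{zero,one} lpol" where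
  "yvar j = (\<lambda>e. if e = ((\<lambda>_. 0), (\<lambda>l. if l = j then 1 else 0)) then 1 else 0)"

definition is_ideal :: "nat \<Rightarrow> nat \<Rightarrow> 'k::comm_ring_1 lpol set \<Rightarrow> bool" where
  "is_ideal N M I \<longleftrightarrow> (\<forall>p\<in>I. lpoly N M p) \<and> (\<lambda>_. 0) \<in> I \<and>
     (\<forall>p\<in>I. \<forall>q\<in>I. lpol_add p q \<in> I) \<and>
     (\<forall>p\<in>I. \<forall>h. lpoly N M h \<longrightarrow> lpol_mult h p \<in> I)"

inductive_set gen_ideal :: "nat \<Rightarrow> nat \<Rightarrow> 'k::comm_ring_1 lpol set \<Rightarrow> 'k lpol set"
  for N M G where
  gen_zero: "(\<lambda>_. 0) \<in> gen_ideal N M G"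
| gen_mult: "g \<in> G \<Longrightarrow> lpoly N M h \<Longrightarrow> lpol_mult h g \<in> gen_ideal N M G"
| gen_add: "p \<in> gen_ideal N M G \<Longrightarrow> q \<in> gen_ideal N M G \<Longrightarrow> lpol_add p q \<in> gen_ideal N M G"

text \<open>eta : nat => ereal, with values in R \<union> {\<infinity>}; ereal multiplication satisfies
  \<infinity> * 0 = 0 and \<infinity> * a = \<infinity> for a > 0, as in the paper's conventions.\<close>

definition Lam :: "nat \<Rightarrow> (nat \<Rightarrow> ereal) \<Rightarrow> nat set" where
  "Lam M \<eta> = {j. j < M \<and> \<eta> j \<noteq> \<infinity>}"

definition wt :: "nat \<Rightarrow> nat \<Rightarrow> (nat \<Rightarrow> real) \<Rightarrow> (nat \<Rightarrow> ereal) \<Rightarrow> lexp \<Rightarrow> ereal" where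
  "wt N M \<omega>' \<eta> e = ereal (\<Sum>i<N. \<omega>' i * real_of_int (fst e i)) + (\<Sum>j<M. \<eta> j * ereal (real (snd e j)))"

definition ord_w :: "nat \<Rightarrow> nat \<Rightarrow> (nat \<Rightarrow> real) \<Rightarrow> (nat \<Rightarrow> ereal) \<Rightarrow> 'k::zero lpol \<Rightarrow> ereal" where
  "ord_w N M \<omega>' \<eta> f = (INF e\<in>supp f. wt N M \<omega>' \<eta> e)"

definition in_w :: "nat \<Rightarrow> nat \<Rightarrow> (nat \<Rightarrow> real) \<Rightarrow> (nat \<Rightarrow> ereal) \<Rightarrow> 'k::zero lpol \<Rightarrow> 'k lpol" where
  "in_w N M \<omega>' \<eta> f = (\<lambda>e. if ord_w N M \<omega>' \<eta> f \<noteq> \<infinity> \<and> wt N M \<omega>' \<eta> e = ord_w N M \<omega>' \<eta> f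
                           then f e else 0)"

definition In_w :: "nat \<Rightarrow> nat \<Rightarrow> (nat \<Rightarrow> real) \<Rightarrow> (nat \<Rightarrow> ereal) \<Rightarrow> 'k::comm_ring_1 lpol set \<Rightarrow> 'k lpol set" where
  "In_w N M \<omega>' \<eta> J = gen_ideal N M ({in_w N M \<omega>' \<eta> f | f. f \<in> J} \<union> {yvar j | j. j < M \<and> j \<notin> Lam M \<eta>})"

definition in_tau :: "nat \<Rightarrow> nat \<Rightarrow> 'k::comm_ring_1 lpol set \<Rightarrow> (nat \<Rightarrow> real) \<Rightarrow> (nat \<Rightarrow> ereal) \<Rightarrow> bool" where
  "in_tau N M J \<omega>' \<eta> \<longleftrightarrow>
     \<not> (\<exists>p\<in>In_w N M \<omega>' \<eta> J. is_monomial p \<and> (\<forall>e\<in>supp p. \<forall>j<M. j \<notin> Lam M \<eta> \<longrightarrow> snd e j = 0))"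

text \<open>An omega-set is (eta, Gamma, c), Gamma j i the (j,i) entry of the M x N matrix.
  Rows j not in Lambda(eta) are the all-infinity rows; their (rational) stored values are
  irrelevant and ignored by all definitions below.\<close>

type_synonym 'k wset = "(nat \<Rightarrow> ereal) \<times> (nat \<Rightarrow> nat \<Rightarrow> rat) \<times> (nat \<Rightarrow> 'k)"

definition omega_set :: "nat \<Rightarrow> nat \<Rightarrow> (nat \<Rightarrow> real) \<Rightarrow> 'k::zero wset \<Rightarrow> bool" where
  "omega_set N M \<omega> D \<longleftrightarrow> (case D of (\<eta>, \<Gamma>, c) \<Rightarrow>
     (\<forall>j<M. (j \<in> Lam M \<eta> \<longrightarrow> \<eta> j = ereal (\<Sum>i<N. \<omega> i * real_of_rat (\<Gamma> j i)) \<and> c j \<noteq> 0) \<and>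
            (j \<notin> Lam M \<eta> \<longrightarrow> c j = 0)))"

definition eval_one :: "nat \<Rightarrow> 'k::comm_ring_1 lpol \<Rightarrow> (nat \<Rightarrow> 'k) \<Rightarrow> 'k" where
  "eval_one M f c = (\<Sum>e\<in>supp f. f e * (\<Prod>j<M. c j ^ snd e j))"

definition starting_set :: "nat \<Rightarrow> nat \<Rightarrow> (nat \<Rightarrow> real) \<Rightarrow> 'k::comm_ring_1 lpol set \<Rightarrow> 'k wset \<Rightarrow> bool" where
  "starting_set N M \<omega> J D \<longleftrightarrow> (case D of (\<eta>, \<Gamma>, c) \<Rightarrow>
     omega_set N M \<omega> D \<and> in_tau N M J \<omega> \<eta> \<and> (\<forall>f\<in>In_w N M \<omega> \<eta> J. eval_one M f c = 0))"

definition dG :: "nat \<Rightarrow> nat \<Rightarrow> 'k wset \<Rightarrow> nat" where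
  "dG N M D = (case D of (\<eta>, \<Gamma>, c) \<Rightarrow>
     (LEAST k::nat. 0 < k \<and> (\<forall>j\<in>Lam M \<eta>. \<forall>i<N. of_nat k * \<Gamma> j i \<in> \<int>)))"

text \<open>f(x^{kI}, y + M_D(x^{kI})), where g j = k * Gamma_{j,*} (an integer vector).
  Expanding (y_j + c_j x^{g_j})^{beta_j} binomially gives the coefficient formula below.\<close>

definition subst_D :: "nat \<Rightarrow> nat \<Rightarrow> 'k::comm_ring_1 wset \<Rightarrow> 'k lpol \<Rightarrow> 'k lpol" where
  "subst_D N M D f = (case D of (\<eta>, \<Gamma>, c) \<Rightarrow>
     (let k = dG N M D;
          g = (\<lambda>j i. if i < N then \<lfloor>of_nat k * \<Gamma> j i\<rfloor> else 0)
      in (\<lambda>(\<alpha>', b). \<Sum>e\<in>{e\<in>supp f. (\<forall>j. b j \<le> snd e j) \<and>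
                   (\<lambda>i. int k * fst e i + (\<Sum>j<M. int (snd e j - b j) * g j i)) = \<alpha>'}.
            f e * (\<Prod>j<M. of_nat (snd e j choose b j) * c j ^ (snd e j - b j)))))"

definition trans_ideal :: "nat \<Rightarrow> nat \<Rightarrow> 'k::comm_ring_1 lpol set \<Rightarrow> 'k wset \<Rightarrow> 'k lpol set" where
  "trans_ideal N M J D = gen_ideal N M {subst_D N M D f | f. f \<in> J}"

fun ideal_seq :: "nat \<Rightarrow> nat \<Rightarrow> 'k::comm_ring_1 lpol set \<Rightarrow> (nat \<Rightarrow> 'k wset) \<Rightarrow> nat \<Rightarrow> 'k lpol set" where
  "ideal_seq N M I S 0 = I"
| "ideal_seq N M I S (Suc i) = trans_ideal N M (ideal_seq N M I S i) (S i)"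

definition omega_sequence :: "nat \<Rightarrow> nat \<Rightarrow> (nat \<Rightarrow> real) \<Rightarrow> 'k::comm_ring_1 lpol set \<Rightarrow> (nat \<Rightarrow> 'k wset) \<Rightarrow> bool" where
  "omega_sequence N M \<omega> I S \<longleftrightarrow>
     (\<forall>i. starting_set N M \<omega> (ideal_seq N M I S i) (S i)) \<and>
     (\<forall>i. \<forall>j\<in>Lam M (fst (S (Suc i))).
         fst (S (Suc i)) j > ereal (real (dG N M (S i))) * fst (S i) j)"

text \<open>A series is its coefficient function on exponents nat => rat (zero for i >= N).\<close>

type_synonym 'k pser = "(nat \<Rightarrow> rat) \<Rightarrow> 'k"

definition rcone :: "nat \<Rightarrow> (nat \<Rightarrow> rat) set \<Rightarrow> (nat \<Rightarrow> rat) set" where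
  "rcone N G = {v. \<exists>t. (\<forall>g\<in>G. t g \<ge> 0) \<and> v = (\<lambda>i. \<Sum>g\<in>G. t g * g i)}"

definition omega_positive :: "nat \<Rightarrow> (nat \<Rightarrow> real) \<Rightarrow> 'k::zero pser \<Rightarrow> bool" where
  "omega_positive N \<omega> \<phi> \<longleftrightarrow>
     (\<forall>a\<in>supp \<phi>. \<forall>i\<ge>N. a i = 0) \<and>
     (\<exists>k::nat. 0 < k \<and> (\<forall>a\<in>supp \<phi>. \<forall>i<N. of_nat k * a i \<in> \<int>)) \<and>
     (\<exists>\<gamma> G. (\<forall>i\<ge>N. \<gamma> i = 0) \<and> finite G \<and> (\<forall>g\<in>G. \<forall>i\<ge>N. g i = 0) \<and>
        (\<forall>v\<in>rcone N G. (\<Sum>i<N. \<omega> i * real_of_rat (v i)) \<ge> 0) \<and>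
        (\<forall>a\<in>supp \<phi>. (\<lambda>i. a i + \<gamma> i) \<in> rcone N G))"

text \<open>Product of series (each coefficient is a finite sum for omega-positive series).\<close>

definition ps_mult :: "'k::comm_ring_1 pser \<Rightarrow> 'k pser \<Rightarrow> 'k pser" where
  "ps_mult \<phi> \<psi> = (\<lambda>v. \<Sum>(a, b)\<in>{(a, b). a \<in> supp \<phi> \<and> b \<in> supp \<psi> \<and> (\<lambda>i. a i + b i) = v}. \<phi> a * \<psi> b)"

definition ps_monom :: "(nat \<Rightarrow> rat) \<Rightarrow> 'k::comm_ring_1 pser" where
  "ps_monom a = (\<lambda>v. if v = a then 1 else 0)"

primrec ps_pow :: "'k::comm_ring_1 pser \<Rightarrow> nat \<Rightarrow> 'k pser" where
  "ps_pow \<phi> 0 = ps_monom (\<lambda>_. 0)"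
| "ps_pow \<phi> (Suc n) = ps_mult (ps_pow \<phi> n) \<phi>"

primrec ps_ymon :: "(nat \<Rightarrow> 'k::comm_ring_1 pser) \<Rightarrow> (nat \<Rightarrow> nat) \<Rightarrow> nat \<Rightarrow> 'k pser" where
  "ps_ymon \<phi> \<beta> 0 = ps_monom (\<lambda>_. 0)"
| "ps_ymon \<phi> \<beta> (Suc m) = ps_mult (ps_ymon \<phi> \<beta> m) (ps_pow (\<phi> m) (\<beta> m))"

definition eval_ser :: "nat \<Rightarrow> 'k::comm_ring_1 lpol \<Rightarrow> (nat \<Rightarrow> 'k pser) \<Rightarrow> 'k pser" where
  "eval_ser M f \<phi> = (\<lambda>v. \<Sum>e\<in>supp f.
      f e * ps_mult (ps_monom (\<lambda>i. of_int (fst e i))) (ps_ymon \<phi> (snd e) M) v)"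

definition omega_solution :: "nat \<Rightarrow> nat \<Rightarrow> (nat \<Rightarrow> real) \<Rightarrow> 'k::comm_ring_1 lpol set \<Rightarrow> (nat \<Rightarrow> 'k pser) \<Rightarrow> bool" where
  "omega_solution N M \<omega> J \<phi> \<longleftrightarrow>
     (\<forall>j<M. omega_positive N \<omega> (\<phi> j)) \<and> (\<forall>f\<in>J. eval_ser M f \<phi> = (\<lambda>_. 0))"

definition r_seq :: "nat \<Rightarrow> nat \<Rightarrow> (nat \<Rightarrow> 'k wset) \<Rightarrow> nat \<Rightarrow> rat" where
  "r_seq N M S i = 1 / of_nat (\<Prod>l<i. dG N M (S l))"

definition ser :: "nat \<Rightarrow> nat \<Rightarrow> (nat \<Rightarrow> 'k::comm_ring_1 wset) \<Rightarrow> nat \<Rightarrow> 'k pser" where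
  "ser N M S j = (\<lambda>v. \<Sum>i\<in>{i. j \<in> Lam M (fst (S i)) \<and>
        v = (\<lambda>l. if l < N then r_seq N M S i * fst (snd (S i)) j l else 0)}.
      snd (snd (S i)) j)"

definition eval_pt :: "nat \<Rightarrow> nat \<Rightarrow> 'k::comm_ring_1 lpol \<Rightarrow> (nat \<Rightarrow> 'k) \<Rightarrow> (nat \<Rightarrow> 'k) \<Rightarrow> 'k" where
  "eval_pt N M f a b = (\<Sum>e\<in>supp f. f e * (\<Prod>i<N. a i ^ nat (fst e i)) * (\<Prod>j<M. b j ^ snd e j))"

definition is_xpoly :: "nat \<Rightarrow> 'k::zero lpol \<Rightarrow> bool" where
  "is_xpoly N g \<longleftrightarrow> lpoly N 0 g \<and> (\<forall>e\<in>supp g. \<forall>i. fst e i \<ge> 0)"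

definition zero_set :: "nat \<Rightarrow> nat \<Rightarrow> 'k::comm_ring_1 lpol set \<Rightarrow> ((nat \<Rightarrow> 'k) \<times> (nat \<Rightarrow> 'k)) set" where
  "zero_set N M J = {(a, b). (\<forall>i\<ge>N. a i = 0) \<and> (\<forall>j\<ge>M. b j = 0) \<and> (\<forall>f\<in>J. eval_pt N M f a b = 0)}"

definition admissible :: "nat \<Rightarrow> nat \<Rightarrow> 'k::comm_ring_1 lpol set \<Rightarrow> bool" where
  "admissible N M I \<longleftrightarrow>
     (let J = {f\<in>I. \<forall>e\<in>supp f. \<forall>i. fst e i \<ge> 0}; V = zero_set N M J in
       \<comment> \<open>dominant: no nonzero polynomial in K[x] vanishes on the image of the projection\<close>
       (\<forall>g. is_xpoly N g \<and> (\<forall>(a, b)\<in>V. eval_pt N M g a b = 0) \<longrightarrow> g = (\<lambda>_. 0)) \<and>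
       \<comment> \<open>finite generic fibre: fibres are finite over a nonempty Zariski open subset\<close>
       (\<exists>g. is_xpoly N g \<and> g \<noteq> (\<lambda>_. 0) \<and>
          (\<forall>a. (\<forall>i\<ge>N. a i = 0) \<and> eval_pt N M g a (\<lambda>_. 0) \<noteq> 0 \<longrightarrow> finite {b. (a, b) \<in> V})))"

definition alg_closed :: "'k::field itself \<Rightarrow> bool" where
  "alg_closed _ \<longleftrightarrow> (\<forall>p::'k poly. 0 < degree p \<longrightarrow> (\<exists>z. poly p z = 0))"

end

theory Submission
  imports Defs "HOL-Library.Poly_Mapping" "HOL-Library.Function_Algebras"
    "HOL-Library.Product_Plus" "HOL-Library.FuncSet"
begin

text \<open>
  Substituting the first \<open>i\<close> terms of the series into \<open>f \<in> I\<close> gives an element of the \<open>i\<close>-th ideal.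
  If \<open>f\<close> did not vanish at the series, then for large \<open>i\<close> the terms of that element that involve
  some \<open>y\<close> would all have larger weight than the initial term of the value of \<open>f\<close>, so its initial
  form would be a monomial in \<open>x\<close>, which the tropical condition forbids.

  This needs the orders of the terms of each coordinate \<open>y\<^sub>j\<close> to tend to infinity and the denominators
  to be bounded. Finiteness of the generic fibre yields a nonzero element of \<open>I\<close> that involves no
  \<open>y\<^sub>l\<close> with \<open>l \<noteq> j\<close>: otherwise a prime ideal above \<open>I\<close> meets \<open>K[x\<^sup>*, y\<^sub>j]\<close> in zero and a general
  point of the \<open>(x, y\<^sub>j)\<close>-space extends to a zero of it. Along this one polynomial the algorithm is the
  classical Newton-Puiseux procedure: the multiplicity of the root \<open>c\<close> of the initial form never
  increases, and once it is constant all further exponents lie in the lattice reached so far and in a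
  finitely generated semigroup of nonnegative weight.
\<close>

subsection \<open>Extension of homomorphisms modulo a prime ideal\<close>

text \<open>An omega-sequence only asks for increasing orders. Nothing in its definition keeps them
  from accumulating, or the denominators from growing, and an initial form in several y does not
  control a single coordinate. An element of \<open>I\<close> in x and y_j alone does: the
  substitutions keep it in K[x*, y_j] without raising its y_j-degree, and c_j remains a root of its
  initial form because c is a zero of the whole initial ideal.

  The elimination step uses no dimension theory. Zorn's lemma gives a prime that avoids the nonzero
  elements of K[x*, y_j], and a point is extended through it one variable at a time. The y_j-value
  may be anything outside a finite set, so it can be taken outside the y_j-coordinates of a finite
  fibre.

  Rational independence of the coordinates of omega makes an exponent recoverable from its real
  weight. The one-variable procedure is therefore run on real numbers, and its conclusions are
  carried back to exponent vectors.\<close>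

definition subring_of :: "'r::comm_ring_1 set \<Rightarrow> bool" where
  "subring_of A \<longleftrightarrow> 1 \<in> A \<and> (\<forall>x\<in>A. \<forall>y\<in>A. x + y \<in> A \<and> x * y \<in> A) \<and> (\<forall>x\<in>A. - x \<in> A)"

definition polys_over :: "'r::comm_ring_1 set \<Rightarrow> 'r poly set" where
  "polys_over A = {p. \<forall>i. coeff p i \<in> A}"

text \<open>One prime \<open>P\<close> of the largest ring \<open>C\<close> is fixed, and the
  smaller rings are treated modulo their intersection with \<open>P\<close>. This replaces quotient
  rings, and no ring of the tower needs a type of its own.\<close>

definition prime_in :: "'r::comm_ring_1 set \<Rightarrow> 'r set \<Rightarrow> bool" where
  "prime_in C P \<longleftrightarrow> P \<subseteq> C \<and> 0 \<in> P \<and> 1 \<notin> P \<and> (\<forall>x\<in>P. \<forall>y\<in>P. x + y \<in> P) \<and>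
     (\<forall>x\<in>C. \<forall>y\<in>P. x * y \<in> P) \<and> (\<forall>x\<in>C. \<forall>y\<in>C. x * y \<in> P \<longrightarrow> x \<in> P \<or> y \<in> P)"

definition hom_on :: "'r::comm_ring_1 set \<Rightarrow> ('r \<Rightarrow> 'k::field) \<Rightarrow> bool" where
  "hom_on A \<phi> \<longleftrightarrow> \<phi> 1 = 1 \<and> (\<forall>x\<in>A. \<forall>y\<in>A. \<phi> (x + y) = \<phi> x + \<phi> y \<and> \<phi> (x * y) = \<phi> x * \<phi> y)"

lemma subring_ofD:
  assumes "subring_of A"
  shows "0 \<in> A" "1 \<in> A" "x \<in> A \<Longrightarrow> y \<in> A \<Longrightarrow> x + y \<in> A" "x \<in> A \<Longrightarrow> y \<in> A \<Longrightarrow> x * y \<in> A"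
    "x \<in> A \<Longrightarrow> - x \<in> A" "x \<in> A \<Longrightarrow> y \<in> A \<Longrightarrow> x - y \<in> A" "x \<in> A \<Longrightarrow> x ^ n \<in> A"
proof -
  show 1: "1 \<in> A" "x \<in> A \<Longrightarrow> y \<in> A \<Longrightarrow> x + y \<in> A" "x \<in> A \<Longrightarrow> y \<in> A \<Longrightarrow> x * y \<in> A" "x \<in> A \<Longrightarrow> - x \<in> A"
    for x y using assms by (auto simp: subring_of_def)
  have "1 + (- 1) \<in> A" using 1 by blast
  then show "0 \<in> A" by simp
  show "x \<in> A \<Longrightarrow> y \<in> A \<Longrightarrow> x - y \<in> A" using 1(2)[of x "- y"] 1(4)[of y] by simp
  show "x \<in> A \<Longrightarrow> x ^ n \<in> A" by (induction n) (use 1 in auto)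
qed

lemma subring_of_sum: "subring_of A \<Longrightarrow> (\<And>i. i \<in> S \<Longrightarrow> f i \<in> A) \<Longrightarrow> sum f S \<in> A"
  by (induction S rule: infinite_finite_induct) (auto simp: subring_ofD)

lemma polys_over_closed:
  assumes "subring_of A"
  shows "p \<in> polys_over A \<Longrightarrow> q \<in> polys_over A \<Longrightarrow> p + q \<in> polys_over A"
    "p \<in> polys_over A \<Longrightarrow> q \<in> polys_over A \<Longrightarrow> p - q \<in> polys_over A"
    "p \<in> polys_over A \<Longrightarrow> q \<in> polys_over A \<Longrightarrow> p * q \<in> polys_over A"
    "a \<in> A \<Longrightarrow> p \<in> polys_over A \<Longrightarrow> smult a p \<in> polys_over A"
    "a \<in> A \<Longrightarrow> monom a n \<in> polys_over A"
    "a \<in> A \<Longrightarrow> [:a:] \<in> polys_over A"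
    "0 \<in> polys_over A"
  using subring_ofD[OF assms]
  by (auto simp: polys_over_def coeff_mult coeff_pCons split: nat.splits intro!: subring_of_sum[OF assms])

lemma poly_in_subring:
  "subring_of B \<Longrightarrow> A \<subseteq> B \<Longrightarrow> u \<in> B \<Longrightarrow> p \<in> polys_over A \<Longrightarrow> poly p u \<in> B"
  unfolding poly_altdef polys_over_def by (intro subring_of_sum subring_ofD) auto

lemma hom_on_zero: "subring_of A \<Longrightarrow> hom_on A \<phi> \<Longrightarrow> \<phi> 0 = 0"
  unfolding hom_on_def by (metis add_cancel_right_right subring_ofD(1))

lemma hom_on_sum:
  assumes "subring_of A" "hom_on A \<phi>"
  shows "(\<And>i. i \<in> S \<Longrightarrow> f i \<in> A) \<Longrightarrow> \<phi> (sum f S) = (\<Sum>i\<in>S. \<phi> (f i))"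
proof (induction S rule: infinite_finite_induct)
  case (insert x F)
  then show ?case using assms subring_of_sum[OF assms(1), of F f] by (auto simp: hom_on_def)
qed (use assms hom_on_zero in auto)

lemma hom_on_power:
  assumes "subring_of A" "hom_on A \<phi>" "x \<in> A"
  shows "\<phi> (x ^ n) = \<phi> x ^ n"
  using assms subring_ofD[OF assms(1)] by (induction n) (auto simp: hom_on_def)

lemma hom_on_minus:
  assumes "subring_of A" "hom_on A \<phi>" "x \<in> A" "y \<in> A"
  shows "\<phi> (x - y) = \<phi> x - \<phi> y"
proof -
  have "\<forall>x\<in>A. \<forall>y\<in>A. \<phi> (x + y) = \<phi> x + \<phi> y" using assms(2) by (simp add: hom_on_def)
  then have "\<phi> (x - y + y) = \<phi> (x - y) + \<phi> y" using subring_ofD(6)[OF assms(1,3,4)] assms(4) by blast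
  then show ?thesis by simp
qed

text \<open>Nothing is known about \<phi> outside \<open>A\<close>, so
  \<open>map_poly \<phi>\<close> respects the operations only on polynomials over \<open>A\<close>;
  hence the membership hypotheses.\<close>

lemma map_poly_hom_on:
  assumes "subring_of A" "hom_on A \<phi>" "p \<in> polys_over A" "q \<in> polys_over A"
  shows "map_poly \<phi> (p + q) = map_poly \<phi> p + map_poly \<phi> q"
    "map_poly \<phi> (p - q) = map_poly \<phi> p - map_poly \<phi> q"
    "map_poly \<phi> (p * q) = map_poly \<phi> p * map_poly \<phi> q"
    "a \<in> A \<Longrightarrow> map_poly \<phi> (smult a p) = smult (\<phi> a) (map_poly \<phi> p)"
proof -
  have z: "\<phi> 0 = 0" using assms hom_on_zero by blast
  have c: "coeff p i \<in> A" "coeff q i \<in> A" for i using assms by (auto simp: polys_over_def)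
  have m: "\<phi> (x * y) = \<phi> x * \<phi> y" "\<phi> (x + y) = \<phi> x + \<phi> y" if "x \<in> A" "y \<in> A" for x y
    using assms that by (auto simp: hom_on_def)
  show "map_poly \<phi> (p + q) = map_poly \<phi> p + map_poly \<phi> q"
    by (rule poly_eqI) (simp add: coeff_map_poly z m c)
  show "map_poly \<phi> (p - q) = map_poly \<phi> p - map_poly \<phi> q"
    by (rule poly_eqI) (simp add: coeff_map_poly z hom_on_minus[OF assms(1,2)] c)
  show "map_poly \<phi> (p * q) = map_poly \<phi> p * map_poly \<phi> q"
    by (rule poly_eqI)
      (simp add: coeff_map_poly z coeff_mult hom_on_sum[OF assms(1,2)] subring_ofD[OF assms(1)] c m)
  show "map_poly \<phi> (smult a p) = smult (\<phi> a) (map_poly \<phi> p)" if "a \<in> A"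
    by (rule poly_eqI) (simp add: coeff_map_poly z m c that)
qed

text \<open>The leading coefficient of \<open>P\<close> need not be invertible, so \<open>q\<close>
  is first multiplied by a power of it; quotient and remainder then keep their coefficients in
  \<open>A\<close>. The degree bound on \<open>s\<close> later shows that a quotient is shorter than
  a minimal relation.\<close>

lemma pseudo_division_over:
  assumes A: "subring_of A" and P: "P \<in> polys_over A" "0 < degree P"
  shows "q \<in> polys_over A \<Longrightarrow> \<exists>k s r. s \<in> polys_over A \<and> r \<in> polys_over A \<and>
    smult (lead_coeff P ^ k) q = P * s + r \<and> degree r < degree P \<and> degree s \<le> degree q - degree P"
proof (induction "degree q" arbitrary: q rule: less_induct)
  case less
  note cl = polys_over_closed[OF A]
  have lc: "lead_coeff P \<in> A" "lead_coeff q \<in> A" using less P by (auto simp: polys_over_def)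
  show ?case
  proof (cases "degree q < degree P")
    case True
    then show ?thesis using less cl(7) by (intro exI[of _ 0] exI[of _ q]) auto
  next
    case False
    let ?m = "monom (lead_coeff q) (degree q - degree P)"
    define q' where "q' = smult (lead_coeff P) q - ?m * P"
    have q': "q' \<in> polys_over A" unfolding q'_def using less P lc cl by auto
    have "degree (?m * P) \<le> degree q"
      by (rule order.trans[OF degree_mult_le]) (use False degree_monom_le[of "lead_coeff q" "degree q - degree P"] in linarith)
    then have d: "degree q' \<le> degree q" unfolding q'_def
      by (intro degree_diff_le degree_smult_le)
    \<comment> \<open>The ring may have zero divisors, so degrees of products are only bounded from
      above. The cancellation is read off at the coefficient of \<open>degree q\<close>.\<close>
    have "coeff (?m * P) (degree q) = lead_coeff q * lead_coeff P"
      using False by (simp add: coeff_monom_mult)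
    then have "coeff q' (degree q) = 0" by (simp add: q'_def)
    then have dl: "degree q' < degree q"
      using d False P(2) by (metis degree_0 le_neq_implies_less leading_coeff_0_iff not_less order.strict_trans2)
    obtain k s r where h: "s \<in> polys_over A" "r \<in> polys_over A"
      "smult (lead_coeff P ^ k) q' = P * s + r" "degree r < degree P" "degree s \<le> degree q' - degree P"
      using less.hyps[OF dl q'] by blast
    let ?s = "s + smult (lead_coeff P ^ k) ?m"
    have "smult (lead_coeff P ^ Suc k) q = P * ?s + r"
    proof -
      have "smult (lead_coeff P ^ Suc k) q = smult (lead_coeff P ^ k) (q' + ?m * P)"
        by (simp add: q'_def mult.commute)
      also have "\<dots> = P * ?s + r" by (simp add: smult_add_right h(3) algebra_simps)
      finally show ?thesis .
    qed
    moreover have "degree ?s \<le> degree q - degree P"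
      using h(5) dl by (intro degree_add_le order.trans[OF degree_smult_le] degree_monom_le) linarith
    moreover have "?s \<in> polys_over A" using h lc cl subring_ofD[OF A] by auto
    ultimately show ?thesis using h by blast
  qed
qed

lemma prime_inD:
  assumes "prime_in C P"
  shows "P \<subseteq> C" "0 \<in> P" "1 \<notin> P" "x \<in> P \<Longrightarrow> y \<in> P \<Longrightarrow> x + y \<in> P" "x \<in> C \<Longrightarrow> y \<in> P \<Longrightarrow> x * y \<in> P"
    "x \<in> C \<Longrightarrow> y \<in> C \<Longrightarrow> x * y \<in> P \<Longrightarrow> x \<in> P \<or> y \<in> P"
  using assms by (auto simp: prime_in_def)

lemma prime_in_diff:
  assumes "subring_of C" "prime_in C P" "x \<in> P" "y \<in> P"
  shows "x - y \<in> P"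
proof -
  have "(- 1) * y \<in> P" by (intro prime_inD(5)[OF assms(2)] subring_ofD[OF assms(1)] assms)
  then have "x + (- 1) * y \<in> P" by (intro prime_inD(4)[OF assms(2)] assms)
  then show ?thesis by simp
qed

lemma prime_in_power:
  assumes "subring_of C" "prime_in C P" "x \<in> C" "x ^ n \<in> P"
  shows "x \<in> P"
  using assms(4)
proof (induction n)
  case (Suc n)
  then show ?case using prime_inD(6)[OF assms(2,3), of "x ^ n"] subring_ofD(7)[OF assms(1,3)] by auto
qed (use prime_inD(3)[OF assms(2)] in auto)

lemma prime_in_sum:
  "prime_in C P \<Longrightarrow> (\<And>i. i \<in> S \<Longrightarrow> f i \<in> P) \<Longrightarrow> sum f S \<in> P"
  by (induction S rule: infinite_finite_induct) (auto simp: prime_inD)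

text \<open>Sending \<open>q(u)\<close> to the value of \<open>map_poly \<phi> q\<close> at \<beta>
  is well defined, since two representatives differ by a relation, which \<open>root\<close>
  annihilates at \<beta>. Relations are taken modulo \<open>P\<close>, so the extension also
  vanishes on \<open>B \<inter> P\<close>.\<close>

lemma hom_extends_by_root:
  fixes \<phi> :: "'r::comm_ring_1 \<Rightarrow> 'k::field"
  assumes A: "subring_of A" and B: "subring_of B" and AB: "A \<subseteq> B"
    and gen: "B \<subseteq> {poly q u | q. q \<in> polys_over A}" and P: "0 \<in> P"
    and \<phi>: "hom_on A \<phi>" and root: "\<And>q. q \<in> polys_over A \<Longrightarrow> poly q u \<in> P \<Longrightarrow> poly (map_poly \<phi> q) \<beta> = 0"
  obtains \<psi> where "hom_on B \<psi>" "\<And>x. x \<in> A \<Longrightarrow> \<psi> x = \<phi> x" "\<And>x. x \<in> B \<inter> P \<Longrightarrow> \<psi> x = 0"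
    "\<And>q. q \<in> polys_over A \<Longrightarrow> \<psi> (poly q u) = poly (map_poly \<phi> q) \<beta>"
proof
  define \<psi> where "\<psi> b = poly (map_poly \<phi> (SOME q. q \<in> polys_over A \<and> poly q u = b)) \<beta>" for b
  note cl = polys_over_closed[OF A]
  have z: "\<phi> 0 = 0" using hom_on_zero A \<phi> by blast
  show *: "\<psi> (poly q u) = poly (map_poly \<phi> q) \<beta>" if q: "q \<in> polys_over A" for q
  proof -
    define q' where "q' = (SOME q'. q' \<in> polys_over A \<and> poly q' u = poly q u)"
    have q': "q' \<in> polys_over A \<and> poly q' u = poly q u" unfolding q'_def by (rule someI[of _ q]) (use q in auto)
    have "poly (map_poly \<phi> (q' - q)) \<beta> = 0" by (rule root) (use q q' cl P in auto)
    then show ?thesis using q q' by (simp add: map_poly_hom_on[OF A \<phi>] \<psi>_def q'_def)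
  qed
  show "\<psi> x = \<phi> x" if "x \<in> A" for x
    using *[OF cl(6)[OF that]] by (simp add: map_poly_pCons z)
  then have "\<psi> 1 = 1" using \<phi> subring_ofD(2)[OF A] by (simp add: hom_on_def)
  moreover have "\<psi> (x + y) = \<psi> x + \<psi> y \<and> \<psi> (x * y) = \<psi> x * \<psi> y" if xy: "x \<in> B" "y \<in> B" for x y
  proof -
    obtain p q where pq: "p \<in> polys_over A" "q \<in> polys_over A" and x: "x = poly p u" and y: "y = poly q u" using gen xy by blast
    have "x + y = poly (p + q) u" "x * y = poly (p * q) u" using x y by auto
    then show ?thesis unfolding x y using * cl pq by (simp add: map_poly_hom_on[OF A \<phi>] del: poly_add poly_mult) (simp add: map_poly_hom_on[OF A \<phi>])
  qed
  ultimately show "hom_on B \<psi>" by (simp add: hom_on_def)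
  show "\<psi> x = 0" if "x \<in> B \<inter> P" for x
    using that gen * root by fastforce
qed

text \<open>
  If \<open>u\<close> satisfies no relation over \<open>A\<close> modulo \<open>P\<close>, almost every value for \<open>u\<close> works. Otherwise \<open>u\<close> is
  sent to a root of a relation \<open>P0\<close> of minimal degree: pseudo-division by \<open>P0\<close> shows that all relations
  are respected, and the constant \<open>W\<close>, a multiple of \<open>v\<close> modulo \<open>P\<close>, keeps \<open>v\<close> away from zero.
\<close>

lemma hom_extends_simple:
  fixes A B C P :: "'r::comm_ring_1 set" and u v :: 'r
  assumes ac: "alg_closed TYPE('k::field_char_0)"
    and A: "subring_of A" and B: "subring_of B" and C: "subring_of C" and AB: "A \<subseteq> B" and BC: "B \<subseteq> C"
    and u: "u \<in> B" and gen: "B \<subseteq> {poly q u | q. q \<in> polys_over A}"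
    and P: "prime_in C P" and v: "v \<in> B" "v \<notin> P"
  shows "\<exists>h\<in>A. h \<notin> P \<and> (\<forall>\<phi>::'r \<Rightarrow> 'k. hom_on A \<phi> \<and> (\<forall>x\<in>A \<inter> P. \<phi> x = 0) \<and> \<phi> h \<noteq> 0 \<longrightarrow>
    (\<exists>\<psi>. hom_on B \<psi> \<and> (\<forall>x\<in>A. \<psi> x = \<phi> x) \<and> (\<forall>x\<in>B \<inter> P. \<psi> x = 0) \<and> \<psi> v \<noteq> 0))"
proof -
  note cl = polys_over_closed[OF A]
  note Ad = subring_ofD[OF A] and Bd = subring_ofD[OF B] and Cd = subring_ofD[OF C] and Pd = prime_inD[OF P]
  have inB: "poly p u \<in> B" if "p \<in> polys_over A" for p using poly_in_subring[OF B AB u that] .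
  have inC: "poly p u \<in> C" if "p \<in> polys_over A" for p using inB[OF that] BC by blast
  have cA: "coeff p i \<in> A" if "p \<in> polys_over A" for p i using that by (auto simp: polys_over_def)
  have AC: "x \<in> C" if "x \<in> A" for x using that AB BC by blast
  have uC: "u \<in> C" using u BC by blast
  obtain V where V: "V \<in> polys_over A" "v = poly V u" using gen v by blast
  have polyP: "poly p u \<in> P" if "\<And>i. coeff p i \<in> P" for p
    unfolding poly_altdef by (rule prime_in_sum[OF P]) (metis Cd(7) Pd(5) mult.commute that uC)
  show ?thesis
  proof (cases "\<forall>p\<in>polys_over A. poly p u \<in> P \<longrightarrow> (\<forall>i. coeff p i \<in> P)")
    case True
    \<comment> \<open>If all coefficients of \<open>V\<close> were in \<open>P\<close>, so would be
      \<open>v\<close>. If \<phi> does not kill this coefficient, the image of \<open>V\<close> is a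
      nonzero polynomial, and only its finitely many roots must be avoided as values for
      \<open>u\<close>.\<close>
    obtain n where n: "coeff V n \<notin> P" using polyP V v by blast
    show ?thesis
    proof (intro bexI[of _ "coeff V n"] conjI allI impI)
      fix \<phi> :: "'r \<Rightarrow> 'k" assume \<phi>: "hom_on A \<phi> \<and> (\<forall>x\<in>A \<inter> P. \<phi> x = 0) \<and> \<phi> (coeff V n) \<noteq> 0"
      then have z: "\<phi> 0 = 0" using hom_on_zero A by blast
      have "coeff (map_poly \<phi> V) n \<noteq> 0" using \<phi> z by (simp add: coeff_map_poly)
      then have "map_poly \<phi> V \<noteq> 0" by auto
      then have "finite {x. poly (map_poly \<phi> V) x = 0}" by (rule poly_roots_finite)
      then obtain \<beta> where \<beta>: "poly (map_poly \<phi> V) \<beta> \<noteq> 0"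
        using infinite_UNIV_char_0[where 'a='k] by (metis (mono_tags, lifting) UNIV_eq_I mem_Collect_eq)
      have rt: "poly (map_poly \<phi> q) \<beta> = 0" if "q \<in> polys_over A" "poly q u \<in> P" for q
      proof -
        have "map_poly \<phi> q = 0" using True that \<phi> cA by (intro poly_eqI) (auto simp: coeff_map_poly z)
        then show ?thesis by simp
      qed
      obtain \<psi> where "hom_on B \<psi>" "\<And>x. x \<in> A \<Longrightarrow> \<psi> x = \<phi> x" "\<And>x. x \<in> B \<inter> P \<Longrightarrow> \<psi> x = 0"
        "\<And>q. q \<in> polys_over A \<Longrightarrow> \<psi> (poly q u) = poly (map_poly \<phi> q) \<beta>"
        using hom_extends_by_root[OF A B AB gen Pd(2) conjunct1[OF \<phi>] rt] by blast
      then show "\<exists>\<psi>. hom_on B \<psi> \<and> (\<forall>x\<in>A. \<psi> x = \<phi> x) \<and> (\<forall>x\<in>B \<inter> P. \<psi> x = 0) \<and> \<psi> v \<noteq> 0"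
        using V \<beta> by (intro exI[of _ \<psi>]) auto
    qed (use n cA V in auto)
  next
    case False
    \<comment> \<open>A leading term with coefficient in \<open>P\<close> can be discarded without
      changing the value at \<open>u\<close> modulo \<open>P\<close>. Hence polynomials of minimal
      degree have leading coefficient outside \<open>P\<close>; the disjunct
      \<open>degree p = 0\<close> is there because a constant has no smaller degree to drop
      to.\<close>
    have drop_lead: "p - monom (lead_coeff p) (degree p) \<in> polys_over A \<and>
        poly (p - monom (lead_coeff p) (degree p)) u - poly p u \<in> P \<and>
        (degree p = 0 \<or> degree (p - monom (lead_coeff p) (degree p)) < degree p)"
      if p: "p \<in> polys_over A" "lead_coeff p \<in> P" for p
    proof (intro conjI)
      let ?p = "p - monom (lead_coeff p) (degree p)"
      show "?p \<in> polys_over A" using p cl cA by auto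
      have "- (u ^ degree p) * lead_coeff p \<in> P" by (intro Pd(5) p Cd(5) Cd(7) uC)
      then show "poly ?p u - poly p u \<in> P" by (simp add: poly_monom mult.commute)
      have "degree ?p \<le> degree p" by (intro degree_diff_le) (auto simp: degree_monom_le)
      moreover have "coeff ?p (degree p) = 0" by simp
      ultimately show "degree p = 0 \<or> degree ?p < degree p"
        by (metis degree_0 gr0I le_neq_implies_less leading_coeff_0_iff)
    qed
    define Q where "Q p \<longleftrightarrow> p \<in> polys_over A \<and> poly p u \<in> P \<and> (\<exists>i. coeff p i \<notin> P)" for p
    obtain P1 where "Q P1" using False by (auto simp: Q_def)
    then obtain P0 where P0: "Q P0" and P0min: "\<And>p. Q p \<Longrightarrow> degree P0 \<le> degree p"
      using ex_has_least_nat[of Q P1 degree] by blast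
    have small: "coeff p i \<in> P" if "p \<in> polys_over A" "poly p u \<in> P" "degree p < degree P0" for p i
      using P0min[of p] that unfolding Q_def by force
    let ?n = "degree P0" and ?a = "lead_coeff P0"
    have P0A: "P0 \<in> polys_over A" "poly P0 u \<in> P" using P0 by (auto simp: Q_def)
    have n0: "0 < ?n"
    proof (rule ccontr)
      assume "\<not> 0 < ?n"
      then obtain c where "P0 = [:c:]" by (metis degree_eq_zeroE gr0I)
      then have "coeff P0 i \<in> P" for i using P0A(2) Pd(2) by (cases i) auto
      then show False using P0 by (auto simp: Q_def)
    qed
    have a: "?a \<notin> P"
    proof
      assume l: "?a \<in> P"
      let ?p = "P0 - monom ?a ?n"
      have "poly ?p u - poly P0 u + poly P0 u \<in> P" using drop_lead[OF P0A(1) l] Pd(4) P0A by blast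
      then have "poly ?p u \<in> P" by simp
      moreover have "degree ?p < ?n" using drop_lead[OF P0A(1) l] n0 by auto
      ultimately have c: "coeff ?p i \<in> P" for i using small drop_lead[OF P0A(1) l] by blast
      have "coeff P0 i \<in> P" for i
        using c[of i] l by (cases "i = ?n") auto
      then show False using P0 by (auto simp: Q_def)
    qed
    have red: "poly r u \<in> P" if "poly p u \<in> P" "smult (?a ^ k) p = P0 * s + r" "s \<in> polys_over A" for p k s r
    proof -
      have "poly r u = ?a ^ k * poly p u - poly s u * poly P0 u"
        using arg_cong[OF that(2), of "\<lambda>p. poly p u"] by (simp add: algebra_simps)
      also have "\<dots> \<in> P" using that P0A cA[OF P0A(1)] by (intro prime_in_diff[OF C P] Pd(5) Cd(7) AC inC) auto
      finally show ?thesis .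
    qed
    \<comment> \<open>The value of such a \<open>W\<close> at \<open>u\<close> is a multiple of
      \<open>v\<close> modulo \<open>P\<close> and is not in \<open>P\<close>. A member of degree 0
      is an element of \<open>A\<close>, and whenever \<phi> does not kill it, the extension cannot
      kill \<open>v\<close>.\<close>
    define R where "R W \<longleftrightarrow> W \<in> polys_over A \<and> poly W u \<notin> P \<and> (\<exists>s\<in>B. poly W u - s * v \<in> P)" for W
    have "R V" unfolding R_def using V v Bd(2) Pd(2) by (auto intro!: bexI[of _ 1])
    then obtain W where W: "R W" and Wmin: "\<And>p. R p \<Longrightarrow> degree W \<le> degree p"
      using ex_has_least_nat[of R V degree] by blast
    have WA: "W \<in> polys_over A" "poly W u \<notin> P" using W by (auto simp: R_def)
    obtain s0 where s0: "s0 \<in> B" "poly W u - s0 * v \<in> P" using W by (auto simp: R_def)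
    \<comment> \<open>This is a Euclidean argument between \<open>W\<close> and \<open>P0\<close>.
      If \<open>W\<close> is the longer one, its remainder modulo \<open>P0\<close> is a shorter
      member of \<open>R\<close>. Otherwise \<open>P0\<close> is divided by \<open>W\<close>:
      minimality puts the value of the remainder into \<open>P\<close>, so the quotient
      \<open>s\<close> is a relation shorter than \<open>P0\<close> and all its coefficients lie in
      \<open>P\<close>. The coefficient of degree \<open>?n\<close> then places a product of two
      leading coefficients outside \<open>P\<close> into \<open>P\<close>.\<close>
    have W0: "degree W = 0"
    proof (rule ccontr)
      assume m0: "degree W \<noteq> 0"
      have lW: "lead_coeff W \<notin> P"
      proof
        assume l: "lead_coeff W \<in> P"
        let ?W = "W - monom (lead_coeff W) (degree W)"
        note dl = drop_lead[OF WA(1) l]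
        have "(poly ?W u - poly W u) + (poly W u - s0 * v) \<in> P" using dl s0 Pd(4) by blast
        then have "poly ?W u - s0 * v \<in> P" by (simp add: algebra_simps)
        moreover have "poly ?W u \<notin> P"
        proof
          assume "poly ?W u \<in> P"
          then have "poly ?W u - (poly ?W u - poly W u) \<in> P" using dl prime_in_diff[OF C P] by blast
          then show False using WA by simp
        qed
        ultimately have "R ?W" unfolding R_def using dl s0 by blast
        then show False using Wmin dl m0 by fastforce
      qed
      have Wn: "degree W \<le> ?n"
      proof (rule ccontr)
        assume gt: "\<not> degree W \<le> ?n"
        obtain k s r where h: "s \<in> polys_over A" "r \<in> polys_over A"
          "smult (?a ^ k) W = P0 * s + r" "degree r < ?n"
          using pseudo_division_over[OF A P0A(1) n0 WA(1)] by blast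
        have e: "poly r u = ?a ^ k * poly W u - poly s u * poly P0 u"
          using arg_cong[OF h(3), of "\<lambda>p. poly p u"] by (simp add: algebra_simps)
        have Ps: "poly s u * poly P0 u \<in> P" using P0A inC h by (intro Pd(5)) auto
        have aC: "?a \<in> C" using cA[OF P0A(1)] AC by auto
        have "poly r u \<notin> P"
        proof
          assume "poly r u \<in> P"
          then have "?a ^ k * poly W u \<in> P" using Pd(4)[OF _ Ps, of "poly r u"] unfolding e by simp
          then show False
            using Pd(6)[of "?a ^ k" "poly W u"] Cd(7) aC inC WA a prime_in_power[OF C P aC] by blast
        qed
        moreover have "poly r u - (?a ^ k * s0) * v \<in> P"
        proof -
          have "?a ^ k * (poly W u - s0 * v) - poly s u * poly P0 u \<in> P"
            by (rule prime_in_diff[OF C P Pd(5)[OF Cd(7)[OF aC] s0(2)] Ps])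
          then show ?thesis unfolding e by (simp add: algebra_simps)
        qed
        moreover have "?a ^ k * s0 \<in> B" using s0 cA[OF P0A(1)] AB by (intro Bd(4) Bd(7)) auto
        ultimately have "R r" unfolding R_def using h by blast
        then show False using Wmin[of r] h gt by auto
      qed
      obtain k s r where h: "s \<in> polys_over A" "r \<in> polys_over A"
        "smult (lead_coeff W ^ k) P0 = W * s + r" "degree r < degree W" "degree s \<le> ?n - degree W"
        using pseudo_division_over[OF A WA(1) _ P0A(1)] m0 by blast
      have e: "poly r u = lead_coeff W ^ k * poly P0 u - poly s u * poly W u"
        using arg_cong[OF h(3), of "\<lambda>p. poly p u"] by (simp add: algebra_simps)
      have lWC: "lead_coeff W \<in> C" using cA[OF WA(1)] AC by auto
      have lP: "lead_coeff W ^ k * poly P0 u \<in> P" using P0A lWC by (intro Pd(5) Cd(7)) auto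
      have "poly r u \<in> P"
      proof (rule ccontr)
        assume "poly r u \<notin> P"
        moreover have "poly r u - (- poly s u * s0) * v \<in> P"
        proof -
          have "lead_coeff W ^ k * poly P0 u - poly s u * (poly W u - s0 * v) \<in> P"
            by (rule prime_in_diff[OF C P lP Pd(5)[OF inC[OF h(1)] s0(2)]])
          then show ?thesis unfolding e by (simp add: algebra_simps)
        qed
        moreover have "- poly s u * s0 \<in> B" using s0 inB h by (intro Bd(4) Bd(5)) auto
        ultimately have "R r" unfolding R_def using h by blast
        then show False using Wmin[of r] h by auto
      qed
      then have "lead_coeff W ^ k * poly P0 u - poly r u \<in> P" using lP prime_in_diff[OF C P] by blast
      then have "poly s u * poly W u \<in> P" unfolding e by simp
      then have sP: "poly s u \<in> P" using Pd(6) inC h WA by blast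
      have "degree s < ?n" using h(5) m0 n0 by auto
      then have "coeff s i \<in> P" for i using small[OF h(1) sP] by blast
      then have "coeff (W * s) ?n \<in> P" unfolding coeff_mult
        by (intro prime_in_sum[OF P] Pd(5) AC cA WA) auto
      moreover have "coeff (W * s) ?n = lead_coeff W ^ k * ?a"
        using arg_cong[OF h(3), of "\<lambda>p. coeff p ?n"] coeff_eq_0[of r ?n] h(4) Wn by simp
      ultimately have "lead_coeff W ^ k * ?a \<in> P" by simp
      then show False
        using Pd(6)[of "lead_coeff W ^ k" ?a] Cd(7) lWC AC cA[OF P0A(1)] a lW prime_in_power[OF C P lWC] by blast
    qed
    then obtain d where d: "W = [:d:]" by (metis degree_eq_zeroE)
    have dA: "d \<in> A" "d \<notin> P" using WA d cA[OF WA(1), of 0] by auto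
    have ds: "d - s0 * v \<in> P" using s0 d by simp
    have aA: "?a \<in> A" using cA[OF P0A(1)] by auto
    \<comment> \<open>The factor \<open>?a\<close> keeps the degree of the image of
      \<open>P0\<close> positive, so that the image has a root. The factor \<open>d\<close> keeps
      \<open>v\<close> from being sent to zero.\<close>
    show ?thesis
    proof (intro bexI[of _ "?a * d"] conjI allI impI notI)
      assume "?a * d \<in> P" then show False using Pd(6) AC aA dA a by blast
    next
      fix \<phi> :: "'r \<Rightarrow> 'k" assume \<phi>: "hom_on A \<phi> \<and> (\<forall>x\<in>A \<inter> P. \<phi> x = 0) \<and> \<phi> (?a * d) \<noteq> 0"
      then have hm: "hom_on A \<phi>" and z: "\<phi> 0 = 0" using hom_on_zero A by blast+
      have nz: "\<phi> ?a \<noteq> 0" "\<phi> d \<noteq> 0" using \<phi> aA dA(1) by (auto simp: hom_on_def)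
      have "coeff (map_poly \<phi> P0) ?n \<noteq> 0" using nz by (simp add: coeff_map_poly z)
      then have "0 < degree (map_poly \<phi> P0)" using le_degree n0 by fastforce
      then obtain \<beta> where \<beta>: "poly (map_poly \<phi> P0) \<beta> = 0" using ac unfolding alg_closed_def by blast
      have rt: "poly (map_poly \<phi> q) \<beta> = 0" if q: "q \<in> polys_over A" "poly q u \<in> P" for q
      proof -
        obtain k s r where h: "s \<in> polys_over A" "r \<in> polys_over A"
          "smult (?a ^ k) q = P0 * s + r" "degree r < ?n"
          using pseudo_division_over[OF A P0A(1) n0 q(1)] by blast
        have "coeff r i \<in> P" for i using small[OF h(2)] red[OF q(2) h(3,1)] h(4) by blast
        then have "map_poly \<phi> r = 0" using \<phi> cA[OF h(2)] by (intro poly_eqI) (auto simp: coeff_map_poly z)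
        moreover have "map_poly \<phi> (smult (?a ^ k) q) = map_poly \<phi> P0 * map_poly \<phi> s + map_poly \<phi> r"
          unfolding h(3) using h P0A cl by (simp add: map_poly_hom_on[OF A hm])
        moreover have "map_poly \<phi> (smult (?a ^ k) q) = smult (\<phi> ?a ^ k) (map_poly \<phi> q)"
          using map_poly_hom_on(4)[OF A hm q(1) q(1), of "?a ^ k"] hom_on_power[OF A hm aA] Ad(7)[OF aA] by simp
        ultimately have "smult (\<phi> ?a ^ k) (map_poly \<phi> q) = map_poly \<phi> P0 * map_poly \<phi> s" by simp
        from arg_cong[OF this, of "\<lambda>p. poly p \<beta>"] show ?thesis using \<beta> nz by simp
      qed
      obtain \<psi> where \<psi>: "hom_on B \<psi>" "\<And>x. x \<in> A \<Longrightarrow> \<psi> x = \<phi> x" "\<And>x. x \<in> B \<inter> P \<Longrightarrow> \<psi> x = 0"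
        "\<And>q. q \<in> polys_over A \<Longrightarrow> \<psi> (poly q u) = poly (map_poly \<phi> q) \<beta>"
        by (rule hom_extends_by_root[OF A B AB gen Pd(2) hm rt]) (assumption | rule that)+
      have "d - s0 * v \<in> B" using dA AB s0 v by (intro Bd(4,6)) auto
      then have "\<psi> (d - s0 * v) = 0" using \<psi>(3) ds by blast
      then have "\<psi> d = \<psi> s0 * \<psi> v" using hom_on_minus[OF B \<psi>(1), of d "s0 * v"] dA AB s0 v Bd(4) \<psi>(1)
        by (auto simp: hom_on_def)
      then have "\<psi> v \<noteq> 0" using nz \<psi>(2)[OF dA(1)] by auto
      then show "\<exists>\<psi>. hom_on B \<psi> \<and> (\<forall>x\<in>A. \<psi> x = \<phi> x) \<and> (\<forall>x\<in>B \<inter> P. \<psi> x = 0) \<and> \<psi> v \<noteq> 0"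
        using \<psi> by blast
    qed (use aA dA Ad in auto)
  qed
qed

subsection \<open>Evaluation of finitely supported functions\<close>

abbreviation "lkp \<equiv> Poly_Mapping.lookup"
abbreviation "kys \<equiv> Poly_Mapping.keys"
abbreviation "sgl \<equiv> Poly_Mapping.single"

lemma keys_eq_supp: "kys p = supp (lkp p)"
  by (auto simp: supp_def in_keys_iff)

lemma lookup_Abs_supp: "finite (supp f) \<Longrightarrow> lkp (Abs_poly_mapping f) = f"
  by (rule lookup_Abs_poly_mapping) (simp add: supp_def)

text \<open>The sum is shaped like both \<open>lpol_mult\<close> and \<open>ps_mult\<close>. Stated
  for a general exponent monoid, it identifies Laurent polynomials and finite series with finitely
  supported functions, whose ring laws then become available.\<close>

lemma lookup_times_keys:
  fixes p q :: "'e::comm_monoid_add \<Rightarrow>\<^sub>0 'r::comm_ring_1"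
  shows "lkp (p * q) k = (\<Sum>(a, b)\<in>{(a, b). a \<in> kys p \<and> b \<in> kys q \<and> a + b = k}. lkp p a * lkp q b)"
proof -
  have "lkp (p * q) k = (\<Sum>(a, b). lkp p a * lkp q b when k = a + b)"
    by (simp add: times_poly_mapping.rep_eq prod_fun_unfold_prod)
  also have "\<dots> = (\<Sum>(a, b)\<in>kys p \<times> kys q. lkp p a * lkp q b when k = a + b)"
    by (rule Sum_any.expand_superset) (auto simp: in_keys_iff when_def split: if_splits)
  also have "\<dots> = (\<Sum>(a, b)\<in>{x\<in>kys p \<times> kys q. fst x + snd x = k}. lkp p a * lkp q b)"
    by (subst sum.inter_filter) (auto intro!: sum.cong simp: when_def)
  also have "{x\<in>kys p \<times> kys q. fst x + snd x = k} = {(a, b). a \<in> kys p \<and> b \<in> kys q \<and> a + b = k}"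
    by auto
  finally show ?thesis .
qed

lemma lexp_add_plus: "lexp_add a b = a + b"
  by (simp add: lexp_add_def prod_eq_iff plus_fun_def)

lemma lookup_times_lpol: "lkp (p * q) = lpol_mult (lkp p) (lkp q)"
  by (rule ext) (simp add: lookup_times_keys lpol_mult_def lexp_add_plus keys_eq_supp)

lemma lookup_plus_lpol: "lkp (p + q) = lpol_add (lkp p) (lkp q)"
  by (rule ext) (simp add: lpol_add_def lookup_add)

lemma sum_single_keys: "p = (\<Sum>e\<in>kys p. sgl e (lkp p e))"
  by (rule poly_mapping_eqI) (auto simp: lookup_sum lookup_single when_def in_keys_iff)

text \<open>Here \<kappa> acts on coefficients and \<chi> on exponents. Their homomorphism laws are
  left to the lemmas, because evaluating Laurent monomials at a point is multiplicative only when
  its x-coordinates are nonzero.\<close>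

definition pm_eval :: "('c::comm_ring_1 \<Rightarrow> 'a::comm_ring_1) \<Rightarrow> ('e::comm_monoid_add \<Rightarrow> 'a) \<Rightarrow> ('e \<Rightarrow>\<^sub>0 'c) \<Rightarrow> 'a" where
  "pm_eval \<kappa> \<chi> p = (\<Sum>e\<in>kys p. \<kappa> (lkp p e) * \<chi> e)"

lemma pm_eval_superset:
  assumes "\<kappa> 0 = 0" "finite F" "kys p \<subseteq> F"
  shows "pm_eval \<kappa> \<chi> p = (\<Sum>e\<in>F. \<kappa> (lkp p e) * \<chi> e)"
  unfolding pm_eval_def using assms by (intro sum.mono_neutral_left) (auto simp: in_keys_iff)

lemma pm_eval_single: "\<kappa> 0 = 0 \<Longrightarrow> pm_eval \<kappa> \<chi> (sgl e c) = \<kappa> c * \<chi> e"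
  by (auto simp: pm_eval_def)

lemma pm_eval_add:
  assumes "\<kappa> 0 = 0" "\<And>a b. \<kappa> (a + b) = \<kappa> a + \<kappa> b"
  shows "pm_eval \<kappa> \<chi> (p + q) = pm_eval \<kappa> \<chi> p + pm_eval \<kappa> \<chi> q"
proof -
  let ?F = "kys p \<union> kys q"
  have "kys (p + q) \<subseteq> ?F" by (rule keys_add)
  then show ?thesis
    by (simp add: pm_eval_superset[of \<kappa> ?F, OF assms(1)] lookup_add assms(2) distrib_right sum.distrib)
qed

lemma pm_eval_sum:
  assumes "\<kappa> 0 = 0" "\<And>a b. \<kappa> (a + b) = \<kappa> a + \<kappa> b"
  shows "pm_eval \<kappa> \<chi> (sum f A) = (\<Sum>i\<in>A. pm_eval \<kappa> \<chi> (f i))"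
  by (induction A rule: infinite_finite_induct) (simp_all add: pm_eval_add[of \<kappa>, OF assms], simp_all add: pm_eval_def)

lemma pm_eval_mult:
  assumes \<kappa>: "\<kappa> 0 = 0" "\<And>a b. \<kappa> (a + b) = \<kappa> a + \<kappa> b" "\<And>a b. \<kappa> (a * b) = \<kappa> a * \<kappa> b"
    and \<chi>: "\<And>a b. \<chi> (a + b) = \<chi> a * \<chi> b"
  shows "pm_eval \<kappa> \<chi> (p * q) = pm_eval \<kappa> \<chi> p * pm_eval \<kappa> \<chi> q"
proof -
  have "p * q = (\<Sum>a\<in>kys p. sgl a (lkp p a)) * (\<Sum>b\<in>kys q. sgl b (lkp q b))"
    using sum_single_keys by metis
  also have "\<dots> = (\<Sum>a\<in>kys p. \<Sum>b\<in>kys q. sgl (a + b) (lkp p a * lkp q b))"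
    by (simp add: sum_product mult_single)
  finally have "pm_eval \<kappa> \<chi> (p * q) = (\<Sum>a\<in>kys p. \<Sum>b\<in>kys q. \<kappa> (lkp p a) * \<kappa> (lkp q b) * (\<chi> a * \<chi> b))"
    by (simp add: pm_eval_sum[of \<kappa>, OF \<kappa>(1,2)] pm_eval_single[of \<kappa>, OF \<kappa>(1)] \<kappa>(3) \<chi>)
  also have "\<dots> = pm_eval \<kappa> \<chi> p * pm_eval \<kappa> \<chi> q"
    by (simp add: pm_eval_def sum_product mult_ac)
  finally show ?thesis .
qed

subsection \<open>Prime ideals\<close>

text \<open>An ideal that is maximal among those containing \<open>J\<close> and missing
  \<open>S\<close> is prime: for x and y outside it, the ideals enlarged by x and by y both meet
  \<open>S\<close>, and the product of the two elements found lies in the ideal as soon as x * y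
  does. Zorn's lemma provides the maximal ideal.\<close>

lemma prime_avoiding:
  fixes C :: "'r::comm_ring_1 set"
  assumes C: "subring_of C" and J: "J \<subseteq> C" "0 \<in> J" "\<And>x y. x \<in> J \<Longrightarrow> y \<in> J \<Longrightarrow> x + y \<in> J"
    "\<And>x y. x \<in> C \<Longrightarrow> y \<in> J \<Longrightarrow> x * y \<in> J"
    and S: "S \<subseteq> C" "1 \<in> S" "\<And>x y. x \<in> S \<Longrightarrow> y \<in> S \<Longrightarrow> x * y \<in> S" "J \<inter> S = {}"
  shows "\<exists>P. prime_in C P \<and> J \<subseteq> P \<and> P \<inter> S = {}"
proof -
  note Cd = subring_ofD[OF C]
  define \<A> where "\<A> = {Q. J \<subseteq> Q \<and> Q \<subseteq> C \<and> (\<forall>x\<in>Q. \<forall>y\<in>Q. x + y \<in> Q) \<and> (\<forall>x\<in>C. \<forall>y\<in>Q. x * y \<in> Q) \<and> Q \<inter> S = {}}"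
  have "\<exists>P\<in>\<A>. \<forall>X\<in>\<A>. P \<subseteq> X \<longrightarrow> X = P"
  proof (rule subset_Zorn_nonempty)
    have "J \<in> \<A>" using J S by (auto simp: \<A>_def)
    then show "\<A> \<noteq> {}" by blast
    fix \<C> assume \<C>: "\<C> \<noteq> {}" "subset.chain \<A> \<C>"
    then have sub: "\<C> \<subseteq> \<A>" and tot: "\<And>X Y. X \<in> \<C> \<Longrightarrow> Y \<in> \<C> \<Longrightarrow> X \<subseteq> Y \<or> Y \<subseteq> X"
      by (auto simp: subset.chain_def)
    have add: "x + y \<in> \<Union>\<C>" if xy: "x \<in> X" "y \<in> Y" and XY: "X \<in> \<C>" "Y \<in> \<C>" for x y X Y
    proof -
      obtain Z where "Z \<in> \<C>" "x \<in> Z" "y \<in> Z" using tot[OF XY] XY xy by blast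
      moreover then have "Z \<in> \<A>" using sub by blast
      ultimately show ?thesis unfolding \<A>_def by blast
    qed
    have el: "J \<subseteq> X" "X \<subseteq> C" "X \<inter> S = {}" "\<And>x y. x \<in> C \<Longrightarrow> y \<in> X \<Longrightarrow> x * y \<in> X" if "X \<in> \<C>" for X
      using that sub by (auto simp: \<A>_def)
    obtain X0 where "X0 \<in> \<C>" using \<C>(1) by blast
    then have "J \<subseteq> \<Union>\<C>" using el(1) by blast
    moreover have "\<Union>\<C> \<subseteq> C" using el(2) by blast
    moreover have "\<Union>\<C> \<inter> S = {}" using el(3) by blast
    moreover have "\<forall>x\<in>C. \<forall>y\<in>\<Union>\<C>. x * y \<in> \<Union>\<C>" using el(4) by blast
    moreover have "\<forall>x\<in>\<Union>\<C>. \<forall>y\<in>\<Union>\<C>. x + y \<in> \<Union>\<C>" using add by blast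
    ultimately show "\<Union>\<C> \<in> \<A>" unfolding \<A>_def by simp
  qed
  then obtain P where P: "P \<in> \<A>" and max: "\<And>X. X \<in> \<A> \<Longrightarrow> P \<subseteq> X \<Longrightarrow> X = P" by blast
  have Pi: "J \<subseteq> P" "P \<subseteq> C" "\<And>x y. x \<in> P \<Longrightarrow> y \<in> P \<Longrightarrow> x + y \<in> P"
    "\<And>x y. x \<in> C \<Longrightarrow> y \<in> P \<Longrightarrow> x * y \<in> P" "P \<inter> S = {}" using P by (auto simp: \<A>_def)
  have 0: "0 \<in> P" using Pi J by blast
  have ext: "\<exists>p c. p \<in> P \<and> c \<in> C \<and> p + c * x \<in> S" if x: "x \<in> C" "x \<notin> P" for x
  proof (rule ccontr)
    assume no: "\<nexists>p c. p \<in> P \<and> c \<in> C \<and> p + c * x \<in> S"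
    define X where "X = {p + c * x | p c. p \<in> P \<and> c \<in> C}"
    have "P \<subseteq> X" unfolding X_def using Cd(1) by (force intro: exI[of _ 0])
    moreover have "X \<in> \<A>"
    proof -
      have add: "a + b \<in> X" if ab: "a \<in> X" "b \<in> X" for a b
      proof -
        obtain p c p' c' where "a = p + c * x" "b = p' + c' * x" "p \<in> P" "p' \<in> P" "c \<in> C" "c' \<in> C"
          using ab unfolding X_def by blast
        then have "a + b = (p + p') + (c + c') * x" "p + p' \<in> P" "c + c' \<in> C" using Pi Cd by (auto simp: algebra_simps)
        then show ?thesis unfolding X_def by blast
      qed
      have mult: "a * b \<in> X" if ab: "a \<in> C" "b \<in> X" for a b
      proof -
        obtain p c where "b = p + c * x" "p \<in> P" "c \<in> C"
          using ab unfolding X_def by blast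
        then have "a * b = a * p + (a * c) * x" "a * p \<in> P" "a * c \<in> C" using Pi Cd ab by (auto simp: algebra_simps)
        then show ?thesis unfolding X_def by blast
      qed
      have "X \<subseteq> C"
      proof
        fix y assume "y \<in> X"
        then obtain p c where "y = p + c * x" "p \<in> P" "c \<in> C" unfolding X_def by blast
        then show "y \<in> C" using Cd(3)[of p "c * x"] Cd(4)[of c x] Pi(2) x by auto
      qed
      moreover have "X \<inter> S = {}" using no unfolding X_def by blast
      ultimately show ?thesis using order.trans[OF Pi(1) \<open>P \<subseteq> X\<close>] add mult unfolding \<A>_def by simp
    qed
    ultimately have "X = P" by (intro max)
    moreover have "0 + 1 * x \<in> X" unfolding X_def using 0 Cd(2) by blast
    ultimately show False using x by simp
  qed
  have "x \<in> P \<or> y \<in> P" if xy: "x \<in> C" "y \<in> C" "x * y \<in> P" for x y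
  proof (rule ccontr)
    assume "\<not> (x \<in> P \<or> y \<in> P)"
    then obtain p c q d where h: "p \<in> P" "c \<in> C" "p + c * x \<in> S" "q \<in> P" "d \<in> C" "q + d * y \<in> S"
      using ext xy by blast
    have "(q + d * y) * p + (c * x) * q + (c * d) * (x * y) \<in> P"
      by (rule Pi(3)[OF Pi(3)[OF Pi(4)[OF _ h(1)] Pi(4)[OF _ h(4)]] Pi(4)[OF _ xy(3)]])
        (use h xy S(1) Cd(4) in auto)
    then have "(p + c * x) * (q + d * y) \<in> P" by (simp add: algebra_simps)
    then show False using S(3)[OF h(3,6)] Pi(5) by blast
  qed
  then have "prime_in C P" unfolding prime_in_def using Pi(2-5) 0 S(2) by auto
  then show ?thesis using Pi by blast
qed

subsection \<open>Points where Laurent polynomials do not vanish\<close>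

text \<open>The weights are powers \<open>t ^ i\<close>. Two distinct exponents receive equal weight
  only if \<open>t\<close> is a root of the nonzero polynomial formed from their difference, and
  finitely many pairs exclude only finitely many integers \<open>t\<close>.\<close>

lemma separating_weights:
  assumes "finite D" and D: "\<And>\<alpha> i. \<alpha> \<in> D \<Longrightarrow> i \<ge> N \<Longrightarrow> \<alpha> i = (0::int)"
  shows "\<exists>w::nat \<Rightarrow> int. inj_on (\<lambda>\<alpha>. \<Sum>i<N. w i * \<alpha> i) D"
proof -
  define p where "p = (\<lambda>\<alpha> \<beta>. \<Sum>i<N. monom (\<alpha> i - \<beta> i :: int) i)"
  define B where "B = (\<Union>(\<alpha>, \<beta>)\<in>{x\<in>D \<times> D. fst x \<noteq> snd x}. {t. poly (p \<alpha> \<beta>) t = 0})"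
  have "p \<alpha> \<beta> \<noteq> 0" if ab: "\<alpha> \<in> D" "\<beta> \<in> D" "\<alpha> \<noteq> \<beta>" for \<alpha> \<beta>
  proof -
    obtain i where i: "\<alpha> i \<noteq> \<beta> i" using ab by blast
    then have "i < N" using D ab by (metis not_less)
    then have "coeff (p \<alpha> \<beta>) i = \<alpha> i - \<beta> i" by (simp add: p_def coeff_sum)
    then show ?thesis using i by auto
  qed
  then have "finite B" unfolding B_def using assms by (auto intro!: poly_roots_finite)
  then obtain t where t: "t \<notin> B" using infinite_UNIV_int ex_new_if_finite by blast
  have "inj_on (\<lambda>\<alpha>. \<Sum>i<N. t ^ i * \<alpha> i) D"
  proof (rule inj_onI, rule ccontr)
    fix \<alpha> \<beta> assume "\<alpha> \<in> D" "\<beta> \<in> D" "(\<Sum>i<N. t ^ i * \<alpha> i) = (\<Sum>i<N. t ^ i * \<beta> i)" "\<alpha> \<noteq> \<beta>"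
    moreover from this have "poly (p \<alpha> \<beta>) t = 0"
      by (simp add: p_def poly_sum poly_monom algebra_simps sum_subtractf)
    ultimately have "t \<in> B" unfolding B_def by (intro UN_I[of "(\<alpha>, \<beta>)"]) auto
    then show False using t by blast
  qed
  then show ?thesis by (intro exI)
qed

text \<open>Multiplication by a power of t clears the negative exponents. Injectivity of
  \<open>w\<close> prevents different terms from merging, so the term at \<open>e0\<close>
  survives.\<close>

lemma finite_laurent_roots:
  fixes c :: "'e \<Rightarrow> 'k::field" and w :: "'e \<Rightarrow> int"
  assumes "finite E" "inj_on w E" "e0 \<in> E" "c e0 \<noteq> 0"
  shows "finite {t. t \<noteq> 0 \<and> (\<Sum>e\<in>E. c e * t powi w e) = 0}"
proof -
  define L where "L = Max ((\<lambda>e. \<bar>w e\<bar>) ` E)"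
  have L: "\<bar>w e\<bar> \<le> L" if "e \<in> E" for e unfolding L_def using assms that by auto
  define p where "p = (\<Sum>e\<in>E. monom (c e) (nat (w e + L)))"
  have "nat (w e + L) = nat (w e0 + L) \<longleftrightarrow> e = e0" if "e \<in> E" for e
    using L[OF that] L[OF assms(3)] assms(2,3) that by (auto simp: inj_on_def)
  then have "coeff p (nat (w e0 + L)) = (\<Sum>e\<in>E. if e = e0 then c e else 0)"
    unfolding p_def coeff_sum coeff_monom by (intro sum.cong) auto
  then have "p \<noteq> 0" using assms by auto
  then have "finite {t. poly p t = 0}" by (rule poly_roots_finite)
  moreover have "poly p t = t powi L * (\<Sum>e\<in>E. c e * t powi w e)" if "t \<noteq> 0" for t
  proof -
    have "t ^ nat (w e + L) = t powi L * t powi w e" if "e \<in> E" for e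
    proof -
      have "t ^ nat (w e + L) = t powi (w e + L)" using L[OF that] by (simp add: power_int_def)
      then show ?thesis using \<open>t \<noteq> 0\<close> by (simp add: power_int_add mult.commute)
    qed
    then show ?thesis unfolding p_def by (simp add: poly_sum poly_monom sum_distrib_left mult_ac)
  qed
  ultimately show ?thesis by (elim finite_subset[rotated]) auto
qed

text \<open>The variable y_j is present at every level and y_0, ..., y_(k-1) are added in turn.
  Level 0 gives K[x*, y_j] and, for \<open>j < M\<close>, level \<open>M\<close> gives the full
  ring. The step at \<open>k = j\<close> adds nothing, which spares a renumbering of the
  variables.\<close>

definition exps :: "nat \<Rightarrow> nat \<Rightarrow> nat \<Rightarrow> lexp set" where
  "exps N j k = {e. (\<forall>i\<ge>N. fst e i = 0) \<and> (\<forall>l. snd e l \<noteq> 0 \<longrightarrow> l = j \<or> l < k)}"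

definition exps_ring :: "nat \<Rightarrow> nat \<Rightarrow> nat \<Rightarrow> (lexp \<Rightarrow>\<^sub>0 'k::comm_ring_1) set" where
  "exps_ring N j k = {p. kys p \<subseteq> exps N j k}"

text \<open>This is the value of a monomial at x = a, y_j = b. The other y are ignored, so it is the
  intended evaluation on \<open>exps N j 0\<close> only.\<close>

definition point_char :: "nat \<Rightarrow> nat \<Rightarrow> (nat \<Rightarrow> 'k::field) \<Rightarrow> 'k \<Rightarrow> lexp \<Rightarrow> 'k" where
  "point_char N j a b e = (\<Prod>i<N. a i powi fst e i) * b ^ snd e j"

definition ypm :: "nat \<Rightarrow> lexp \<Rightarrow>\<^sub>0 'k::comm_ring_1" where
  "ypm l = sgl (0, (\<lambda>i. if i = l then 1 else 0)) 1"

lemma exps_add: "e \<in> exps N j k \<Longrightarrow> e' \<in> exps N j k \<Longrightarrow> e + e' \<in> exps N j k"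
  unfolding exps_def by simp

lemma exps_ring_subring: "subring_of (exps_ring N j k)"
  unfolding subring_of_def
proof (intro conjI ballI)
  show "1 \<in> exps_ring N j k" by (auto simp: exps_ring_def exps_def)
  fix x y :: "lexp \<Rightarrow>\<^sub>0 'a" assume xy: "x \<in> exps_ring N j k" "y \<in> exps_ring N j k"
  show "x + y \<in> exps_ring N j k" using xy keys_add[of x y] by (auto simp: exps_ring_def)
  show "x * y \<in> exps_ring N j k" using xy keys_mult[of x y] exps_add unfolding exps_ring_def by blast
next
  fix x :: "lexp \<Rightarrow>\<^sub>0 'a" assume "x \<in> exps_ring N j k"
  then show "- x \<in> exps_ring N j k" by (simp add: exps_ring_def subset_iff in_keys_iff)
qed

lemma exps_ring_mono: "k \<le> k' \<Longrightarrow> exps_ring N j k \<subseteq> exps_ring N j k'"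
proof -
  assume "k \<le> k'"
  then have "exps N j k \<subseteq> exps N j k'" unfolding exps_def using order.strict_trans2 by blast
  then show ?thesis by (auto simp: exps_ring_def)
qed

lemma single_in_exps_ring: "e \<in> exps N j k \<Longrightarrow> sgl e c \<in> exps_ring N j k"
  by (auto simp: exps_ring_def)

lemma ypm_power: "ypm l ^ n = sgl (0, (\<lambda>i. if i = l then n else 0)) 1"
proof (induction n)
  case 0
  have "(0, (\<lambda>i. if i = l then 0 else 0)) = (0 :: lexp)" by (simp add: prod_eq_iff zero_fun_def)
  then show ?case by (simp only: power_0 single_one)
next
  case (Suc n)
  have "(0, (\<lambda>i. if i = l then 1 else 0)) + (0, (\<lambda>i. if i = l then n else 0)) = ((0, (\<lambda>i. if i = l then Suc n else 0)) :: lexp)"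
    by (simp add: prod_eq_iff fun_eq_iff)
  then show ?case by (simp only: power_Suc Suc) (simp only: ypm_def mult_single mult_1)
qed

lemma exps_ring_Suc_generated:
  "exps_ring N j (Suc k) \<subseteq> {poly q (ypm k) | q. q \<in> polys_over (exps_ring N j k)}" (is "_ \<subseteq> ?R")
proof
  note sr = exps_ring_subring[of N j k] and cl = polys_over_closed[OF exps_ring_subring[of N j k]]
  fix p :: "lexp \<Rightarrow>\<^sub>0 'a" assume p: "p \<in> exps_ring N j (Suc k)"
  have "\<exists>q\<in>polys_over (exps_ring N j k). sgl e (lkp p e) = poly q (ypm k)" if e: "e \<in> kys p" for e
  proof -
    define e' where "e' = (fst e, (snd e)(k := 0))"
    have ee: "e = e' + (0, (\<lambda>i. if i = k then snd e k else 0))"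
      by (auto simp: e'_def prod_eq_iff fun_eq_iff)
    have "e \<in> exps N j (Suc k)" using p e by (auto simp: exps_ring_def)
    then have "e' \<in> exps N j k" by (auto simp: exps_def e'_def less_Suc_eq)
    moreover have "sgl e (lkp p e) = sgl e' (lkp p e) * ypm k ^ snd e k"
      unfolding ypm_power mult_single using ee by simp
    ultimately show ?thesis
      by (intro bexI[of _ "monom (sgl e' (lkp p e)) (snd e k)"])
        (auto simp: poly_monom intro!: cl single_in_exps_ring)
  qed
  then obtain q where q: "\<And>e. e \<in> kys p \<Longrightarrow> q e \<in> polys_over (exps_ring N j k) \<and> sgl e (lkp p e) = poly (q e) (ypm k)"
    by metis
  have "p = (\<Sum>e\<in>kys p. sgl e (lkp p e))" by (rule sum_single_keys)
  also have "\<dots> = poly (\<Sum>e\<in>kys p. q e) (ypm k)" using q by (simp add: poly_sum)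
  finally have "p = poly (\<Sum>e\<in>kys p. q e) (ypm k)" .
  moreover have "(\<Sum>e\<in>kys p. q e) \<in> polys_over (exps_ring N j k)"
    using q unfolding polys_over_def by (auto simp: coeff_sum intro!: subring_of_sum[OF sr])
  ultimately show "p \<in> ?R" by blast
qed

lemma point_char_add:
  assumes "\<And>i. i < N \<Longrightarrow> a i \<noteq> 0"
  shows "point_char N j a b (e + e') = point_char N j a b e * point_char N j a b e'"
proof -
  have "(\<Prod>i<N. a i powi fst (e + e') i) = (\<Prod>i<N. a i powi fst e i * a i powi fst e' i)"
    by (rule prod.cong) (use assms in \<open>auto simp: power_int_add\<close>)
  then show ?thesis by (simp add: point_char_def power_add prod.distrib mult_ac)
qed

lemma point_eval_hom_on:
  assumes "\<And>i. i < N \<Longrightarrow> a i \<noteq> 0"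
  shows "hom_on A (pm_eval (\<lambda>c. c) (point_char N j a b))"
proof -
  have "pm_eval (\<lambda>c. c) (point_char N j a b) 1 = 1"
    unfolding single_one[symmetric] by (subst pm_eval_single) (auto simp: point_char_def)
  moreover have "pm_eval (\<lambda>c. c) (point_char N j a b) (p * q) =
     pm_eval (\<lambda>c. c) (point_char N j a b) p * pm_eval (\<lambda>c. c) (point_char N j a b) q" for p q
    by (rule pm_eval_mult) (use point_char_add[OF assms] in auto)
  moreover have "pm_eval (\<lambda>c. c) (point_char N j a b) (p + q) =
     pm_eval (\<lambda>c. c) (point_char N j a b) p + pm_eval (\<lambda>c. c) (point_char N j a b) q" for p q
    by (rule pm_eval_add) auto
  ultimately show ?thesis by (simp add: hom_on_def)
qed

text \<open>Along the curve x_i = t^(w_i), the coefficient of a fixed power of y_j becomes a Laurent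
  polynomial in t. Separating weights prevent cancellation, so it is nonzero for almost all t; then
  \<open>h\<close> restricts to a nonzero polynomial in y_j.\<close>

lemma point_eval_nonzero_aux:
  fixes h :: "lexp \<Rightarrow>\<^sub>0 'k::field"
  assumes h: "h \<in> exps_ring N j 0" "h \<noteq> 0"
    and w: "inj_on (\<lambda>\<alpha>. \<Sum>i<N. w i * \<alpha> i) D" "fst ` kys h \<subseteq> D"
  obtains T where "finite T" "\<And>t. t \<noteq> 0 \<Longrightarrow> t \<notin> T \<Longrightarrow>
    finite {b. pm_eval (\<lambda>c. c) (point_char N j (\<lambda>i. t powi w i) b) h = 0}"
proof -
  obtain e0 where e0: "e0 \<in> kys h" using h(2) by (metis in_keys_iff lookup_zero poly_mapping_eqI)
  define E where "E = {e\<in>kys h. snd e j = snd e0 j}"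
  define W where "W e = (\<Sum>i<N. w i * fst e i)" for e :: lexp
  let ?T = "{t. t \<noteq> 0 \<and> (\<Sum>e\<in>E. lkp h e * t powi W e) = 0}"
  have supp0: "snd e l = 0" if "e \<in> kys h" "l \<noteq> j" for e l
    using that h(1) by (auto simp: exps_ring_def exps_def)
  have "inj_on W E"
  proof (rule inj_onI)
    fix e e' assume ee: "e \<in> E" "e' \<in> E" and eq: "W e = W e'"
    then have "fst e \<in> D" "fst e' \<in> D" using w(2) by (auto simp: E_def)
    then have "fst e = fst e'" using inj_onD[OF w(1), of "fst e" "fst e'"] eq by (simp add: W_def)
    moreover have "snd e l = snd e' l" for l
      using supp0[of e l] supp0[of e' l] ee by (cases "l = j") (auto simp: E_def)
    ultimately show "e = e'" by (auto simp: prod_eq_iff)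
  qed
  then have fin: "finite ?T"
    using e0 by (intro finite_laurent_roots[of _ _ e0]) (auto simp: E_def in_keys_iff)
  have "finite {b. pm_eval (\<lambda>c. c) (point_char N j (\<lambda>i. t powi w i) b) h = 0}"
    if t: "t \<noteq> 0" "t \<notin> ?T" for t
  proof -
  define p where "p = (\<Sum>e\<in>kys h. monom (lkp h e * t powi W e) (snd e j))"
  have tW: "(\<Prod>i<N. (t powi w i) powi fst e i) = t powi W e" for e
  proof -
    have "(\<Prod>i<n. (t powi w i) powi fst e i) = t powi (\<Sum>i<n. w i * fst e i)" for n
      by (induction n) (use t in \<open>auto simp: power_int_add power_int_mult\<close>)
    then show ?thesis by (simp add: W_def)
  qed
  have "pm_eval (\<lambda>c. c) (point_char N j (\<lambda>i. t powi w i) b) h = poly p b" for b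
    by (simp add: pm_eval_def point_char_def tW p_def poly_sum poly_monom mult_ac)
  moreover have "coeff p (snd e0 j) = (\<Sum>e\<in>E. lkp h e * t powi W e)"
    unfolding p_def E_def coeff_sum coeff_monom sum.inter_filter[OF finite_keys] by (intro sum.cong) auto
  then have "p \<noteq> 0" using t by auto
  ultimately show ?thesis
    by (simp add: poly_roots_finite)
  qed
  then show thesis using that[OF fin] by blast
qed

lemma point_eval_nonzero:
  fixes g h :: "lexp \<Rightarrow>\<^sub>0 'k::field_char_0"
  assumes g: "g \<in> exps_ring N j 0" "g \<noteq> 0" and h: "h \<in> exps_ring N j 0" "h \<noteq> 0"
  obtains a where "\<And>i. a i \<noteq> 0" "finite {b. pm_eval (\<lambda>c. c) (point_char N j a b) g = 0}"
     "finite {b. pm_eval (\<lambda>c. c) (point_char N j a b) h = 0}"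
proof -
  define D where "D = fst ` kys g \<union> fst ` kys h"
  have "\<alpha> i = 0" if "\<alpha> \<in> D" "N \<le> i" for \<alpha> i
    using that g h unfolding D_def exps_ring_def exps_def by auto
  then obtain w where w: "inj_on (\<lambda>\<alpha>. \<Sum>i<N. w i * \<alpha> i) D"
    using separating_weights[of D N] unfolding D_def by auto
  obtain T where T: "finite T" "\<And>t. t \<noteq> 0 \<Longrightarrow> t \<notin> T \<Longrightarrow>
    finite {b. pm_eval (\<lambda>c. c) (point_char N j (\<lambda>i. t powi w i) b) g = 0}"
    using point_eval_nonzero_aux[OF g w] unfolding D_def by blast
  obtain U where U: "finite U" "\<And>t. t \<noteq> 0 \<Longrightarrow> t \<notin> U \<Longrightarrow>
    finite {b. pm_eval (\<lambda>c. c) (point_char N j (\<lambda>i. t powi w i) b) h = 0}"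
    using point_eval_nonzero_aux[OF h w] unfolding D_def by blast
  obtain t where "t \<notin> insert 0 (T \<union> U)"
    using ex_new_if_finite[OF infinite_UNIV_char_0, of "insert 0 (T \<union> U)"] T U by auto
  then show thesis using that[of "\<lambda>i. t powi w i"] T(2)[of t] U(2)[of t] by auto
qed

text \<open>Two nonzero elements have a common point where neither vanishes, and evaluation there is
  multiplicative. This makes the nonzero elements of K[x*, y_j] a multiplicative set, as needed for
  \<open>prime_avoiding\<close>.\<close>

lemma exps_ring_0_domain:
  fixes g h :: "lexp \<Rightarrow>\<^sub>0 'k::field_char_0"
  assumes g: "g \<in> exps_ring N j 0" "g \<noteq> 0" and h: "h \<in> exps_ring N j 0" "h \<noteq> 0"
  shows "g * h \<noteq> 0"
proof -
  obtain a where a: "\<And>i. a i \<noteq> 0" "finite {b. pm_eval (\<lambda>c. c) (point_char N j a b) g = 0}"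
     "finite {b. pm_eval (\<lambda>c. c) (point_char N j a b) h = 0}"
    using point_eval_nonzero[OF assms] by blast
  obtain b where b: "pm_eval (\<lambda>c. c) (point_char N j a b) g \<noteq> 0" "pm_eval (\<lambda>c. c) (point_char N j a b) h \<noteq> 0"
    using ex_new_if_finite[OF infinite_UNIV_char_0 finite_UnI[OF a(2,3)]] by blast
  have "pm_eval (\<lambda>c. c) (point_char N j a b) (g * h) =
     pm_eval (\<lambda>c. c) (point_char N j a b) g * pm_eval (\<lambda>c. c) (point_char N j a b) h"
    by (rule pm_eval_mult) (simp_all add: point_char_add a)
  then have "pm_eval (\<lambda>c. c) (point_char N j a b) (g * h) \<noteq> 0" using b by simp
  then show ?thesis by (auto simp: pm_eval_def)
qed

text \<open>The induction descends from \<open>M\<close>, where 1 serves as \<open>h\<close>. The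
  \<open>h\<close> of level \<open>k + 1\<close> is the element \<open>v\<close> that the
  one-variable extension from level \<open>k\<close> has to keep nonzero.\<close>

lemma hom_extends_tower:
  fixes P :: "(lexp \<Rightarrow>\<^sub>0 'k::field_char_0) set"
  assumes ac: "alg_closed TYPE('k)" and P: "prime_in (exps_ring N j M) P" and "k \<le> M"
  shows "\<exists>h\<in>exps_ring N j k. h \<notin> P \<and> (\<forall>\<phi>::(lexp \<Rightarrow>\<^sub>0 'k) \<Rightarrow> 'k.
     hom_on (exps_ring N j k) \<phi> \<and> (\<forall>x\<in>exps_ring N j k \<inter> P. \<phi> x = 0) \<and> \<phi> h \<noteq> 0 \<longrightarrow>
    (\<exists>\<psi>. hom_on (exps_ring N j M) \<psi> \<and> (\<forall>x\<in>exps_ring N j k. \<psi> x = \<phi> x) \<and> (\<forall>x\<in>P. \<psi> x = 0)))"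
  using \<open>k \<le> M\<close>
proof (induction k rule: inc_induct)
  case base
  have "1 \<in> exps_ring N j M" "1 \<notin> P" using subring_ofD(2)[OF exps_ring_subring] prime_inD(3)[OF P] by auto
  moreover have "P \<subseteq> exps_ring N j M" using prime_inD(1)[OF P] .
  ultimately show ?case by blast
next
  case (step k)
  then obtain v :: "lexp \<Rightarrow>\<^sub>0 'k" where v: "v \<in> exps_ring N j (Suc k)" "v \<notin> P" and ext:
    "\<And>\<phi>::(lexp \<Rightarrow>\<^sub>0 'k) \<Rightarrow> 'k. hom_on (exps_ring N j (Suc k)) \<phi> \<Longrightarrow> (\<forall>x\<in>exps_ring N j (Suc k) \<inter> P. \<phi> x = 0) \<Longrightarrow> \<phi> v \<noteq> 0 \<Longrightarrow>
    (\<exists>\<psi>. hom_on (exps_ring N j M) \<psi> \<and> (\<forall>x\<in>exps_ring N j (Suc k). \<psi> x = \<phi> x) \<and> (\<forall>x\<in>P. \<psi> x = 0))"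
    by blast
  have y: "ypm k \<in> exps_ring N j (Suc k)"
    unfolding ypm_def by (rule single_in_exps_ring) (auto simp: exps_def)
  have kk: "exps_ring N j k \<subseteq> (exps_ring N j (Suc k) :: (lexp \<Rightarrow>\<^sub>0 'k) set)" by (rule exps_ring_mono) simp
  have kM: "exps_ring N j (Suc k) \<subseteq> (exps_ring N j M :: (lexp \<Rightarrow>\<^sub>0 'k) set)" by (rule exps_ring_mono) (use step in simp)
  obtain h where h: "h \<in> exps_ring N j k" "h \<notin> P" and ext2:
    "\<And>\<phi>::(lexp \<Rightarrow>\<^sub>0 'k) \<Rightarrow> 'k. hom_on (exps_ring N j k) \<phi> \<and> (\<forall>x\<in>exps_ring N j k \<inter> P. \<phi> x = 0) \<and> \<phi> h \<noteq> 0 \<Longrightarrow>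
    (\<exists>\<psi>. hom_on (exps_ring N j (Suc k)) \<psi> \<and> (\<forall>x\<in>exps_ring N j k. \<psi> x = \<phi> x) \<and> (\<forall>x\<in>exps_ring N j (Suc k) \<inter> P. \<psi> x = 0) \<and> \<psi> v \<noteq> 0)"
    using hom_extends_simple[OF ac exps_ring_subring exps_ring_subring exps_ring_subring kk kM y exps_ring_Suc_generated P v]
    by (elim bexE conjE) (rule that, auto)
  show ?case
  proof (intro bexI[of _ h] conjI allI impI)
    fix \<phi> :: "(lexp \<Rightarrow>\<^sub>0 'k) \<Rightarrow> 'k"
    assume "hom_on (exps_ring N j k) \<phi> \<and> (\<forall>x\<in>exps_ring N j k \<inter> P. \<phi> x = 0) \<and> \<phi> h \<noteq> 0"
    from ext2[OF this] obtain \<psi> where \<psi>: "hom_on (exps_ring N j (Suc k)) \<psi>" "\<forall>x\<in>exps_ring N j k. \<psi> x = \<phi> x"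
      "\<forall>x\<in>exps_ring N j (Suc k) \<inter> P. \<psi> x = 0" "\<psi> v \<noteq> 0" by blast
    from ext[OF \<psi>(1,3,4)] obtain \<psi>' where "hom_on (exps_ring N j M) \<psi>'" "\<forall>x\<in>exps_ring N j (Suc k). \<psi>' x = \<psi> x" "\<forall>x\<in>P. \<psi>' x = 0"
      by blast
    then show "\<exists>\<psi>. hom_on (exps_ring N j M) \<psi> \<and> (\<forall>x\<in>exps_ring N j k. \<psi> x = \<phi> x) \<and> (\<forall>x\<in>P. \<psi> x = 0)"
      using \<psi>(2) kk by (intro exI[of _ \<psi>']) auto
  qed (use h in auto)
qed

subsection \<open>Consequences of a finite generic fibre\<close>

lemma lpoly_iff_exps_ring: "j < M \<Longrightarrow> p \<in> exps_ring N j M \<longleftrightarrow> lpoly N M (lkp p)"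
  unfolding exps_ring_def exps_def lpoly_def keys_eq_supp
  using finite_keys[of p, unfolded keys_eq_supp] by (auto simp: subset_iff) (metis gr0I not_less)+

text \<open>An extended homomorphism is known on monomials in x and has a name for its value on each
  y variable; this factorization determines it on all monomials.\<close>

lemma single_lexp_factor:
  assumes "\<And>l. M \<le> l \<Longrightarrow> snd e l = 0"
  shows "sgl e c = sgl (fst e, 0) c * (\<Prod>l<M. ypm l ^ snd e l)"
proof -
  have "(\<Prod>l<m. ypm l ^ snd e l) = (sgl (0, (\<lambda>l. if l < m then snd e l else 0)) 1 :: lexp \<Rightarrow>\<^sub>0 'a)" for m
  proof (induction m)
    case 0
    have "(0, (\<lambda>l. if l < 0 then snd e l else 0)) = (0 :: lexp)" by (auto simp: prod_eq_iff)
    then show ?case by (simp only: lessThan_0 prod.empty single_one)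
  next
    case (Suc m)
    have "(0, (\<lambda>l. if l < m then snd e l else 0)) + (0, (\<lambda>i. if i = m then snd e m else 0)) = ((0, (\<lambda>l. if l < Suc m then snd e l else 0)) :: lexp)"
      by (auto simp: prod_eq_iff fun_eq_iff less_Suc_eq)
    moreover have "(\<Prod>l<Suc m. ypm l ^ snd e l) = (\<Prod>l<m. ypm l ^ snd e l) * (ypm m ^ snd e m :: lexp \<Rightarrow>\<^sub>0 'a)" by simp
    ultimately show ?case by (simp only: Suc) (simp only: ypm_power mult_single mult_1)
  qed
  moreover have "(fst e, 0) + (0, (\<lambda>l. if l < M then snd e l else 0)) = e"
    using assms by (auto simp: prod_eq_iff fun_eq_iff)
  ultimately show ?thesis by (simp add: mult_single)
qed

text \<open>If no such element existed, the image of the zero set in (x, y_j)-space would be so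
  large that over a general x almost every value of y_j occurs. This contradicts the finiteness of
  the fibre.\<close>

lemma elimination_polynomial:
  fixes I :: "'k::field_char_0 lpol set"
  assumes ac: "alg_closed TYPE('k)" and I: "is_ideal N M I" and adm: "admissible N M I" and j: "j < M"
  shows "\<exists>P\<in>I. supp P \<noteq> {} \<and> (\<forall>e\<in>supp P. \<forall>l. l \<noteq> j \<longrightarrow> snd e l = 0)"
proof (rule ccontr)
  assume no: "\<not> ?thesis"
  define C :: "(lexp \<Rightarrow>\<^sub>0 'k) set" where "C = exps_ring N j M"
  define A :: "(lexp \<Rightarrow>\<^sub>0 'k) set" where "A = exps_ring N j 0"
  have AC: "A \<subseteq> C" unfolding A_def C_def by (rule exps_ring_mono) simp
  define J where "J = {p. lkp p \<in> I}"
  have JC: "J \<subseteq> C" using I lpoly_iff_exps_ring[OF j] unfolding J_def C_def is_ideal_def by blast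
  have JA: "p = 0" if "p \<in> J" "p \<in> A" for p
  proof -
    have "\<forall>e\<in>supp (lkp p). \<forall>l. l \<noteq> j \<longrightarrow> snd e l = 0"
      using that unfolding A_def exps_ring_def exps_def keys_eq_supp by auto
    then have "supp (lkp p) = {}" using no that unfolding J_def by blast
    then show ?thesis by (intro poly_mapping_eqI) (auto simp: supp_def)
  qed
  have sA: "subring_of A" and sC: "subring_of C" unfolding A_def C_def by (rule exps_ring_subring)+
  note Ad = subring_ofD[OF sA]
  \<comment> \<open>The set \<open>A - {0}\<close> is multiplicative because \<open>A\<close> is a
    domain, and it misses \<open>J\<close> by the assumption being refuted.\<close>
  have "\<exists>P. prime_in C P \<and> J \<subseteq> P \<and> P \<inter> (A - {0}) = {}"
  proof (rule prime_avoiding[OF sC JC])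
    have "lkp (0 :: lexp \<Rightarrow>\<^sub>0 'k) = (\<lambda>_. 0)" by (rule ext) simp
    then show "0 \<in> J" using I unfolding J_def is_ideal_def by simp
    show "x + y \<in> J" if "x \<in> J" "y \<in> J" for x y
      using that I unfolding J_def is_ideal_def by (simp add: lookup_plus_lpol)
    show "x * y \<in> J" if "x \<in> C" "y \<in> J" for x y
      using that I lpoly_iff_exps_ring[OF j, of x] unfolding J_def C_def is_ideal_def by (simp add: lookup_times_lpol)
    show "A - {0} \<subseteq> C" using AC by blast
    show "1 \<in> A - {0}" using Ad(2) by simp
    show "x * y \<in> A - {0}" if "x \<in> A - {0}" "y \<in> A - {0}" for x y
      using that Ad(4) exps_ring_0_domain[of x N j y] unfolding A_def by auto
    show "J \<inter> (A - {0}) = {}" using JA by blast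
  qed
  then obtain P where P: "prime_in C P" and JP: "J \<subseteq> P" and PA: "P \<inter> (A - {0}) = {}" by blast
  obtain h where h: "h \<in> A" "h \<notin> P" and ext: "\<And>\<phi>::(lexp \<Rightarrow>\<^sub>0 'k) \<Rightarrow> 'k.
     hom_on A \<phi> \<Longrightarrow> (\<forall>x\<in>A \<inter> P. \<phi> x = 0) \<Longrightarrow> \<phi> h \<noteq> 0 \<Longrightarrow>
    (\<exists>\<psi>. hom_on C \<psi> \<and> (\<forall>x\<in>A. \<psi> x = \<phi> x) \<and> (\<forall>x\<in>P. \<psi> x = 0))"
    using hom_extends_tower[OF ac, of N j M P 0] P unfolding A_def C_def by blast
  have h0: "h \<noteq> 0" using h prime_inD(2)[OF P] by blast
  define V where "V = zero_set N M {f\<in>I. \<forall>e\<in>supp f. \<forall>i. fst e i \<ge> 0}"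
  obtain g where g: "is_xpoly N g" "g \<noteq> (\<lambda>_. 0)" and
    fib: "\<And>a. (\<forall>i\<ge>N. a i = 0) \<Longrightarrow> eval_pt N M g a (\<lambda>_. 0) \<noteq> 0 \<Longrightarrow> finite {b. (a, b) \<in> V}"
    using adm unfolding admissible_def Let_def V_def by blast
  have gx: "finite (supp g)" "\<And>e i. e \<in> supp g \<Longrightarrow> fst e i \<ge> 0"
     "\<And>e i. e \<in> supp g \<Longrightarrow> N \<le> i \<Longrightarrow> fst e i = 0" "\<And>e. e \<in> supp g \<Longrightarrow> snd e = (\<lambda>_. 0)"
    using g(1) by (auto simp: is_xpoly_def lpoly_def)
  define G where "G = Abs_poly_mapping g"
  have lG: "lkp G = g" unfolding G_def by (rule lookup_Abs_supp[OF gx(1)])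
  have kG: "kys G = supp g" by (simp add: keys_eq_supp lG)
  have "e \<in> exps N j 0" if "e \<in> supp g" for e using gx(3)[OF that] gx(4)[OF that] by (simp add: exps_def)
  then have G: "G \<in> A" by (auto simp: A_def exps_ring_def kG)
  have "G \<noteq> 0" using g(2) unfolding lG[symmetric] by (metis ext lookup_zero)
  note G = G this
  \<comment> \<open>Nonzero coordinates allow negative exponents. Since \<open>G\<close> involves no
    y, its value at \<open>a\<close> is the same for every \<open>b\<close>; finitely many zeros in
    \<open>b\<close> therefore means that it is nonzero.\<close>
  obtain a where a: "\<And>i. a i \<noteq> 0" and finG: "finite {b. pm_eval (\<lambda>c. c) (point_char N j a b) G = 0}"
     and finh: "finite {b. pm_eval (\<lambda>c. c) (point_char N j a b) h = 0}"
    using point_eval_nonzero[of G N j h] G h(1) h0 unfolding A_def by blast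
  define a' where "a' i = (if i < N then a i else 0)" for i
  have "eval_pt N M g a' (\<lambda>_. 0) = pm_eval (\<lambda>c. c) (point_char N j a b) G" for b
    unfolding eval_pt_def pm_eval_def lG keys_eq_supp
  proof (rule sum.cong)
    fix e assume e: "e \<in> supp g"
    have "(\<Prod>i<N. a' i ^ nat (fst e i)) = (\<Prod>i<N. a i powi fst e i)"
      using gx(2)[OF e] by (intro prod.cong) (auto simp: a'_def power_int_def)
    then show "g e * (\<Prod>i<N. a' i ^ nat (fst e i)) * (\<Prod>j<M. 0 ^ snd e j) = g e * point_char N j a b e"
      using gx(4)[OF e] by (simp add: point_char_def)
  qed simp
  moreover obtain b1 where "pm_eval (\<lambda>c. c) (point_char N j a b1) G \<noteq> 0"
    using ex_new_if_finite[OF infinite_UNIV_char_0 finG] by blast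
  ultimately have "finite {b. (a', b) \<in> V}" by (intro fib) (auto simp: a'_def)
  then have "finite ((\<lambda>b. b j) ` {b. (a', b) \<in> V})" by simp
  \<comment> \<open>The value \<open>b0\<close> must not be the y_j-coordinate of any point of the
    finite fibre over \<open>a'\<close>, and must not annihilate \<open>h\<close>, so that
    evaluation at it extends to \<open>C\<close>.\<close>
  from ex_new_if_finite[OF infinite_UNIV_char_0 finite_UnI[OF this finh]]
  obtain b0 where "b0 \<notin> (\<lambda>b. b j) ` {b. (a', b) \<in> V} \<union> {b. pm_eval (\<lambda>c. c) (point_char N j a b) h = 0}" ..
  then have b0: "b0 \<notin> (\<lambda>b. b j) ` {b. (a', b) \<in> V}" "pm_eval (\<lambda>c. c) (point_char N j a b0) h \<noteq> 0"
    by simp_all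
  let ?\<phi> = "pm_eval (\<lambda>c. c) (point_char N j a b0)"
  \<comment> \<open>The prime meets \<open>A\<close> in zero alone, so evaluation at any point is
    compatible with it.\<close>
  have "\<forall>x\<in>A \<inter> P. ?\<phi> x = 0" using PA by (auto simp: pm_eval_def)
  then obtain \<psi> where \<psi>: "hom_on C \<psi>" "\<And>x. x \<in> A \<Longrightarrow> \<psi> x = ?\<phi> x" "\<And>x. x \<in> P \<Longrightarrow> \<psi> x = 0"
    using ext[OF point_eval_hom_on _ b0(2)] a by blast
  define b where "b l = (if l < M then \<psi> (ypm l) else 0)" for l
  have yC: "ypm l \<in> C" if "l < M" for l
    unfolding C_def ypm_def by (rule single_in_exps_ring) (use that in \<open>auto simp: exps_def\<close>)
  have "(a', b) \<in> V"
  proof -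
    have "eval_pt N M f a' b = 0" if f: "f \<in> I" "\<And>e i. e \<in> supp f \<Longrightarrow> 0 \<le> fst e i" for f
    proof -
      have lf: "lpoly N M f" using f I by (auto simp: is_ideal_def)
      define F where "F = Abs_poly_mapping f"
      have lF: "lkp F = f" unfolding F_def using lf by (intro lookup_Abs_supp) (auto simp: lpoly_def)
      have val: "sgl e (f e) \<in> C \<and> \<psi> (sgl e (f e)) = f e * (\<Prod>i<N. a' i ^ nat (fst e i)) * (\<Prod>l<M. b l ^ snd e l)"
        if e: "e \<in> supp f" for e
      proof -
        let ?y = "\<lambda>m. \<Prod>l<m. ypm l ^ snd e l :: lexp \<Rightarrow>\<^sub>0 'k"
        have yv: "?y m \<in> C \<and> \<psi> (?y m) = (\<Prod>l<m. b l ^ snd e l)" if "m \<le> M" for m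
          using that
        proof (induction m)
          case 0
          then show ?case using \<psi>(1) subring_ofD[OF sC] by (auto simp: hom_on_def)
        next
          case (Suc m)
          then have "ypm m ^ snd e m \<in> C" "\<psi> (ypm m ^ snd e m) = b m ^ snd e m"
            using yC[of m] subring_ofD(7)[OF sC] hom_on_power[OF sC \<psi>(1)] by (auto simp: b_def)
          then show ?case using Suc \<psi>(1) subring_ofD(4)[OF sC] by (auto simp: hom_on_def)
        qed
        have ez: "snd e l = 0" if "M \<le> l" for l using lf e that by (auto simp: lpoly_def)
        have fa: "sgl (fst e, 0) (f e) \<in> A"
          unfolding A_def using lf e by (intro single_in_exps_ring) (auto simp: exps_def lpoly_def)
        have "\<psi> (sgl (fst e, 0) (f e)) = f e * (\<Prod>i<N. a i powi fst e i)"
          using \<psi>(2)[OF fa] by (simp add: pm_eval_single point_char_def)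
        also have "(\<Prod>i<N. a i powi fst e i) = (\<Prod>i<N. a' i ^ nat (fst e i))"
          using f(2)[OF e] by (intro prod.cong) (auto simp: a'_def power_int_def)
        finally have fv: "\<psi> (sgl (fst e, 0) (f e)) = f e * (\<Prod>i<N. a' i ^ nat (fst e i))" .
        have fC: "sgl (fst e, 0) (f e) \<in> C" using fa AC by blast
        have y: "?y M \<in> C" "\<psi> (?y M) = (\<Prod>l<M. b l ^ snd e l)" using yv[of M] by auto
        have "\<psi> (sgl (fst e, 0) (f e) * ?y M) = \<psi> (sgl (fst e, 0) (f e)) * \<psi> (?y M)"
          using fC y(1) \<psi>(1) unfolding hom_on_def by blast
        moreover have "sgl e (f e) = sgl (fst e, 0) (f e) * ?y M" by (rule single_lexp_factor) (rule ez)
        ultimately show ?thesis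
          using subring_ofD(4)[OF sC fC y(1)] unfolding fv y(2) by simp
      qed
      have "F \<in> P" using f(1) lF JP by (auto simp: J_def)
      then have "0 = \<psi> F" using \<psi>(3) by simp
      also have "F = (\<Sum>e\<in>supp f. sgl e (f e))" using sum_single_keys[of F] by (simp add: lF keys_eq_supp)
      also have "\<psi> \<dots> = (\<Sum>e\<in>supp f. \<psi> (sgl e (f e)))" by (rule hom_on_sum[OF sC \<psi>(1)]) (use val in auto)
      also have "\<dots> = eval_pt N M f a' b" unfolding eval_pt_def using val by (intro sum.cong) auto
      finally show ?thesis by simp
    qed
    then show ?thesis unfolding V_def zero_set_def by (auto simp: a'_def b_def)
  qed
  moreover have "b j = b0"
  proof -
    have "ypm j \<in> A" unfolding A_def ypm_def by (rule single_in_exps_ring) (auto simp: exps_def)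
    then show ?thesis using \<psi>(2) j by (simp add: b_def ypm_def pm_eval_single point_char_def)
  qed
  ultimately show False using b0 by blast
qed

subsection \<open>One-variable Newton-Puiseux sequences\<close>

text \<open>This is the additive submonoid generated by \<open>E\<close>. It is stated for
  commutative monoids because it is needed both for real weights and for exponent vectors.\<close>

inductive_set nspan :: "'a::comm_monoid_add set \<Rightarrow> 'a set" for E where
  nspan_zero: "0 \<in> nspan E"
| nspan_step: "x \<in> nspan E \<Longrightarrow> e \<in> E \<Longrightarrow> e + x \<in> nspan E"

lemma nspan_base: "e \<in> E \<Longrightarrow> e \<in> nspan E"
  using nspan_step[OF nspan_zero, of e E] by simp

lemma nspan_add: "x \<in> nspan E \<Longrightarrow> y \<in> nspan E \<Longrightarrow> x + y \<in> nspan E"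
  by (induction rule: nspan.induct) (auto simp: add.assoc intro: nspan_step)

lemma nspan_of_nat_mult: "x \<in> nspan E \<Longrightarrow> real n * x \<in> nspan E"
  by (induction n) (auto simp: distrib_right intro: nspan_zero nspan_add)

text \<open>The generator 0 contributes nothing and is dropped. A positive generator e occurs at
  most B / e times in a sum bounded by \<open>B\<close>, so only finitely many coefficient choices
  remain.\<close>

lemma nspan_finite_below:
  fixes E :: "real set"
  assumes "finite E" and pos: "\<And>e. e \<in> E \<Longrightarrow> 0 \<le> e"
  shows "finite {x\<in>nspan E. x \<le> B}"
proof -
  define P where "P = E - {0}"
  have P: "finite P" "\<And>e. e \<in> P \<Longrightarrow> 0 < e" using assms by (auto simp: P_def order.not_eq_order_implies_strict)
  have rep: "\<exists>t::real \<Rightarrow> nat. x = (\<Sum>e\<in>P. real (t e) * e)" if "x \<in> nspan E" for x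
    using that
  proof (induction rule: nspan.induct)
    case nspan_zero
    show ?case by (rule exI[of _ "\<lambda>_. 0"]) simp
  next
    case (nspan_step x e)
    then obtain t :: "real \<Rightarrow> nat" where t: "x = (\<Sum>e\<in>P. real (t e) * e)" by blast
    show ?case
    proof (cases "e = 0")
      case False
      then have "e \<in> P" using nspan_step by (auto simp: P_def)
      then have "e + x = (\<Sum>e'\<in>P. real ((t(e := Suc (t e))) e') * e')"
        unfolding t using P(1) by (simp add: sum.remove[of P e] algebra_simps)
      then show ?thesis by blast
    qed (use t in auto)
  qed
  define K where "K = nat \<lceil>Max (insert 0 ((\<lambda>e. B / e) ` P))\<rceil>"
  have "{x\<in>nspan E. x \<le> B} \<subseteq> (\<lambda>t. \<Sum>e\<in>P. real (t e) * e) ` (PiE P (\<lambda>_. {..K}))"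
  proof
    fix x assume x: "x \<in> {x\<in>nspan E. x \<le> B}"
    then obtain t :: "real \<Rightarrow> nat" where t: "x = (\<Sum>e\<in>P. real (t e) * e)" using rep by blast
    have "t e \<le> K" if e: "e \<in> P" for e
    proof -
      have "real (t e) * e \<le> x" unfolding t
        using P e by (intro member_le_sum) (auto simp: less_imp_le[OF P(2)])
      then have "real (t e) \<le> B / e" using x P(2)[OF e] by (simp add: pos_le_divide_eq)
      also have "\<dots> \<le> Max (insert 0 ((\<lambda>e. B / e) ` P))" using P e by (intro Max_ge) auto
      also have "\<dots> \<le> real (nat \<lceil>Max (insert 0 ((\<lambda>e. B / e) ` P))\<rceil>)" by linarith
      finally show ?thesis unfolding K_def by linarith
    qed
    then have "restrict t P \<in> PiE P (\<lambda>_. {..K})" by auto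
    moreover have "x = (\<Sum>e\<in>P. real (restrict t P e) * e)" unfolding t by (intro sum.cong) auto
    ultimately show "x \<in> (\<lambda>t. \<Sum>e\<in>P. real (t e) * e) ` (PiE P (\<lambda>_. {..K}))" by blast
  qed
  moreover have "finite (PiE P (\<lambda>_. {..K}))" using P by (intro finite_PiE) auto
  ultimately show ?thesis by (meson finite_imageI finite_subset)
qed

lemma pcompose_monom: "pcompose (monom a k) q = smult a (q ^ k)"
  for q :: "'a::comm_ring_1 poly"
  by (induction k) (auto simp: monom_0 monom_Suc pcompose_pCons mult_ac)

text \<open>These are the Taylor coefficients of \<open>p\<close> at \<open>c\<close>. A common
  bound \<open>d\<close> instead of the degree gives the sum the shape of the recursion for the
  substituted polynomials.\<close>

lemma coeff_pcompose_shift: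
  fixes c :: "'k::field_char_0"
  assumes "\<And>k. d < k \<Longrightarrow> coeff p k = 0"
  shows "coeff (pcompose p [:c, 1:]) n = (\<Sum>k\<le>d. of_nat (k choose n) * c ^ (k - n) * coeff p k)"
proof -
  have "p = (\<Sum>k\<le>d. monom (coeff p k) k)"
    by (rule poly_eqI) (use assms in \<open>auto simp: coeff_sum not_le\<close>)
  then have "pcompose p [:c, 1:] = pcompose (\<Sum>k\<le>d. monom (coeff p k) k) [:c, 1:]"
    by (rule arg_cong)
  also have "\<dots> = (\<Sum>k\<le>d. pcompose (monom (coeff p k) k) [:c, 1:])"
    by (rule pcompose_sum)
  also have "\<dots> = (\<Sum>k\<le>d. smult (coeff p k) ([:c, 1:] ^ k))"
    by (simp add: pcompose_monom)
  finally have "pcompose p [:c, 1:] = (\<Sum>k\<le>d. smult (coeff p k) ([:c, 1:] ^ k))" .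
  moreover have "coeff ([:c, 1:] ^ k) n = of_nat (k choose n) * c ^ (k - n)" for k
  proof (cases "n \<le> k")
    case False
    then have "degree ([:c, 1:] ^ k) < n" using degree_power_le[of "[:c, 1:]" k] by simp
    then show ?thesis using False by (simp add: coeff_eq_0 binomial_eq_0)
  qed (simp add: coeff_linear_poly_power)
  ultimately show ?thesis by (simp add: coeff_sum mult_ac)
qed

text \<open>
  Since the weight is injective on exponents, exponents are represented by their weights: \<open>a i x n\<close>
  is the coefficient of \<open>y\<^sup>n\<close> at weight \<open>x\<close> in the \<open>i\<close>-th polynomial, \<open>g i\<close> its initial form dehomogenized,
  and \<open>m i\<close> the multiplicity of \<open>c i\<close> as a root of \<open>g i\<close>. Once \<open>m\<close> is constant, \<open>g i\<close> is a multiple of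
  \<open>(z - c i)\<^sup>M\<close>, whose coefficients of degree \<open>M\<close> and \<open>M - 1\<close> do not vanish in characteristic zero.
\<close>

lemma newton_puiseux_stable:
  fixes a :: "nat \<Rightarrow> real \<Rightarrow> nat \<Rightarrow> 'k::field_char_0" and \<theta> :: "nat \<Rightarrow> real"
  assumes fin: "\<And>i. finite {(x, n). a i x n \<noteq> 0}" and ne: "\<exists>x n. a 0 x n \<noteq> 0"
    and deg: "\<And>i x n. d < n \<Longrightarrow> a i x n = 0"
    and rec: "\<And>i x n. a (Suc i) x n =
      (\<Sum>k\<le>d. of_nat (k choose n) * c i ^ (k - n) * a i (x - (real k - real n) * \<theta> i) k)"
    and c: "\<And>i. c i \<noteq> 0" and inc: "\<And>i. \<theta> i < \<theta> (Suc i)"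
    and init: "\<And>i w. (\<And>x k. a i x k \<noteq> 0 \<Longrightarrow> w \<le> x + real k * \<theta> i) \<Longrightarrow>
      (\<Sum>k\<le>d. a i (w - real k * \<theta> i) k * c i ^ k) = 0"
  obtains i1 E where "finite E" "\<And>e. e \<in> E \<Longrightarrow> 0 \<le> e"
    "\<And>e. e \<in> E \<Longrightarrow> \<exists>x n y k. e = x + real n * \<theta> i1 - (y + real k * \<theta> i1) \<and> a i1 x n \<noteq> 0 \<and> a i1 y k \<noteq> 0"
    "\<And>i. i1 \<le> i \<Longrightarrow> \<theta> i - \<theta> i1 \<in> nspan E"
    "\<And>i. i1 \<le> i \<Longrightarrow> \<exists>x y n k. \<theta> i = x - y \<and> a i x n \<noteq> 0 \<and> a i y k \<noteq> 0"
proof -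
  define S where "S i = {(x, n). a i x n \<noteq> 0}" for i
  define \<delta> where "\<delta> i = Min ((\<lambda>(x, n). x + real n * \<theta> i) ` S i)" for i
  define g where "g i = (\<Sum>k\<le>d. monom (a i (\<delta> i - real k * \<theta> i) k) k)" for i
  define h where "h i = pcompose (g i) [:c i, 1:]" for i
  define m where "m i = (LEAST n. coeff (h i) n \<noteq> 0)" for i
  have finS: "finite (S i)" for i using fin by (simp add: S_def)
  have lb: "\<delta> i \<le> x + real n * \<theta> i" if "a i x n \<noteq> 0" for i x n
    unfolding \<delta>_def using finS that by (intro Min_le) (auto simp: S_def image_iff)
  have cg: "coeff (g i) k = a i (\<delta> i - real k * \<theta> i) k" for i k
    using deg[of k i] by (cases "k \<le> d") (auto simp: g_def coeff_sum)
  \<comment> \<open>Terms on the face of order \<open>\<delta> i\<close> are transformed among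
    themselves: shifting the initial form by \<open>c i\<close> yields the coefficients of the next
    polynomial on the same line.\<close>
  have ch: "coeff (h i) n = a (Suc i) (\<delta> i - real n * \<theta> i) n" for i n
    unfolding h_def rec
    by (subst coeff_pcompose_shift[of d]) (auto simp: cg deg algebra_simps intro!: sum.cong)
  have gne: "g i \<noteq> 0" if "S i \<noteq> {}" for i
  proof -
    have "\<delta> i \<in> (\<lambda>(x, n). x + real n * \<theta> i) ` S i" unfolding \<delta>_def using finS that by (intro Min_in) auto
    then obtain x n where "\<delta> i = x + real n * \<theta> i" "a i x n \<noteq> 0" by (auto simp: S_def)
    then have "coeff (g i) n \<noteq> 0" by (simp add: cg)
    then show ?thesis by auto
  qed
  have hne': "h i \<noteq> 0" if "g i \<noteq> 0" for i
    using that pcompose_eq_0[of "g i" "[:c i, 1:]"] unfolding h_def by auto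
  have Sne: "S i \<noteq> {}" for i
  proof (induction i)
    case 0
    then show ?case using ne by (auto simp: S_def)
  next
    case (Suc i)
    then have "h i \<noteq> 0" using gne hne' by blast
    then obtain n where "coeff (h i) n \<noteq> 0" using leading_coeff_0_iff by blast
    then show ?case by (auto simp: S_def ch)
  qed
  have hne: "h i \<noteq> 0" for i using Sne gne hne' by blast
  have cm: "coeff (h i) (m i) \<noteq> 0" for i
    unfolding m_def by (rule LeastI[of _ "degree (h i)"]) (use hne in auto)
  have cml: "coeff (h i) n = 0" if "n < m i" for i n using not_less_Least that unfolding m_def by blast
  \<comment> \<open>The added term has order \<open>\<theta> i\<close>, so expansion preserves order
    with respect to the old slope and nothing appears below the old face.\<close>
  have low: "\<delta> i \<le> x + real n * \<theta> i" if an: "a (Suc i) x n \<noteq> 0" for i x n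
  proof -
    obtain k where "a i (x - (real k - real n) * \<theta> i) k \<noteq> 0"
      using an unfolding rec by (metis (no_types, lifting) mult_zero_right sum.neutral)
    from lb[OF this] show ?thesis by (simp add: algebra_simps)
  qed
  have mpos: "0 < m i" for i
  proof (rule ccontr)
    assume "\<not> 0 < m i"
    then have "coeff (h i) 0 \<noteq> 0" using cm[of i] by simp
    moreover have "coeff (h i) 0 = (\<Sum>k\<le>d. a i (\<delta> i - real k * \<theta> i) k * c i ^ k)"
      unfolding h_def by (subst coeff_pcompose_shift[of d]) (auto simp: cg deg mult_ac)
    ultimately show False using init[of i "\<delta> i"] lb by simp
  qed
  have degh: "degree (h i) = degree (g i)" for i unfolding h_def by (simp add: degree_pcompose)
  \<comment> \<open>The new polynomial has a point of degree \<open>m i\<close> on the old face and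
    no point below that face. For the larger slope \<open>\<theta> (Suc i)\<close>, every point of
    degree above \<open>m i\<close> is strictly heavier than this one and cannot be initial.\<close>
  have dm: "degree (g (Suc i)) \<le> m i" for i
  proof (rule degree_le, intro allI impI, rule ccontr)
    fix k assume k: "m i < k" "coeff (g (Suc i)) k \<noteq> 0"
    then have "a (Suc i) (\<delta> (Suc i) - real k * \<theta> (Suc i)) k \<noteq> 0" by (simp add: cg)
    from low[OF this] have 1: "\<delta> i \<le> \<delta> (Suc i) - real k * \<theta> (Suc i) + real k * \<theta> i" .
    have "a (Suc i) (\<delta> i - real (m i) * \<theta> i) (m i) \<noteq> 0" using cm[of i] by (simp add: ch)
    from lb[OF this] have "\<delta> (Suc i) \<le> \<delta> i - real (m i) * \<theta> i + real (m i) * \<theta> (Suc i)" .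
    with 1 have "(real k - real (m i)) * (\<theta> (Suc i) - \<theta> i) \<le> 0" by (simp add: algebra_simps)
    then show False using k(1) inc[of i] by (simp add: mult_le_0_iff)
  qed
  have md: "m i \<le> degree (g i)" for i using le_degree[OF cm[of i]] degh by simp
  have mdec: "m (Suc i) \<le> m i" for i using dm[of i] md[of "Suc i"] by simp
  obtain i0 where i0: "\<And>i. m i0 \<le> m i" using ex_has_least_nat[of "\<lambda>_. True" 0 m] by auto
  define M where "M = m i0"
  have mM: "m i = M" if "i0 \<le> i" for i
    using that
  proof (induction rule: dec_induct)
    case (step i)
    then show ?case using mdec[of i] i0[of "Suc i"] by (simp add: M_def)
  qed (simp add: M_def)
  \<comment> \<open>The degree bound at a stage refers to the multiplicity at the preceding stage,
    which must already equal \<open>M\<close>; hence one step past \<open>i0\<close>.\<close>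
  define i1 where "i1 = Suc i0"
  have Mpos: "0 < M" using mpos by (simp add: M_def)
  have hi: "h i = monom (coeff (h i) M) M" if i: "i1 \<le> i" for i
  proof -
    obtain i' where i': "i = Suc i'" "i0 \<le> i'" using i unfolding i1_def by (cases i) auto
    have "degree (h i) \<le> M" using dm[of i'] mM i' degh by simp
    then have "coeff (h i) n = 0" if "n \<noteq> M" for n
      using cml[of n i] mM[of i] i' that coeff_eq_0[of "h i" n] by (cases "n < M") auto
    then show ?thesis by (intro poly_eqI) auto
  qed
  have top: "a i (\<delta> i - real M * \<theta> i) M \<noteq> 0" "a i (\<delta> i - real (M - 1) * \<theta> i) (M - 1) \<noteq> 0" if i: "i1 \<le> i" for i
  proof -
    define b where "b = coeff (h i) M"
    have b: "b \<noteq> 0" using cm[of i] mM[of i] i by (auto simp: b_def i1_def)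
    have hb: "h i = monom b M" using hi[OF i] by (simp add: b_def)
    have "pcompose (h i) [:- c i, 1:] = g i" unfolding h_def by (simp add: pcompose_assoc[symmetric] pcompose_pCons)
    moreover have "coeff (pcompose (monom b M) [:- c i, 1:]) n = of_nat (M choose n) * (- c i) ^ (M - n) * b" for n
      by (subst coeff_pcompose_shift[of M]) (auto simp: if_distrib sum.delta cong: if_cong)
    ultimately have "coeff (g i) n = of_nat (M choose n) * (- c i) ^ (M - n) * b" for n using hb by simp
    from this[of M] this[of "M - 1"] show "a i (\<delta> i - real M * \<theta> i) M \<noteq> 0" "a i (\<delta> i - real (M - 1) * \<theta> i) (M - 1) \<noteq> 0"
      unfolding cg using b c[of i] Mpos by (auto simp: binomial_eq_0_iff)
  qed
  \<comment> \<open>This is the x-weight of the vertex of degree \<open>M\<close>. Consecutive faces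
    share that vertex, so it never moves.\<close>
  define \<epsilon> where "\<epsilon> i = \<delta> i - real M * \<theta> i" for i
  have \<epsilon>S: "\<epsilon> (Suc i) = \<epsilon> i" if i: "i1 \<le> i" for i
  proof (rule antisym)
    have "a (Suc i) (\<delta> i - real M * \<theta> i) M \<noteq> 0"
      using cm[of i] mM[of i] i by (auto simp: ch i1_def)
    from lb[OF this] show "\<epsilon> (Suc i) \<le> \<epsilon> i" by (simp add: \<epsilon>_def)
    have "a (Suc i) (\<epsilon> (Suc i)) M \<noteq> 0" using top(1)[of "Suc i"] i by (simp add: \<epsilon>_def)
    from low[OF this] show "\<epsilon> i \<le> \<epsilon> (Suc i)" by (simp add: \<epsilon>_def)
  qed
  have \<epsilon>: "\<epsilon> i = \<epsilon> i1" if "i1 \<le> i" for i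
    using that by (induction rule: dec_induct) (auto simp: \<epsilon>S)
  \<comment> \<open>Orders are measured with the fixed slope \<open>\<theta> i1\<close> and counted
    from their minimum at stage \<open>i1\<close>. This makes the generators nonnegative and lets
    one finite set serve all later stages.\<close>
  define E where "E = (\<lambda>(x, n). x + real n * \<theta> i1 - \<delta> i1) ` S i1"
  have key: "(\<forall>x n. a i x n \<noteq> 0 \<longrightarrow> x + real n * \<theta> i1 - \<delta> i1 \<in> nspan E) \<and> \<theta> i - \<theta> i1 \<in> nspan E" if "i1 \<le> i" for i
    using that
  proof (induction rule: dec_induct)
    case base
    show ?case by (auto simp: E_def S_def image_iff intro!: nspan_base nspan_zero)
  next
    case (step i)
    have 1: "x + real n * \<theta> i1 - \<delta> i1 \<in> nspan E" if an: "a (Suc i) x n \<noteq> 0" for x n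
    proof -
      obtain k where k: "of_nat (k choose n) * c i ^ (k - n) * a i (x - (real k - real n) * \<theta> i) k \<noteq> 0"
        using an unfolding rec by (meson sum.neutral)
      then have nk: "n \<le> k" using binomial_eq_0[of k n] by (cases "n \<le> k") auto
      have "x - (real k - real n) * \<theta> i + real k * \<theta> i1 - \<delta> i1 + real (k - n) * (\<theta> i - \<theta> i1) \<in> nspan E"
        using k step.IH by (intro nspan_add nspan_of_nat_mult) auto
      then show ?thesis using nk by (simp add: of_nat_diff algebra_simps)
    qed
    \<comment> \<open>The points of degrees \<open>M - 1\<close> and \<open>M\<close> on the new
      face differ in x-weight by \<open>\<theta> (Suc i)\<close>. The latter point is fixed, so the
      order of the former at slope \<open>\<theta> i1\<close> is exactly the increment of
      \<theta>.\<close>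
    moreover have "\<delta> (Suc i) - real (M - 1) * \<theta> (Suc i) + real (M - 1) * \<theta> i1 - \<delta> i1 \<in> nspan E"
      using 1 top(2)[of "Suc i"] step by simp
    moreover have "\<delta> (Suc i) - real (M - 1) * \<theta> (Suc i) + real (M - 1) * \<theta> i1 - \<delta> i1 = \<theta> (Suc i) - \<theta> i1"
      using \<epsilon>[of "Suc i"] step Mpos unfolding \<epsilon>_def by (simp add: of_nat_diff algebra_simps)
    ultimately show ?case by auto
  qed
  show thesis
  proof (rule that[of E i1])
    show "finite E" using finS by (simp add: E_def)
    show "0 \<le> e" if "e \<in> E" for e using that lb by (auto simp: E_def S_def)
    show "\<theta> i - \<theta> i1 \<in> nspan E" if "i1 \<le> i" for i using key that by blast
    show "\<exists>x n y k. e = x + real n * \<theta> i1 - (y + real k * \<theta> i1) \<and> a i1 x n \<noteq> 0 \<and> a i1 y k \<noteq> 0" if eE: "e \<in> E" for e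
    proof -
      obtain x n where "e = x + real n * \<theta> i1 - \<delta> i1" "a i1 x n \<noteq> 0" using eE by (auto simp: E_def S_def)
      moreover have "\<delta> i1 = (\<delta> i1 - real M * \<theta> i1) + real M * \<theta> i1" by simp
      ultimately show ?thesis using top(1)[of i1] by (metis order_refl)
    qed
    \<comment> \<open>The order of the new term is a difference of x-weights already present in the
      polynomial of the same stage. This is what rules out new denominators.\<close>
    show "\<exists>x y n k. \<theta> i = x - y \<and> a i x n \<noteq> 0 \<and> a i y k \<noteq> 0" if "i1 \<le> i" for i
    proof -
      have "\<theta> i = (\<delta> i - real (M - 1) * \<theta> i) - (\<delta> i - real M * \<theta> i)" using Mpos by (simp add: of_nat_diff algebra_simps)
      then show ?thesis using top[OF that] by blast
    qed
  qed
qed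

subsection \<open>The substitution of an omega-set\<close>

lemma common_denominator:
  "finite F \<Longrightarrow> \<exists>k::nat. 0 < k \<and> (\<forall>q\<in>F. of_nat k * (q::rat) \<in> \<int>)"
proof (induction F rule: finite_induct)
  case (insert q F)
  then obtain k :: nat where k: "0 < k" "\<And>q. q \<in> F \<Longrightarrow> of_nat k * q \<in> \<int>" by blast
  obtain a b where q: "q = Fract a b" "b > 0" by (cases q) auto
  have bn: "(of_nat (nat b) :: rat) = of_int b" using q(2) by simp
  have b: "of_int b * q = of_int a" using q by (simp add: Fract_of_int_quotient)
  have "of_nat (k * nat b) * q' \<in> \<int>" if "q' \<in> insert q F" for q'
  proof (cases "q' = q")
    case True
    have "of_nat (k * nat b) * q = of_nat k * (of_int b * q)" by (simp only: of_nat_mult bn mult.assoc)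
    then show ?thesis by (simp only: True b) simp
  next
    case False
    have "of_nat (k * nat b) * q' = of_int b * (of_nat k * q')" by (simp only: of_nat_mult bn mult_ac)
    then show ?thesis using False that k(2)[of q'] by (simp only:) simp
  qed
  then show ?case using k(1) q(2) by (intro exI[of _ "k * nat b"]) auto
qed (auto intro: exI[of _ 1])

lemma dG_spec:
  shows dG_pos: "0 < dG N M (\<eta>, \<Gamma>, c)"
    and dG_integral: "j \<in> Lam M \<eta> \<Longrightarrow> i < N \<Longrightarrow> of_nat (dG N M (\<eta>, \<Gamma>, c)) * \<Gamma> j i \<in> \<int>"
proof -
  have "finite ((\<lambda>(j, i). \<Gamma> j i) ` (Lam M \<eta> \<times> {..<N}))" by (auto simp: Lam_def)
  from common_denominator[OF this]
  obtain k :: nat where "0 < k \<and> (\<forall>j\<in>Lam M \<eta>. \<forall>i<N. of_nat k * \<Gamma> j i \<in> \<int>)" by auto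
  then have "0 < dG N M (\<eta>, \<Gamma>, c) \<and> (\<forall>j\<in>Lam M \<eta>. \<forall>i<N. of_nat (dG N M (\<eta>, \<Gamma>, c)) * \<Gamma> j i \<in> \<int>)"
    unfolding dG_def by simp (rule LeastI)
  then show "0 < dG N M (\<eta>, \<Gamma>, c)"
    "j \<in> Lam M \<eta> \<Longrightarrow> i < N \<Longrightarrow> of_nat (dG N M (\<eta>, \<Gamma>, c)) * \<Gamma> j i \<in> \<int>" by auto
qed

lemma dG_eq_1:
  assumes "\<And>j i. j \<in> Lam M \<eta> \<Longrightarrow> i < N \<Longrightarrow> \<Gamma> j i \<in> \<int>"
  shows "dG N M (\<eta>, \<Gamma>, c) = 1"
proof -
  have "dG N M (\<eta>, \<Gamma>, c) \<le> 1" unfolding dG_def using assms by simp (rule Least_le, simp)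
  then show ?thesis using dG_pos[of N M \<eta> \<Gamma> c] by linarith
qed

text \<open>The floor is exact on the rows in \<open>Lam\<close>. On the other rows its value is
  arbitrary, but there c_j = 0 removes every term that would use it.\<close>

definition shift_vec :: "nat \<Rightarrow> nat \<Rightarrow> 'k wset \<Rightarrow> nat \<Rightarrow> nat \<Rightarrow> int" where
  "shift_vec N M D j i = (if i < N then \<lfloor>of_nat (dG N M D) * fst (snd D) j i\<rfloor> else 0)"

lemma shift_vec_scaled:
  assumes j: "j \<in> Lam M (fst D)"
  shows "r / of_nat (dG N M D) * of_int (shift_vec N M D j i) = (if i < N then r * fst (snd D) j i else 0)"
proof -
  obtain \<eta> \<Gamma> c where D: "D = (\<eta>, \<Gamma>, c)" by (cases D) auto
  have k: "0 < dG N M D" unfolding D by (rule dG_pos)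
  have "r / of_nat (dG N M D) * of_int \<lfloor>of_nat (dG N M D) * \<Gamma> j i\<rfloor> = r * \<Gamma> j i" if "i < N"
  proof -
    have "of_nat (dG N M D) * \<Gamma> j i \<in> \<int>" using j that unfolding D by (intro dG_integral) auto
    then have 1: "of_int \<lfloor>of_nat (dG N M D) * \<Gamma> j i\<rfloor> = of_nat (dG N M D) * \<Gamma> j i" by (metis Ints_cases floor_of_int)
    have "r / of_nat (dG N M D) * (of_nat (dG N M D) * \<Gamma> j i) = r * \<Gamma> j i" using k by simp
    then show ?thesis by (simp only: 1)
  qed
  moreover have "fst (snd D) = \<Gamma>" by (simp add: D)
  ultimately show ?thesis by (simp add: shift_vec_def)
qed

text \<open>A pair \<open>(e, b)\<close> stands for one term of the binomial expansion: of the
  y-part of \<open>e\<close>, the exponent \<open>b\<close> is kept and the remaining factors are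
  replaced by the monomials of \<open>D\<close>.\<close>

definition subst_exp :: "nat \<Rightarrow> nat \<Rightarrow> 'k wset \<Rightarrow> lexp \<Rightarrow> (nat \<Rightarrow> nat) \<Rightarrow> nat \<Rightarrow> int" where
  "subst_exp N M D e b i = int (dG N M D) * fst e i + (\<Sum>j<M. int (snd e j - b j) * shift_vec N M D j i)"

definition subst_coeff :: "nat \<Rightarrow> 'k::comm_ring_1 wset \<Rightarrow> lexp \<Rightarrow> (nat \<Rightarrow> nat) \<Rightarrow> 'k" where
  "subst_coeff M D e b = (\<Prod>j<M. of_nat (snd e j choose b j) * snd (snd D) j ^ (snd e j - b j))"

lemma subst_D_altdef:
  "subst_D N M D f (\<alpha>', b) = (\<Sum>e\<in>{e\<in>supp f. b \<le> snd e \<and> subst_exp N M D e b = \<alpha>'}. f e * subst_coeff M D e b)"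
  by (cases D) (simp add: subst_D_def Let_def subst_exp_def[abs_def] subst_coeff_def shift_vec_def[abs_def] le_fun_def cong: if_cong)

lemma finite_below_nat_fun:
  assumes "\<And>j. M \<le> j \<Longrightarrow> (\<beta> :: nat \<Rightarrow> nat) j = 0"
  shows "finite {b. b \<le> \<beta>}"
proof (rule finite_subset)
  show "{b. b \<le> \<beta>} \<subseteq> {b. \<forall>j. (j \<in> {..<M} \<longrightarrow> b j \<in> {..Max (\<beta> ` {..<M})}) \<and> (j \<notin> {..<M} \<longrightarrow> b j = 0)}"
  proof (intro subsetI CollectI allI conjI impI)
    fix b j assume b: "b \<in> {b. b \<le> \<beta>}"
    show "b j \<in> {..Max (\<beta> ` {..<M})}" if "j \<in> {..<M}"
    proof -
      have "\<beta> j \<le> Max (\<beta> ` {..<M})" using that by (intro Max_ge) auto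
      then show ?thesis using b le_funD[of b \<beta> j] by simp
    qed
    show "b j = 0" if "j \<notin> {..<M}" using b assms[of j] that le_funD[of b \<beta> j] by simp
  qed
  show "finite \<dots>" by (rule finite_set_of_finite_funs) auto
qed

text \<open>Terms of the expansion are regrouped by the exponent they produce. An arbitrary summand
  \<open>F\<close> and additive \<kappa> let the same regrouping serve the evaluation at series and
  the recursion for single coefficients.\<close>

lemma sum_subst_D:
  fixes \<kappa> :: "'k::comm_ring_1 \<Rightarrow> 'a::comm_ring_1"
  assumes \<kappa>: "\<kappa> 0 = 0" "\<And>a b. \<kappa> (a + b) = \<kappa> a + \<kappa> b" and f: "lpoly N M f"
  shows "(\<Sum>e'\<in>supp (subst_D N M D f). \<kappa> (subst_D N M D f e') * F e') =
    (\<Sum>e\<in>supp f. \<Sum>b | b \<le> snd e. \<kappa> (f e * subst_coeff M D e b) * F (subst_exp N M D e b, b))"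
    and finite_supp_subst_D: "finite (supp (subst_D N M D f))"
proof -
  define Q where "Q = (SIGMA e:supp f. {b. b \<le> snd e})"
  define T where "T = (\<lambda>(e, b). (subst_exp N M D e b, b))"
  define G where "G = (\<lambda>(e, b). f e * subst_coeff M D e b)"
  have \<kappa>s: "\<kappa> (sum g A) = (\<Sum>x\<in>A. \<kappa> (g x))" for g and A :: "'x set"
    by (induction A rule: infinite_finite_induct) (simp_all add: \<kappa>)
  have ff: "finite (supp f)" "\<And>e. e \<in> supp f \<Longrightarrow> finite {b. b \<le> snd e}"
    using f finite_below_nat_fun[of M] by (auto simp: lpoly_def)
  then have finQ: "finite Q" unfolding Q_def by blast
  have val: "subst_D N M D f e' = (\<Sum>p\<in>{p\<in>Q. T p = e'}. G p)" for e'
  proof -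
    have "subst_D N M D f (fst e', snd e') = (\<Sum>p\<in>{p\<in>Q. T p = (fst e', snd e')}. G p)"
      unfolding subst_D_altdef
      by (rule sum.reindex_bij_witness[of _ fst "\<lambda>e. (e, snd e')"]) (auto simp: Q_def T_def G_def)
    then show ?thesis by simp
  qed
  have sub: "supp (subst_D N M D f) \<subseteq> T ` Q"
  proof
    fix e' assume "e' \<in> supp (subst_D N M D f)"
    then have "(\<Sum>p\<in>{p\<in>Q. T p = e'}. G p) \<noteq> 0" by (simp add: supp_def val)
    then have "{p\<in>Q. T p = e'} \<noteq> {}" by force
    then show "e' \<in> T ` Q" by blast
  qed
  then show "finite (supp (subst_D N M D f))" using finQ finite_subset by blast
  have "(\<Sum>e'\<in>supp (subst_D N M D f). \<kappa> (subst_D N M D f e') * F e') = (\<Sum>e'\<in>T ` Q. \<kappa> (subst_D N M D f e') * F e')"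
    using finQ sub by (intro sum.mono_neutral_left) (auto simp: supp_def \<kappa>)
  also have "\<dots> = (\<Sum>e'\<in>T ` Q. \<Sum>p\<in>{p\<in>Q. T p = e'}. \<kappa> (G p) * F (T p))"
    by (intro sum.cong refl) (simp add: val \<kappa>s sum_distrib_right)
  also have "\<dots> = (\<Sum>p\<in>Q. \<kappa> (G p) * F (T p))"
    using finQ by (subst sum.image_gen[of Q _ T]) auto
  also have "\<dots> = (\<Sum>e\<in>supp f. \<Sum>b | b \<le> snd e. \<kappa> (f e * subst_coeff M D e b) * F (subst_exp N M D e b, b))"
  proof -
    have "(\<Sum>e\<in>supp f. \<Sum>b | b \<le> snd e. \<kappa> (f e * subst_coeff M D e b) * F (subst_exp N M D e b, b)) =
       (\<Sum>(e, b)\<in>Q. \<kappa> (f e * subst_coeff M D e b) * F (subst_exp N M D e b, b))"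
      unfolding Q_def by (rule sum.Sigma) (use ff in auto)
    then show ?thesis by (simp add: G_def T_def case_prod_unfold)
  qed
  finally show "(\<Sum>e'\<in>supp (subst_D N M D f). \<kappa> (subst_D N M D f e') * F e') = \<dots>" .
qed

lemma supp_subst_D:
  assumes "e' \<in> supp (subst_D N M D f)"
  obtains e where "e \<in> supp f" "snd e' \<le> snd e" "fst e' = subst_exp N M D e (snd e')" "subst_coeff M D e (snd e') \<noteq> 0"
proof -
  have "subst_D N M D f (fst e', snd e') \<noteq> 0" using assms by (simp add: supp_def)
  then obtain e where "e \<in> {e\<in>supp f. snd e' \<le> snd e \<and> subst_exp N M D e (snd e') = fst e'}" "f e * subst_coeff M D e (snd e') \<noteq> 0"
    unfolding subst_D_altdef by (meson sum.not_neutral_contains_not_neutral)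
  then show thesis by (intro that[of e]) auto
qed

lemma lpoly_subst_D:
  assumes "lpoly N M f"
  shows "lpoly N M (subst_D N M D f)"
  unfolding lpoly_def
proof (intro conjI ballI allI impI)
  show "finite (supp (subst_D N M D f))" using finite_supp_subst_D[of "\<lambda>c. c", OF _ _ assms] by simp
  fix e' assume "e' \<in> supp (subst_D N M D f)"
  then obtain e where e: "e \<in> supp f" "snd e' \<le> snd e" "fst e' = subst_exp N M D e (snd e')" by (rule supp_subst_D)
  show "fst e' i = 0" if "N \<le> i" for i
    unfolding e(3) using assms e(1) that by (auto simp: lpoly_def subst_exp_def shift_vec_def)
  show "snd e' j = 0" if "M \<le> j" for j
    using assms e(1) that le_funD[OF e(2), of j] by (auto simp: lpoly_def)
qed

lemma sum_below_binomial:
  fixes s u :: "nat \<Rightarrow> 'a::comm_ring_1"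
  assumes \<beta>: "\<And>j. M \<le> j \<Longrightarrow> \<beta> j = 0"
  shows "(\<Sum>b | b \<le> \<beta>. \<Prod>j<M. of_nat (\<beta> j choose b j) * u j ^ (\<beta> j - b j) * s j ^ b j) = (\<Prod>j<M. (s j + u j) ^ \<beta> j)"
proof -
  have "(\<Prod>j<M. (s j + u j) ^ \<beta> j) = (\<Prod>j<M. \<Sum>k\<le>\<beta> j. of_nat (\<beta> j choose k) * u j ^ (\<beta> j - k) * s j ^ k)"
    by (simp add: binomial_ring mult_ac)
  also have "\<dots> = (\<Sum>b\<in>PiE {..<M} (\<lambda>j. {..\<beta> j}). \<Prod>j<M. of_nat (\<beta> j choose b j) * u j ^ (\<beta> j - b j) * s j ^ b j)"
    by (rule prod_sum_PiE) auto
  also have "\<dots> = (\<Sum>b | b \<le> \<beta>. \<Prod>j<M. of_nat (\<beta> j choose b j) * u j ^ (\<beta> j - b j) * s j ^ b j)"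
  proof (rule sum.reindex_bij_witness[of _ "\<lambda>b. restrict b {..<M}" "\<lambda>b j. if j < M then b j else 0"])
    fix b assume b: "b \<in> PiE {..<M} (\<lambda>j. {..\<beta> j})"
    show "restrict (\<lambda>j. if j < M then b j else 0) {..<M} = b"
      using b by (auto simp: fun_eq_iff PiE_def extensional_def restrict_def)
    show "(\<lambda>j. if j < M then b j else 0) \<in> {b. b \<le> \<beta>}" using b by (auto simp: le_fun_def PiE_def Pi_def)
    show "(\<Prod>j<M. of_nat (\<beta> j choose (if j < M then b j else 0)) * u j ^ (\<beta> j - (if j < M then b j else 0)) * s j ^ (if j < M then b j else 0)) =
      (\<Prod>j<M. of_nat (\<beta> j choose b j) * u j ^ (\<beta> j - b j) * s j ^ b j)" by (intro prod.cong) auto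
  next
    fix b assume b: "b \<in> {b. b \<le> \<beta>}"
    have "b j = 0" if "M \<le> j" for j using b \<beta>[OF that] le_funD[of b \<beta> j] by simp
    then show "(\<lambda>j. if j < M then restrict b {..<M} j else 0) = b" by (auto simp: fun_eq_iff)
    show "restrict b {..<M} \<in> PiE {..<M} (\<lambda>j. {..\<beta> j})" using b by (auto simp: le_fun_def)
  qed
  finally show ?thesis by simp
qed

text \<open>This is f(x^r, s) for finite series \<open>s\<close>. With the factor \<open>r\<close>,
  polynomials of all stages, whose variables are successive roots, take their values in the original
  x.\<close>

definition lpol_eval :: "nat \<Rightarrow> rat \<Rightarrow> 'k::comm_ring_1 lpol \<Rightarrow> (nat \<Rightarrow> (nat \<Rightarrow> rat) \<Rightarrow>\<^sub>0 'k) \<Rightarrow> (nat \<Rightarrow> rat) \<Rightarrow>\<^sub>0 'k" where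
  "lpol_eval M r f s = (\<Sum>e\<in>supp f. sgl (\<lambda>i. r * of_int (fst e i)) (f e) * (\<Prod>j<M. s j ^ snd e j))"

lemma single_power: "sgl v c ^ n = sgl (\<lambda>i. of_nat n * v i) (c ^ n)" for v :: "nat \<Rightarrow> rat" and c :: "'k::comm_ring_1"
proof (induction n)
  case 0
  have "(\<lambda>i. of_nat 0 * v i) = 0" by (simp add: fun_eq_iff)
  then show ?case by (simp only: power_0 single_one)
next
  case (Suc n)
  have "v + (\<lambda>i. of_nat n * v i) = (\<lambda>i. of_nat (Suc n) * v i)" by (simp add: fun_eq_iff algebra_simps)
  then show ?case by (simp only: power_Suc Suc mult_single)
qed

lemma prod_single:
  fixes v :: "nat \<Rightarrow> nat \<Rightarrow> rat" and c :: "nat \<Rightarrow> 'k::comm_ring_1"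
  shows "(\<Prod>j<M. sgl (v j) (c j)) = sgl (\<lambda>i. \<Sum>j<M. v j i) (\<Prod>j<M. c j)"
proof (induction M)
  case 0
  have "(\<lambda>i. \<Sum>j<0. v j i) = 0" by (simp add: fun_eq_iff)
  then show ?case by (simp only: lessThan_0 prod.empty single_one)
next
  case (Suc M)
  have "(\<lambda>i. \<Sum>j<M. v j i) + v M = (\<lambda>i. \<Sum>j<Suc M. v j i)" by (simp add: fun_eq_iff)
  then show ?case by (simp only: prod.lessThan_Suc Suc mult_single)
qed

text \<open>Here the coefficient formula \<open>subst_D\<close> is recognized as a substitution.
  Replacing x by x^(r/k) turns x^k into x^r, and the binomial theorem reassembles the powers of s_j
  plus the monomial of \<open>D\<close>.\<close>

lemma lpol_eval_subst_D:
  fixes D :: "'k::comm_ring_1 wset"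
  assumes f: "lpoly N M f" and D: "omega_set N M \<omega> D"
  shows "lpol_eval M (r / of_nat (dG N M D)) (subst_D N M D f) s =
    lpol_eval M r f (\<lambda>j. s j + sgl (\<lambda>i. if i < N then r * fst (snd D) j i else 0) (snd (snd D) j))"
proof -
  obtain \<eta> \<Gamma> c where Dd: "D = (\<eta>, \<Gamma>, c)" by (cases D) auto
  define k where "k = dG N M D"
  define r' where "r' = r / of_nat k"
  have k: "0 < k" using dG_pos unfolding k_def Dd by blast
  define \<gamma> where "\<gamma> j i = r' * of_int (shift_vec N M D j i)" for j i
  define u where "u j = sgl (\<lambda>i. if i < N then r * \<Gamma> j i else 0) (c j)" for j
  \<comment> \<open>On rows outside \<open>Lam\<close> the two exponents may differ, but both sides
    vanish since the coefficient is zero.\<close>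
  have u: "u j = sgl (\<gamma> j) (c j)" if "j < M" for j
  proof (cases "j \<in> Lam M \<eta>")
    case True
    then have "\<gamma> j = (\<lambda>i. if i < N then r * \<Gamma> j i else 0)"
      using shift_vec_scaled[of j M D r N] by (simp add: \<gamma>_def r'_def k_def fun_eq_iff Dd)
    then show ?thesis by (simp add: u_def)
  next
    case False
    then have "c j = 0" using D that unfolding Dd omega_set_def by auto
    then show ?thesis by (simp add: u_def)
  qed
  have "lpol_eval M r' (subst_D N M D f) s = (\<Sum>e'\<in>supp (subst_D N M D f). sgl 0 (subst_D N M D f e') *
      (sgl (\<lambda>i. r' * of_int (fst e' i)) 1 * (\<Prod>j<M. s j ^ snd e' j)))"
    unfolding lpol_eval_def by (simp add: mult.assoc[symmetric] mult_single)
  also have "\<dots> = (\<Sum>e\<in>supp f. \<Sum>b | b \<le> snd e. sgl 0 (f e * subst_coeff M D e b) *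
     (sgl (\<lambda>i. r' * of_int (fst (subst_exp N M D e b, b) i)) 1 * (\<Prod>j<M. s j ^ snd (subst_exp N M D e b, b) j)))"
    by (rule sum_subst_D[OF _ _ f]) (auto simp: single_add)
  also have "\<dots> = (\<Sum>e\<in>supp f. sgl (\<lambda>i. r * of_int (fst e i)) (f e) * (\<Prod>j<M. (s j + u j) ^ snd e j))"
  proof (rule sum.cong[OF refl])
    fix e assume e: "e \<in> supp f"
    have trm: "sgl 0 (f e * subst_coeff M D e b) *
     (sgl (\<lambda>i. r' * of_int (fst (subst_exp N M D e b, b) i)) 1 * (\<Prod>j<M. s j ^ snd (subst_exp N M D e b, b) j)) =
      sgl (\<lambda>i. r * of_int (fst e i)) (f e) * (\<Prod>j<M. of_nat (snd e j choose b j) * u j ^ (snd e j - b j) * s j ^ b j)" for b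
    proof -
      have "(\<Prod>j<M. of_nat (snd e j choose b j) * u j ^ (snd e j - b j)) =
         (\<Prod>j<M. sgl (\<lambda>i. of_nat (snd e j - b j) * \<gamma> j i) (of_nat (snd e j choose b j) * c j ^ (snd e j - b j)))"
        by (intro prod.cong) (auto simp: u single_power mult_single simp flip: single_of_nat)
      also have "\<dots> = sgl (\<lambda>i. \<Sum>j<M. of_nat (snd e j - b j) * \<gamma> j i) (subst_coeff M D e b)"
        unfolding prod_single by (simp add: subst_coeff_def Dd)
      finally have 1: "(\<Prod>j<M. of_nat (snd e j choose b j) * u j ^ (snd e j - b j)) = \<dots>" .
      have "(\<lambda>i. r * of_int (fst e i)) + (\<lambda>i. \<Sum>j<M. of_nat (snd e j - b j) * \<gamma> j i) = (\<lambda>i. r' * of_int (subst_exp N M D e b i))"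
      proof
        fix i
        have "r' * of_int (subst_exp N M D e b i) = r' * of_nat k * of_int (fst e i) + (\<Sum>j<M. r' * (of_nat (snd e j - b j) * of_int (shift_vec N M D j i)))"
          by (simp add: subst_exp_def k_def[symmetric] distrib_left sum_distrib_left mult.assoc)
        also have "r' * of_nat k = r" using k by (simp add: r'_def)
        finally show "((\<lambda>i. r * of_int (fst e i)) + (\<lambda>i. \<Sum>j<M. of_nat (snd e j - b j) * \<gamma> j i)) i = r' * of_int (subst_exp N M D e b i)"
          by (simp add: \<gamma>_def mult_ac)
      qed
      then have 2: "sgl 0 (f e * subst_coeff M D e b) * sgl (\<lambda>i. r' * of_int (subst_exp N M D e b i)) 1 =
          sgl (\<lambda>i. r * of_int (fst e i)) (f e) * sgl (\<lambda>i. \<Sum>j<M. of_nat (snd e j - b j) * \<gamma> j i) (subst_coeff M D e b)"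
        by (simp add: mult_single)
      show ?thesis unfolding prod.distrib[of _ "\<lambda>j. s j ^ b j"] 1 fst_conv snd_conv mult.assoc[symmetric] 2 ..
    qed
    have "\<And>j. M \<le> j \<Longrightarrow> snd e j = 0" using f e by (auto simp: lpoly_def)
    from sum_below_binomial[of M "snd e" u s, OF this]
    show "(\<Sum>b | b \<le> snd e. sgl 0 (f e * subst_coeff M D e b) *
     (sgl (\<lambda>i. r' * of_int (fst (subst_exp N M D e b, b) i)) 1 * (\<Prod>j<M. s j ^ snd (subst_exp N M D e b, b) j))) =
      sgl (\<lambda>i. r * of_int (fst e i)) (f e) * (\<Prod>j<M. (s j + u j) ^ snd e j)"
      unfolding trm by (simp add: sum_distrib_left[symmetric])
  qed
  finally show ?thesis by (simp add: lpol_eval_def r'_def k_def u_def Dd cong: if_cong)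
qed

subsection \<open>Limits of series\<close>

definition wgt :: "nat \<Rightarrow> (nat \<Rightarrow> real) \<Rightarrow> (nat \<Rightarrow> rat) \<Rightarrow> real" where
  "wgt N \<omega> v = (\<Sum>i<N. \<omega> i * real_of_rat (v i))"

definition vecs :: "nat \<Rightarrow> (nat \<Rightarrow> rat) set" where
  "vecs N = {v. \<forall>i\<ge>N. v i = 0}"

lemma wgt_add: "wgt N \<omega> (u + v) = wgt N \<omega> u + wgt N \<omega> v"
  by (simp add: wgt_def of_rat_add distrib_left sum.distrib)

lemma wgt_diff: "wgt N \<omega> (u - v) = wgt N \<omega> u - wgt N \<omega> v"
  by (simp add: wgt_def of_rat_diff right_diff_distrib sum_subtractf)

lemma wgt_zero: "wgt N \<omega> 0 = 0"
  by (simp add: wgt_def)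

lemma wgt_scale: "wgt N \<omega> (\<lambda>i. r * v i) = real_of_rat r * wgt N \<omega> v"
  by (simp add: wgt_def of_rat_mult sum_distrib_left mult_ac)

lemma wgt_sum: "wgt N \<omega> (\<lambda>i. \<Sum>x\<in>A. f x i) = (\<Sum>x\<in>A. wgt N \<omega> (f x))"
  unfolding wgt_def by (subst sum.swap) (simp add: of_rat_sum sum_distrib_left)

lemma vecs_closed: "0 \<in> vecs N" "u \<in> vecs N \<Longrightarrow> v \<in> vecs N \<Longrightarrow> u + v \<in> vecs N"
  "u \<in> vecs N \<Longrightarrow> v \<in> vecs N \<Longrightarrow> u - v \<in> vecs N" "u \<in> vecs N \<Longrightarrow> (\<lambda>i. r * u i) \<in> vecs N"
  by (auto simp: vecs_def)

text \<open>Finitely many exponents below each weight are enough for products to be finite sums and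
  for a least weight to exist. The condition is also stable under finite unions and sums of
  sets.\<close>

definition left_finite :: "nat \<Rightarrow> (nat \<Rightarrow> real) \<Rightarrow> (nat \<Rightarrow> rat) set \<Rightarrow> bool" where
  "left_finite N \<omega> A \<longleftrightarrow> A \<subseteq> vecs N \<and> (\<forall>B. finite {v\<in>A. wgt N \<omega> v \<le> B})"

lemma left_finite_bounded_below:
  assumes "left_finite N \<omega> A"
  obtains m where "\<And>v. v \<in> A \<Longrightarrow> m \<le> wgt N \<omega> v"
proof (cases "A = {}")
  case False
  then obtain a where a: "a \<in> A" by blast
  let ?F = "{v\<in>A. wgt N \<omega> v \<le> wgt N \<omega> a}"
  have "finite ?F" using assms by (simp add: left_finite_def)
  then have le: "Min (wgt N \<omega> ` ?F) \<le> wgt N \<omega> v" if "v \<in> ?F" for v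
    using that by (intro Min_le) auto
  have "Min (wgt N \<omega> ` ?F) \<le> wgt N \<omega> v" if "v \<in> A" for v
    using le[of a] le[of v] a that by (cases "wgt N \<omega> v \<le> wgt N \<omega> a") auto
  then show thesis using that by blast
qed (use that in auto)

lemma left_finite_finite: "finite A \<Longrightarrow> A \<subseteq> vecs N \<Longrightarrow> left_finite N \<omega> A"
  by (auto simp: left_finite_def)

lemma left_finite_UN:
  assumes "finite E" "\<And>e. e \<in> E \<Longrightarrow> left_finite N \<omega> (A e)"
  shows "left_finite N \<omega> (\<Union>e\<in>E. A e)"
proof -
  have "{v \<in> (\<Union>e\<in>E. A e). wgt N \<omega> v \<le> B} = (\<Union>e\<in>E. {v \<in> A e. wgt N \<omega> v \<le> B})" for B by auto
  then show ?thesis using assms by (auto simp: left_finite_def)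
qed

lemma left_finite_sums:
  assumes A: "left_finite N \<omega> A" and B: "left_finite N \<omega> B"
  shows "left_finite N \<omega> ((\<lambda>(a, b). a + b) ` (A \<times> B))"
  unfolding left_finite_def
proof (intro conjI allI)
  show "(\<lambda>(a, b). a + b) ` (A \<times> B) \<subseteq> vecs N"
    using A B by (auto simp: left_finite_def intro!: vecs_closed)
  fix C
  obtain m where m: "\<And>v. v \<in> A \<Longrightarrow> m \<le> wgt N \<omega> v" using left_finite_bounded_below[OF A] by blast
  obtain m' where m': "\<And>v. v \<in> B \<Longrightarrow> m' \<le> wgt N \<omega> v" using left_finite_bounded_below[OF B] by blast
  have "{v \<in> (\<lambda>(a, b). a + b) ` (A \<times> B). wgt N \<omega> v \<le> C} \<subseteq>
    (\<lambda>(a, b). a + b) ` ({v\<in>A. wgt N \<omega> v \<le> C - m'} \<times> {v\<in>B. wgt N \<omega> v \<le> C - m})"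
  proof
    fix v assume "v \<in> {v \<in> (\<lambda>(a, b). a + b) ` (A \<times> B). wgt N \<omega> v \<le> C}"
    then obtain a b where v: "v = a + b" "a \<in> A" "b \<in> B" "wgt N \<omega> a + wgt N \<omega> b \<le> C" by (auto simp: wgt_add)
    then have "wgt N \<omega> a \<le> C - m'" "wgt N \<omega> b \<le> C - m" using m[of a] m'[of b] by auto
    then show "v \<in> (\<lambda>(a, b). a + b) ` ({v\<in>A. wgt N \<omega> v \<le> C - m'} \<times> {v\<in>B. wgt N \<omega> v \<le> C - m})"
      using v by (intro image_eqI[of _ _ "(a, b)"]) auto
  qed
  moreover have "finite \<dots>" using A B by (auto simp: left_finite_def)
  ultimately show "finite {v \<in> (\<lambda>(a, b). a + b) ` (A \<times> B). wgt N \<omega> v \<le> C}" by (rule finite_subset)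
qed

text \<open>Coefficients become stationary up to every weight. The common left-finite support gives
  one lower bound on the weights for the whole sequence, without which products would not pass to
  the limit.\<close>

definition ser_conv :: "nat \<Rightarrow> (nat \<Rightarrow> real) \<Rightarrow> (nat \<Rightarrow> 'k::comm_ring_1 pser) \<Rightarrow> 'k pser \<Rightarrow> bool" where
  "ser_conv N \<omega> \<psi> \<phi> \<longleftrightarrow> (\<exists>A. left_finite N \<omega> A \<and> (\<forall>i. supp (\<psi> i) \<subseteq> A) \<and> supp \<phi> \<subseteq> A) \<and>
     (\<forall>B. \<exists>i0. \<forall>i\<ge>i0. \<forall>v. wgt N \<omega> v \<le> B \<longrightarrow> \<psi> i v = \<phi> v)"

lemma ser_conv_supp:
  "ser_conv N \<omega> \<psi> \<phi> \<Longrightarrow> \<exists>A. left_finite N \<omega> A \<and> (\<forall>i. supp (\<psi> i) \<subseteq> A) \<and> supp \<phi> \<subseteq> A"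
  unfolding ser_conv_def by (rule conjunct1)

lemma ser_conv_eventually:
  "ser_conv N \<omega> \<psi> \<phi> \<Longrightarrow> \<exists>i0. \<forall>i\<ge>i0. \<forall>v. wgt N \<omega> v \<le> B \<longrightarrow> \<psi> i v = \<phi> v"
  unfolding ser_conv_def by (elim conjE allE)

lemma ser_convI:
  assumes "left_finite N \<omega> A" "\<And>i. supp (\<psi> i) \<subseteq> A" "supp \<phi> \<subseteq> A"
    "\<And>B. \<exists>i0. \<forall>i\<ge>i0. \<forall>v. wgt N \<omega> v \<le> B \<longrightarrow> \<psi> i v = \<phi> v"
  shows "ser_conv N \<omega> \<psi> \<phi>"
  unfolding ser_conv_def by (intro conjI exI[of _ A] allI assms)

lemma ser_conv_const: "finite (supp \<phi>) \<Longrightarrow> supp \<phi> \<subseteq> vecs N \<Longrightarrow> ser_conv N \<omega> (\<lambda>_. \<phi>) \<phi>"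
  by (rule ser_convI[of _ _ "supp \<phi>"]) (auto intro: left_finite_finite)

text \<open>Summing over fixed supersets of the supports gives all members of a convergent sequence
  and its limit the same index set.\<close>

lemma ps_mult_superset:
  assumes "left_finite N \<omega> A" "left_finite N \<omega> B" "supp \<phi> \<subseteq> A" "supp \<psi> \<subseteq> B"
  shows "ps_mult \<phi> \<psi> v = (\<Sum>(a, b)\<in>{(a, b). a \<in> A \<and> b \<in> B \<and> a + b = v}. \<phi> a * \<psi> b)"
    and "finite {(a, b). a \<in> A \<and> b \<in> B \<and> a + b = v}"
proof -
  obtain m where m: "\<And>v. v \<in> B \<Longrightarrow> m \<le> wgt N \<omega> v" using left_finite_bounded_below[OF assms(2)] by blast
  have "{(a, b). a \<in> A \<and> b \<in> B \<and> a + b = v} \<subseteq> (\<lambda>a. (a, v - a)) ` {a\<in>A. wgt N \<omega> a \<le> wgt N \<omega> v - m}"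
  proof
    fix x assume "x \<in> {(a, b). a \<in> A \<and> b \<in> B \<and> a + b = v}"
    then obtain a b where x: "x = (a, b)" "a \<in> A" "b \<in> B" "v = a + b" by blast
    then have "wgt N \<omega> a \<le> wgt N \<omega> v - m" using m[of b] by (simp add: wgt_add)
    moreover have "x = (a, v - a)" using x by simp
    ultimately show "x \<in> (\<lambda>a. (a, v - a)) ` {a\<in>A. wgt N \<omega> a \<le> wgt N \<omega> v - m}" using x(2) by blast
  qed
  moreover have "finite {a\<in>A. wgt N \<omega> a \<le> wgt N \<omega> v - m}" using assms(1) by (simp add: left_finite_def)
  ultimately show fin: "finite {(a, b). a \<in> A \<and> b \<in> B \<and> a + b = v}" by (meson finite_imageI finite_subset)
  show "ps_mult \<phi> \<psi> v = (\<Sum>(a, b)\<in>{(a, b). a \<in> A \<and> b \<in> B \<and> a + b = v}. \<phi> a * \<psi> b)"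
    unfolding ps_mult_def using assms(3,4)
    by (intro sum.mono_neutral_left fin) (auto simp: supp_def plus_fun_def)
qed

text \<open>A factor of an exponent of weight at most B has weight at most B minus the lower bound
  of the other factor, so agreement of both factors up to these two thresholds suffices.\<close>

lemma ser_conv_mult:
  assumes "ser_conv N \<omega> \<psi> \<phi>" "ser_conv N \<omega> \<psi>' \<phi>'"
  shows "ser_conv N \<omega> (\<lambda>i. ps_mult (\<psi> i) (\<psi>' i)) (ps_mult \<phi> \<phi>')"
proof -
  obtain A where A: "left_finite N \<omega> A" "\<And>i. supp (\<psi> i) \<subseteq> A" "supp \<phi> \<subseteq> A" using ser_conv_supp[OF assms(1)] by (elim exE conjE) (rule that, auto)
  obtain A' where A': "left_finite N \<omega> A'" "\<And>i. supp (\<psi>' i) \<subseteq> A'" "supp \<phi>' \<subseteq> A'" using ser_conv_supp[OF assms(2)] by (elim exE conjE) (rule that, auto)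
  obtain m where m: "\<And>v. v \<in> A \<Longrightarrow> m \<le> wgt N \<omega> v" using left_finite_bounded_below[OF A(1)] by blast
  obtain m' where m': "\<And>v. v \<in> A' \<Longrightarrow> m' \<le> wgt N \<omega> v" using left_finite_bounded_below[OF A'(1)] by blast
  let ?S = "(\<lambda>(a, b). a + b) ` (A \<times> A')"
  have sub: "supp (ps_mult f g) \<subseteq> ?S" if "supp f \<subseteq> A" "supp g \<subseteq> A'" for f g :: "'a pser"
  proof
    fix v assume "v \<in> supp (ps_mult f g)"
    then have "(\<Sum>(a, b)\<in>{(a, b). a \<in> A \<and> b \<in> A' \<and> a + b = v}. f a * g b) \<noteq> 0"
      using ps_mult_superset(1)[OF A(1) A'(1) that] by (simp add: supp_def)
    then have "{(a, b). a \<in> A \<and> b \<in> A' \<and> a + b = v} \<noteq> {}" by (metis (no_types, lifting) sum.empty)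
    then show "v \<in> ?S" by auto
  qed
  have "\<exists>i0. \<forall>i\<ge>i0. \<forall>v. wgt N \<omega> v \<le> B \<longrightarrow> ps_mult (\<psi> i) (\<psi>' i) v = ps_mult \<phi> \<phi>' v" for B
  proof -
    obtain i0 where i0: "\<forall>i\<ge>i0. \<forall>v. wgt N \<omega> v \<le> B - m' \<longrightarrow> \<psi> i v = \<phi> v"
      using ser_conv_eventually[OF assms(1)] ..
    obtain i1 where i1: "\<forall>i\<ge>i1. \<forall>v. wgt N \<omega> v \<le> B - m \<longrightarrow> \<psi>' i v = \<phi>' v"
      using ser_conv_eventually[OF assms(2)] ..
    have "ps_mult (\<psi> i) (\<psi>' i) v = ps_mult \<phi> \<phi>' v" if i: "max i0 i1 \<le> i" and v: "wgt N \<omega> v \<le> B" for i v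
      unfolding ps_mult_superset(1)[OF A(1) A'(1) A(2) A'(2)] ps_mult_superset(1)[OF A(1) A'(1) A(3) A'(3)]
    proof (rule sum.cong[OF refl])
      fix x assume "x \<in> {(a, b). a \<in> A \<and> b \<in> A' \<and> a + b = v}"
      then obtain a b where x: "x = (a, b)" "a \<in> A" "b \<in> A'" "v = a + b" by blast
      then have "\<psi> i a = \<phi> a" "\<psi>' i b = \<phi>' b"
        using m[of a] m'[of b] v i by (auto intro!: i0[rule_format] i1[rule_format] simp: wgt_add)
      then show "(case x of (a, b) \<Rightarrow> \<psi> i a * \<psi>' i b) = (case x of (a, b) \<Rightarrow> \<phi> a * \<phi>' b)" by (simp add: x)
    qed
    then show ?thesis by blast
  qed
  then show ?thesis
    by (rule ser_convI[OF left_finite_sums[OF A(1) A'(1)] sub[OF A(2) A'(2)] sub[OF A(3) A'(3)]])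
qed

lemma ser_conv_lincomb:
  assumes E: "finite E" and conv: "\<And>e. e \<in> E \<Longrightarrow> ser_conv N \<omega> (\<psi> e) (\<phi> e)"
  shows "ser_conv N \<omega> (\<lambda>i v. \<Sum>e\<in>E. f e * \<psi> e i v) (\<lambda>v. \<Sum>e\<in>E. f e * \<phi> e v)"
proof -
  have "\<forall>e\<in>E. \<exists>A. left_finite N \<omega> A \<and> (\<forall>i. supp (\<psi> e i) \<subseteq> A) \<and> supp (\<phi> e) \<subseteq> A"
    using ser_conv_supp[OF conv] by (intro ballI)
  from bchoice[OF this] obtain A where
    "\<forall>e\<in>E. left_finite N \<omega> (A e) \<and> (\<forall>i. supp (\<psi> e i) \<subseteq> A e) \<and> supp (\<phi> e) \<subseteq> A e" ..
  then have A: "left_finite N \<omega> (A e)" "supp (\<psi> e i) \<subseteq> A e" "supp (\<phi> e) \<subseteq> A e" if "e \<in> E" for e i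
    using that by auto
  have sub: "supp (\<lambda>v. \<Sum>e\<in>E. f e * g e v) \<subseteq> (\<Union>e\<in>E. A e)" if "\<And>e. e \<in> E \<Longrightarrow> supp (g e) \<subseteq> A e" for g
  proof
    fix v assume "v \<in> supp (\<lambda>v. \<Sum>e\<in>E. f e * g e v)"
    then obtain e where "e \<in> E" "f e * g e v \<noteq> 0" unfolding supp_def by (auto elim: sum.not_neutral_contains_not_neutral)
    then have "g e v \<noteq> 0" by auto
    then show "v \<in> (\<Union>e\<in>E. A e)" using that[OF \<open>e \<in> E\<close>] \<open>e \<in> E\<close> by (auto simp: supp_def)
  qed
  have "\<exists>i0. \<forall>i\<ge>i0. \<forall>v. wgt N \<omega> v \<le> B \<longrightarrow> (\<Sum>e\<in>E. f e * \<psi> e i v) = (\<Sum>e\<in>E. f e * \<phi> e v)" for B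
  proof -
    have "\<forall>e\<in>E. \<exists>i0. \<forall>i\<ge>i0. \<forall>v. wgt N \<omega> v \<le> B \<longrightarrow> \<psi> e i v = \<phi> e v"
      using ser_conv_eventually[OF conv] by (intro ballI)
    from bchoice[OF this] obtain i0 where i0: "\<forall>e\<in>E. \<forall>i\<ge>i0 e. \<forall>v. wgt N \<omega> v \<le> B \<longrightarrow> \<psi> e i v = \<phi> e v" ..
    have "(\<Sum>e\<in>E. f e * \<psi> e i v) = (\<Sum>e\<in>E. f e * \<phi> e v)" if i: "sum i0 E \<le> i" and v: "wgt N \<omega> v \<le> B" for i v
    proof (rule sum.cong[OF refl])
      fix e assume e: "e \<in> E"
      have "i0 e \<le> sum i0 E" using E e by (intro member_le_sum) auto
      then show "f e * \<psi> e i v = f e * \<phi> e v" using i0[rule_format, OF e _ v, of i] i by simp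
    qed
    then show ?thesis by blast
  qed
  note eventually = this
  have lf: "left_finite N \<omega> (\<Union>e\<in>E. A e)" by (rule left_finite_UN[OF E]) (rule A(1))
  have s1: "supp (\<lambda>v. \<Sum>e\<in>E. f e * \<psi> e i v) \<subseteq> (\<Union>e\<in>E. A e)" for i by (rule sub) (rule A(2))
  have s2: "supp (\<lambda>v. \<Sum>e\<in>E. f e * \<phi> e v) \<subseteq> (\<Union>e\<in>E. A e)" by (rule sub) (rule A(3))
  show ?thesis by (rule ser_convI[OF lf s1 s2 eventually])
qed

lemma lookup_times_pser: "lkp (p * q) = ps_mult (lkp p) (lkp q)"
  by (rule ext) (simp add: lookup_times_keys ps_mult_def keys_eq_supp plus_fun_def)

lemma lookup_single_one: "lkp (sgl a 1) = ps_monom a"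
  by (rule ext) (auto simp: ps_monom_def lookup_single when_def)

lemma lookup_one_pser: "lkp (1 :: (nat \<Rightarrow> rat) \<Rightarrow>\<^sub>0 'k::comm_ring_1) = ps_monom (\<lambda>_. 0)"
  by (rule ext) (auto simp: lookup_one ps_monom_def when_def zero_fun_def)

lemma lookup_power_pser: "lkp (p ^ n) = ps_pow (lkp p) n"
  by (induction n) (simp_all add: lookup_one_pser lookup_times_pser power_Suc2 del: power_Suc)

lemma lookup_prod_pser: "lkp (\<Prod>j<m. s j ^ \<beta> j) = ps_ymon (\<lambda>j. lkp (s j)) \<beta> m"
  by (induction m) (simp_all add: lookup_one_pser lookup_times_pser lookup_power_pser)

lemma eval_ser_lookup: "eval_ser M f (\<lambda>j. lkp (s j)) = lkp (lpol_eval M 1 f s)"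
proof
  fix v
  have "lkp (sgl 0 (f e) * (sgl (\<lambda>i. of_int (fst e i)) 1 * (\<Prod>j<M. s j ^ snd e j))) v =
     f e * ps_mult (ps_monom (\<lambda>i. of_int (fst e i))) (ps_ymon (\<lambda>j. lkp (s j)) (snd e) M) v" for e
  proof -
    have "lkp (sgl 0 c * p) v = c * lkp p v" for c and p :: "(nat \<Rightarrow> rat) \<Rightarrow>\<^sub>0 'a"
      unfolding mult_map_scale_conv_mult[symmetric] by (simp add: map.rep_eq when_def)
    then show ?thesis by (simp only: lookup_times_pser[of "sgl (\<lambda>i. of_int (fst e i)) 1"] lookup_single_one lookup_prod_pser)
  qed
  moreover have "sgl 0 (f e) * (sgl (\<lambda>i. of_int (fst e i)) 1 * (\<Prod>j<M. s j ^ snd e j)) =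
     sgl (\<lambda>i. 1 * of_int (fst e i)) (f e) * (\<Prod>j<M. s j ^ snd e j)" for e
    by (simp add: mult.assoc[symmetric] mult_single)
  ultimately show "eval_ser M f (\<lambda>j. lkp (s j)) v = lkp (lpol_eval M 1 f s) v"
    unfolding eval_ser_def lpol_eval_def lookup_sum by simp
qed

lemma ser_conv_eval_ser:
  assumes f: "lpoly N M f" and conv: "\<And>j. j < M \<Longrightarrow> ser_conv N \<omega> (\<lambda>i. \<psi> i j) (\<phi> j)"
  shows "ser_conv N \<omega> (\<lambda>i. eval_ser M f (\<psi> i)) (eval_ser M f \<phi>)"
proof -
  have mono: "ser_conv N \<omega> (\<lambda>_. ps_monom a :: 'a pser) (ps_monom a)" if "a \<in> vecs N" for a
    by (rule ser_conv_const) (use that in \<open>auto simp: supp_def ps_monom_def split: if_splits\<close>)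
  have mono0: "ser_conv N \<omega> (\<lambda>_. ps_monom (\<lambda>_. 0) :: 'a pser) (ps_monom (\<lambda>_. 0))"
    by (rule mono) (simp add: vecs_def)
  have pow: "ser_conv N \<omega> (\<lambda>i. ps_pow (\<psi> i j) n) (ps_pow (\<phi> j) n)" if "j < M" for j n
    by (induction n) (simp_all add: mono0 ser_conv_mult conv[OF that])
  have ymon: "ser_conv N \<omega> (\<lambda>i. ps_ymon (\<psi> i) \<beta> m) (ps_ymon \<phi> \<beta> m)" if "m \<le> M" for \<beta> m
    using that by (induction m) (simp_all add: mono0 ser_conv_mult pow)
  show ?thesis unfolding eval_ser_def
  proof (rule ser_conv_lincomb)
    show "finite (supp f)" using f by (simp add: lpoly_def)
    fix e assume "e \<in> supp f"
    then have "(\<lambda>i. rat_of_int (fst e i)) \<in> vecs N" using f by (auto simp: lpoly_def vecs_def)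
    from ser_conv_mult[OF mono[OF this] ymon[OF order_refl]]
    show "ser_conv N \<omega> (\<lambda>i. ps_mult (ps_monom (\<lambda>i. of_int (fst e i))) (ps_ymon (\<psi> i) (snd e) M))
      (ps_mult (ps_monom (\<lambda>i. of_int (fst e i))) (ps_ymon \<phi> (snd e) M))" .
  qed
qed

subsection \<open>The polynomials along an omega-sequence\<close>

fun stage :: "nat \<Rightarrow> nat \<Rightarrow> (nat \<Rightarrow> 'k::comm_ring_1 wset) \<Rightarrow> 'k lpol \<Rightarrow> nat \<Rightarrow> 'k lpol" where
  "stage N M S f 0 = f"
| "stage N M S f (Suc i) = subst_D N M (S i) (stage N M S f i)"

lemma lpoly_stage: "lpoly N M f \<Longrightarrow> lpoly N M (stage N M S f i)"
  by (induction i) (auto intro: lpoly_subst_D)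

text \<open>Generators enter \<open>gen_ideal\<close> only as multiples, so \<open>g\<close> is
  recovered as 1 * g; finite support identifies this product with one in a ring.\<close>

lemma gen_ideal_incl:
  assumes "g \<in> G" "finite (supp g)"
  shows "g \<in> gen_ideal N M G"
proof -
  let ?g = "Abs_poly_mapping g"
  have "lpol_mult (lkp 1) (lkp ?g) = lkp ?g" by (simp add: lookup_times_lpol[symmetric])
  then have "lpol_mult (lkp 1) g = g" using assms by (simp add: lookup_Abs_supp)
  moreover have "lpoly N M (lkp (1 :: lexp \<Rightarrow>\<^sub>0 'a))"
    by (auto simp: lpoly_def keys_eq_supp[symmetric])
  ultimately show ?thesis using gen_mult[OF assms(1), of N M "lkp 1"] by simp
qed

lemma lookup_lpol_eval_zero:
  assumes "lpoly N M f"
  shows "lkp (lpol_eval M r f (\<lambda>_. 0)) v = (\<Sum>e\<in>{e\<in>supp f. snd e = 0 \<and> (\<lambda>i. r * of_int (fst e i)) = v}. f e)"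
proof -
  have fin: "finite (supp f)" using assms by (simp add: lpoly_def)
  have "lkp (sgl (\<lambda>i. r * of_int (fst e i)) (f e) * (\<Prod>j<M. 0 ^ snd e j)) v =
      (if snd e = 0 \<and> (\<lambda>i. r * of_int (fst e i)) = v then f e else 0)" if e: "e \<in> supp f" for e
  proof (cases "snd e = 0")
    case True
    then have "(\<Prod>j<M. 0 ^ snd e j) = (1 :: (nat \<Rightarrow> rat) \<Rightarrow>\<^sub>0 'a)" by simp
    then show ?thesis using True by (simp add: lookup_single when_def)
  next
    case False
    then obtain j where j: "snd e j \<noteq> 0" by (auto simp: fun_eq_iff)
    then have "j < M" using assms e unfolding lpoly_def by (metis not_less)
    then have "(\<Prod>j<M. 0 ^ snd e j) = (0 :: (nat \<Rightarrow> rat) \<Rightarrow>\<^sub>0 'a)"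
      using j by (intro prod_zero) (auto intro!: bexI[of _ j] zero_power)
    then show ?thesis using False by simp
  qed
  then show ?thesis unfolding lpol_eval_def lookup_sum sum.inter_filter[OF fin] by (intro sum.cong) auto
qed

text \<open>Admissibility enters in the form of \<open>elim_poly\<close>, the conclusion of the
  elimination argument.\<close>

locale omega_seq =
  fixes N M :: nat and \<omega> :: "nat \<Rightarrow> real" and I :: "'k::field_char_0 lpol set" and S :: "nat \<Rightarrow> 'k wset"
  assumes indep: "(\<Sum>i<N. real_of_rat (q i) * \<omega> i) = 0 \<Longrightarrow> i < N \<Longrightarrow> q i = 0"
    and ideal: "is_ideal N M I"
    and seq: "omega_sequence N M \<omega> I S"
    and elim_poly: "j < M \<Longrightarrow> \<exists>P\<in>I. supp P \<noteq> {} \<and> (\<forall>e\<in>supp P. \<forall>l. l \<noteq> j \<longrightarrow> snd e l = 0)"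
begin

definition "r = r_seq N M S"
definition "R i = real_of_rat (r i)"
definition "\<Gamma> i = fst (snd (S i))"
definition "c i = snd (snd (S i))"
definition "L i = Lam M (fst (S i))"
text \<open>Exponents and orders are normalized to the original x, so \<gamma> is the exponent of
  the i-th term of the j-th coordinate of the series. In this scale the growth condition of an
  omega-sequence says that \<theta> is strictly increasing in \<open>i\<close>.\<close>

definition "\<gamma> i j l = (if l < N then r i * \<Gamma> i j l else 0)"
definition "\<theta> i j = wgt N \<omega> (\<gamma> i j)"

definition expo :: "nat \<Rightarrow> lexp \<Rightarrow> nat \<Rightarrow> rat" where
  "expo i e = (\<lambda>l. r i * of_int (fst e l))"

lemma wgt_inj: "u \<in> vecs N \<Longrightarrow> v \<in> vecs N \<Longrightarrow> wgt N \<omega> u = wgt N \<omega> v \<Longrightarrow> u = v"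
proof
  fix i assume uv: "u \<in> vecs N" "v \<in> vecs N" "wgt N \<omega> u = wgt N \<omega> v"
  then have "(\<Sum>i<N. real_of_rat ((u - v) i) * \<omega> i) = 0"
    using wgt_diff[of N \<omega> u v] by (simp add: wgt_def mult.commute)
  then show "u i = v i" using indep[of "u - v" i] uv by (cases "i < N") (auto simp: vecs_def)
qed

lemma omega_set_S: "omega_set N M \<omega> (S i)" and in_tau_S: "in_tau N M (ideal_seq N M I S i) \<omega> (fst (S i))"
  and eval_one_S: "f \<in> In_w N M \<omega> (fst (S i)) (ideal_seq N M I S i) \<Longrightarrow> eval_one M f (c i) = 0"
proof -
  have "starting_set N M \<omega> (ideal_seq N M I S i) (S i)" using seq by (auto simp: omega_sequence_def)
  then show "omega_set N M \<omega> (S i)" "in_tau N M (ideal_seq N M I S i) \<omega> (fst (S i))"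
    "f \<in> In_w N M \<omega> (fst (S i)) (ideal_seq N M I S i) \<Longrightarrow> eval_one M f (c i) = 0"
    by (auto simp: starting_set_def c_def split: prod.splits)
qed

lemma dG_S_pos: "0 < dG N M (S i)"
  using dG_pos[of N M "fst (S i)" "\<Gamma> i" "c i"] by (simp add: \<Gamma>_def c_def)

lemma r_0: "r 0 = 1" and r_Suc: "r (Suc i) = r i / of_nat (dG N M (S i))"
  by (simp_all add: r_def r_seq_def)

lemma r_pos: "0 < r i"
  using dG_S_pos by (simp add: r_def r_seq_def prod_pos)

lemma R_pos: "0 < R i"
  using r_pos by (simp add: R_def)

lemma L_less: "j \<in> L i \<Longrightarrow> j < M"
  by (simp add: L_def Lam_def)

lemma c_nonzero: "j \<in> L i \<Longrightarrow> c i j \<noteq> 0" and c_zero: "j < M \<Longrightarrow> j \<notin> L i \<Longrightarrow> c i j = 0"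
proof -
  have "\<forall>j<M. (j \<in> L i \<longrightarrow> c i j \<noteq> 0) \<and> (j \<notin> L i \<longrightarrow> c i j = 0)"
    using omega_set_S[of i] by (cases "S i") (simp add: omega_set_def L_def c_def)
  then show "j \<in> L i \<Longrightarrow> c i j \<noteq> 0" "j < M \<Longrightarrow> j \<notin> L i \<Longrightarrow> c i j = 0" using L_less by auto
qed

lemma \<gamma>_vecs: "\<gamma> i j \<in> vecs N"
  by (simp add: \<gamma>_def vecs_def)

lemma eta_eq: "j \<in> L i \<Longrightarrow> fst (S i) j = ereal (\<theta> i j / R i)"
proof -
  assume j: "j \<in> L i"
  have "\<theta> i j = R i * (\<Sum>l<N. \<omega> l * real_of_rat (\<Gamma> i j l))"
    by (simp add: \<theta>_def wgt_def \<gamma>_def R_def of_rat_mult sum_distrib_left mult_ac)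
  moreover have "fst (S i) j = ereal (\<Sum>l<N. \<omega> l * real_of_rat (\<Gamma> i j l))"
    using omega_set_S[of i] j L_less[OF j] by (auto simp: omega_set_def L_def \<Gamma>_def split: prod.splits)
  ultimately show ?thesis using R_pos[of i] by simp
qed

lemma eta_infty: "j < M \<Longrightarrow> j \<notin> L i \<Longrightarrow> fst (S i) j = \<infinity>"
  by (simp add: L_def Lam_def)

text \<open>An infinite order cannot be exceeded, so a coordinate that has left \<open>L\<close>
  never returns. For the others the factor \<open>dG\<close> in the growth condition cancels against
  the change from \<open>R i\<close> to \<open>R (Suc i)\<close>.\<close>

lemma L_Suc: "j \<in> L (Suc i) \<Longrightarrow> j \<in> L i"
  and \<theta>_less: "j \<in> L (Suc i) \<Longrightarrow> \<theta> i j < \<theta> (Suc i) j"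
proof -
  assume j: "j \<in> L (Suc i)"
  have lt: "ereal (real (dG N M (S i))) * fst (S i) j < fst (S (Suc i)) j"
    using seq j by (auto simp: omega_sequence_def L_def)
  show jL: "j \<in> L i"
  proof (rule ccontr)
    assume "j \<notin> L i"
    then show False using eta_infty[OF L_less[OF j]] lt dG_S_pos[of i] by simp
  qed
  have "real (dG N M (S i)) * (\<theta> i j / R i) < \<theta> (Suc i) j / R (Suc i)"
    using lt unfolding eta_eq[OF j] eta_eq[OF jL] by simp
  then have lt': "R (Suc i) * (real (dG N M (S i)) * (\<theta> i j / R i)) < R (Suc i) * (\<theta> (Suc i) j / R (Suc i))"
    using R_pos by (intro mult_strict_left_mono)
  have "R (Suc i) * real (dG N M (S i)) = R i"
    using dG_S_pos[of i] by (simp add: R_def r_Suc of_rat_divide)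
  then have "R (Suc i) * (real (dG N M (S i)) * (\<theta> i j / R i)) = \<theta> i j"
    using R_pos[of i] by (simp add: mult.assoc[symmetric])
  then show "\<theta> i j < \<theta> (Suc i) j" using lt' R_pos[of "Suc i"] by simp
qed

lemma L_antimono: "i \<le> i' \<Longrightarrow> L i' \<subseteq> L i"
  by (induction rule: dec_induct) (use L_Suc in auto)

lemma \<theta>_strict: "i < i' \<Longrightarrow> j \<in> L i' \<Longrightarrow> \<theta> i j < \<theta> i' j"
proof (induction i')
  case (Suc i')
  then show ?case using \<theta>_less[OF Suc.prems(2)] L_Suc[OF Suc.prems(2)] by (cases "i = i'") auto
qed simp

lemma expo_vecs: "lpoly N M f \<Longrightarrow> e \<in> supp f \<Longrightarrow> expo i e \<in> vecs N"
  by (simp add: expo_def vecs_def lpoly_def)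

lemma expo_inj: "expo i e = expo i e' \<Longrightarrow> fst e = fst e'"
  using r_pos[of i] by (auto simp: expo_def fun_eq_iff)

lemma stage_in_ideal: "f \<in> I \<Longrightarrow> stage N M S f i \<in> ideal_seq N M I S i"
proof (induction i)
  case (Suc i)
  have "finite (supp (stage N M S f (Suc i)))"
    using lpoly_stage[of N M f S "Suc i"] ideal Suc.prems by (simp add: is_ideal_def lpoly_def)
  then show ?case using Suc unfolding ideal_seq.simps trans_ideal_def
    by (intro gen_ideal_incl) auto
qed simp

lemma in_w_stage: "f \<in> I \<Longrightarrow> in_w N M \<omega> (fst (S i)) (stage N M S f i) \<in> In_w N M \<omega> (fst (S i)) (ideal_seq N M I S i)"
proof -
  assume f: "f \<in> I"
  let ?g = "stage N M S f i"
  have "finite (supp ?g)" using lpoly_stage[of N M f S i] ideal f by (simp add: is_ideal_def lpoly_def)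
  moreover have "supp (in_w N M \<omega> (fst (S i)) ?g) \<subseteq> supp ?g" by (auto simp: supp_def in_w_def)
  ultimately show ?thesis unfolding In_w_def
    using stage_in_ideal[OF f, of i] by (intro gen_ideal_incl) (auto intro: finite_subset)
qed

lemma wt_finite:
  assumes "\<And>l. l < M \<Longrightarrow> snd e l \<noteq> 0 \<Longrightarrow> l \<in> L i"
  shows "wt N M \<omega> (fst (S i)) e = ereal ((wgt N \<omega> (expo i e) + (\<Sum>l<M. real (snd e l) * \<theta> i l)) / R i)"
proof -
  have "fst (S i) l * ereal (real (snd e l)) = ereal (real (snd e l) * \<theta> i l / R i)" if "l < M" for l
    using assms[OF that] eta_eq[of l i] by (cases "snd e l = 0") (auto simp: mult_ac simp flip: zero_ereal_def)
  then have "(\<Sum>l<M. fst (S i) l * ereal (real (snd e l))) = ereal (\<Sum>l<M. real (snd e l) * \<theta> i l / R i)"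
    by (simp flip: sum_ereal)
  moreover have "wgt N \<omega> (expo i e) = R i * (\<Sum>l<N. \<omega> l * real_of_int (fst e l))"
    unfolding expo_def wgt_scale by (simp add: R_def wgt_def)
  ultimately show ?thesis using R_pos[of i] by (simp add: wt_def add_divide_distrib sum_divide_distrib)
qed

lemma wt_infinite:
  assumes "l < M" "snd e l \<noteq> 0" "l \<notin> L i"
  shows "wt N M \<omega> (fst (S i)) e = \<infinity>"
proof -
  have "fst (S i) j * ereal (real (snd e j)) \<noteq> - \<infinity>" if "j < M" for j
    using eta_eq[of j i] eta_infty[OF that, of i] by (cases "j \<in> L i") auto
  moreover have "fst (S i) l * ereal (real (snd e l)) = \<infinity>" using eta_infty[OF assms(1,3)] assms(2) by simp
  ultimately have "(\<Sum>l<M. fst (S i) l * ereal (real (snd e l))) = \<infinity>"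
    using assms(1) by (subst sum_Pinfty) auto
  then show ?thesis by (simp add: wt_def)
qed

definition trunc :: "nat \<Rightarrow> nat \<Rightarrow> (nat \<Rightarrow> rat) \<Rightarrow>\<^sub>0 'k" where
  "trunc i j = (\<Sum>l<i. sgl (\<gamma> l j) (c l j))"

text \<open>Each substitution adds one term to the argument of the preceding polynomial; composing
  them adds the partial sum. At \<open>s = 0\<close> this gives the value of f at the truncated
  series.\<close>

lemma stage_eval:
  assumes "lpoly N M f"
  shows "lpol_eval M (r i) (stage N M S f i) s = lpol_eval M 1 f (\<lambda>j. s j + trunc i j)"
proof (induction i arbitrary: s)
  case 0
  then show ?case by (simp add: r_0 trunc_def)
next
  case (Suc i)
  have "lpol_eval M (r (Suc i)) (stage N M S f (Suc i)) s =
     lpol_eval M (r i) (stage N M S f i) (\<lambda>j. s j + sgl (\<gamma> i j) (c i j))"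
    using lpol_eval_subst_D[OF lpoly_stage[OF assms] omega_set_S, of "r i" i S i s]
    by (simp add: r_Suc \<gamma>_def[abs_def] \<Gamma>_def c_def cong: if_cong)
  also have "\<dots> = lpol_eval M 1 f (\<lambda>j. s j + sgl (\<gamma> i j) (c i j) + trunc i j)" by (rule Suc)
  also have "(\<lambda>j. s j + sgl (\<gamma> i j) (c i j) + trunc i j) = (\<lambda>j. s j + trunc (Suc i) j)"
    by (rule ext) (simp add: trunc_def add_ac)
  finally show ?case .
qed

lemma expo_subst_exp:
  assumes "\<And>j. j < M \<Longrightarrow> snd e j - b j \<noteq> 0 \<Longrightarrow> j \<in> L i"
  shows "expo (Suc i) (subst_exp N M (S i) e b, b) = expo i e + (\<lambda>l. \<Sum>j<M. of_nat (snd e j - b j) * \<gamma> i j l)"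
proof
  fix l
  have "r (Suc i) * (of_nat (snd e j - b j) * of_int (shift_vec N M (S i) j l)) = of_nat (snd e j - b j) * \<gamma> i j l" if j: "j < M" for j
  proof (cases "snd e j - b j = 0")
    case False
    then have "r (Suc i) * of_int (shift_vec N M (S i) j l) = \<gamma> i j l"
      using assms[OF j] shift_vec_scaled[of j M "S i" "r i" N l] by (simp add: r_Suc \<gamma>_def \<Gamma>_def L_def)
    then show ?thesis by (metis mult.left_commute)
  qed simp
  then show "expo (Suc i) (subst_exp N M (S i) e b, b) l = (expo i e + (\<lambda>l. \<Sum>j<M. of_nat (snd e j - b j) * \<gamma> i j l)) l"
    using dG_S_pos[of i] unfolding expo_def subst_exp_def
    by (simp add: distrib_left sum_distrib_left r_Suc)
qed

lemma wgt_expo_subst_exp: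
  assumes "\<And>j. j < M \<Longrightarrow> snd e j - b j \<noteq> 0 \<Longrightarrow> j \<in> L i"
  shows "wgt N \<omega> (expo (Suc i) (subst_exp N M (S i) e b, b)) = wgt N \<omega> (expo i e) + (\<Sum>j<M. real (snd e j - b j) * \<theta> i j)"
proof -
  have eq: "expo (Suc i) (subst_exp N M (S i) e b, b) = expo i e + (\<lambda>l. \<Sum>j<M. of_nat (snd e j - b j) * \<gamma> i j l)"
    by (rule expo_subst_exp) (rule assms)
  show ?thesis unfolding eq wgt_add wgt_sum wgt_scale by (simp only: \<theta>_def of_rat_of_nat_eq)
qed

end

section \<open>Translation of a single coordinate into real weights\<close>

lemma sum_single_exponent:
  assumes "finite B" and b0: "b0 \<in> B \<longleftrightarrow> P" and "\<And>b. b \<in> B \<Longrightarrow> b \<noteq> b0 \<Longrightarrow> g b = (0::'a::comm_monoid_add)"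
  shows "(\<Sum>b\<in>B. g b) = (if P then g b0 else 0)"
proof (cases P)
  case True
  then have "sum g B = sum g {b0}" using assms by (intro sum.mono_neutral_right) auto
  then show ?thesis using True by simp
next
  case False
  then have "g b = 0" if "b \<in> B" for b using assms that by blast
  then show ?thesis using False by simp
qed

lemma nspan_vecs: "E \<subseteq> vecs N \<Longrightarrow> v \<in> nspan E \<Longrightarrow> v \<in> vecs N"
  by (rotate_tac, induction rule: nspan.induct) (auto intro: vecs_closed)

lemma nspan_wgt_preimage: "x \<in> nspan (wgt N \<omega> ` E) \<Longrightarrow> \<exists>v\<in>nspan E. wgt N \<omega> v = x"
proof (induction rule: nspan.induct)
  case nspan_zero
  show ?case using wgt_zero nspan.nspan_zero by blast
next
  case (nspan_step x e)
  then obtain v u where "v \<in> nspan E" "wgt N \<omega> v = x" "u \<in> E" "wgt N \<omega> u = e" by blast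
  then have "u + v \<in> nspan E" "wgt N \<omega> (u + v) = e + x"
    by (auto simp only: wgt_add intro: nspan.nspan_step)
  then show ?case by blast
qed

context omega_seq
begin

text \<open>Substitution only lowers the exponents of the y, so an element in x and y_j alone stays
  one, and a single degree bound holds for all stages.\<close>

lemma stage_row:
  assumes row: "\<forall>e\<in>supp P. \<forall>l. l \<noteq> j \<longrightarrow> snd e l = 0" and d: "\<forall>e\<in>supp P. snd e j \<le> d"
  shows "e \<in> supp (stage N M S P i) \<Longrightarrow> (\<forall>l. l \<noteq> j \<longrightarrow> snd e l = 0) \<and> snd e j \<le> d"
proof (induction i arbitrary: e)
  case 0
  then show ?case using assms by simp
next
  case (Suc i)
  then have "e \<in> supp (subst_D N M (S i) (stage N M S P i))" by simp
  then obtain e' where e': "e' \<in> supp (stage N M S P i)" "snd e \<le> snd e'" by (rule supp_subst_D)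
  then show ?case using Suc.IH[OF e'(1)] le_funD[OF e'(2)] by (metis le_trans le_zero_eq)
qed

text \<open>The elimination polynomial is followed through all stages and coded by weights, so that
  \<open>newton_puiseux_stable\<close> applies. Every weight it returns is realized by an exponent
  vector, and injectivity of the weight turns equations between weights into equations between
  vectors.\<close>

lemma row_structure:
  assumes j: "j < M" and Lj: "\<And>i. j \<in> L i"
  obtains i1 E where "finite E" "E \<subseteq> vecs N" "\<And>e. e \<in> E \<Longrightarrow> 0 \<le> wgt N \<omega> e"
    "\<And>i. i1 \<le> i \<Longrightarrow> \<gamma> i j - \<gamma> i1 j \<in> nspan E"
    "\<And>i l. i1 \<le> i \<Longrightarrow> l < N \<Longrightarrow> \<Gamma> i j l \<in> \<int>"
proof -
  obtain P where P: "P \<in> I" "supp P \<noteq> {}" and row: "\<forall>e\<in>supp P. \<forall>l. l \<noteq> j \<longrightarrow> snd e l = 0"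
    using elim_poly[OF j] by blast
  have lP: "lpoly N M P" using P(1) ideal by (simp add: is_ideal_def)
  define F where "F i = stage N M S P i" for i
  have lF: "lpoly N M (F i)" for i unfolding F_def by (rule lpoly_stage[OF lP])
  have finF: "finite (supp (F i))" for i using lF by (simp add: lpoly_def)
  define d where "d = Max ((\<lambda>e. snd e j) ` supp P)"
  have dP: "\<forall>e\<in>supp P. snd e j \<le> d" using lP unfolding d_def lpoly_def by simp
  have Frow: "snd e l = 0" if "e \<in> supp (F i)" "l \<noteq> j" for e i l
    using stage_row[OF row dP] that unfolding F_def by blast
  have Fd: "snd e j \<le> d" if "e \<in> supp (F i)" for e i
    using stage_row[OF row dP] that unfolding F_def by blast
  define X where "X i e = wgt N \<omega> (expo i e)" for i e
  \<comment> \<open>The sum has at most one term, because the weight and the y_j-degree determine a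
    monomial of this polynomial.\<close>
  define a where "a i x n = (\<Sum>e\<in>{e\<in>supp (F i). X i e = x \<and> snd e j = n}. F i e)" for i x n
  have a_single: "a i (X i e) (snd e j) = F i e" if e: "e \<in> supp (F i)" for i e
  proof -
    have "e' = e" if e': "e' \<in> supp (F i)" "X i e' = X i e" "snd e' j = snd e j" for e'
    proof -
      have "expo i e' = expo i e"
        by (rule wgt_inj[OF expo_vecs[OF lF e'(1)] expo_vecs[OF lF e] e'(2)[unfolded X_def]])
      then have "fst e' = fst e" by (rule expo_inj)
      moreover have "snd e' l = snd e l" for l
        using Frow[OF e] Frow[OF e'(1)] e'(3) by (cases "l = j") auto
      ultimately show ?thesis by (auto simp: prod_eq_iff)
    qed
    then have "{e'\<in>supp (F i). X i e' = X i e \<and> snd e' j = snd e j} = {e}" using e by auto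
    then show ?thesis by (simp add: a_def)
  qed
  have a_nz: "\<exists>e\<in>supp (F i). X i e = x \<and> snd e j = n" if "a i x n \<noteq> 0" for i x n
    using that unfolding a_def by (force elim: sum.not_neutral_contains_not_neutral)
  have a_lin: "(\<Sum>k\<le>d. h k * a i (w k) k) = (\<Sum>e\<in>supp (F i). if X i e = w (snd e j) then h (snd e j) * F i e else 0)" for h w i
  proof -
    have "(\<Sum>k\<le>d. h k * a i (w k) k) = (\<Sum>k\<le>d. \<Sum>e\<in>supp (F i). if k = snd e j then (if X i e = w k then h k * F i e else 0) else 0)"
      unfolding a_def sum.inter_filter[OF finF] sum_distrib_left by (intro sum.cong) auto
    also have "\<dots> = (\<Sum>e\<in>supp (F i). \<Sum>k\<le>d. if k = snd e j then (if X i e = w k then h k * F i e else 0) else 0)"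
      by (rule sum.swap)
    also have "\<dots> = (\<Sum>e\<in>supp (F i). if X i e = w (snd e j) then h (snd e j) * F i e else 0)"
      using Fd by (intro sum.cong) auto
    finally show ?thesis .
  qed
  have fin: "finite {(x, n). a i x n \<noteq> 0}" for i
  proof (rule finite_subset)
    show "{(x, n). a i x n \<noteq> 0} \<subseteq> (\<lambda>e. (X i e, snd e j)) ` supp (F i)" using a_nz[of i] by force
  qed (use finF in simp)
  have ne: "\<exists>x n. a 0 x n \<noteq> 0"
  proof -
    obtain e where e: "e \<in> supp (F 0)" using P(2) by (auto simp: F_def)
    then have "a 0 (X 0 e) (snd e j) \<noteq> 0" using a_single[OF e] by (simp add: supp_def)
    then show ?thesis by blast
  qed
  have deg: "a i x n = 0" if "d < n" for i x n
    using a_nz[of i x n] Fd[of _ i] that by (metis not_less)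
  have rec: "a (Suc i) x n = (\<Sum>k\<le>d. of_nat (k choose n) * c i j ^ (k - n) * a i (x - (real k - real n) * \<theta> i j) k)" for i x n
  proof -
    let ?ind = "\<lambda>e'. if X (Suc i) e' = x \<and> snd e' j = n then 1 else (0::'k)"
    \<comment> \<open>Only y_j occurs, so this is the one y-exponent that can contribute to degree
      \<open>n\<close>.\<close>
    define b0 where "b0 l = (if l = j then n else 0)" for l
    have "a (Suc i) x n = (\<Sum>e'\<in>supp (F (Suc i)). F (Suc i) e' * ?ind e')"
      unfolding a_def sum.inter_filter[OF finF] by (intro sum.cong) auto
    also have "\<dots> = (\<Sum>e\<in>supp (F i). \<Sum>b | b \<le> snd e. (F i e * subst_coeff M (S i) e b) * ?ind (subst_exp N M (S i) e b, b))"
      using sum_subst_D(1)[of "\<lambda>c. c", OF _ _ lF] by (simp add: F_def)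
    also have "\<dots> = (\<Sum>e\<in>supp (F i). if X i e = x - (real (snd e j) - real n) * \<theta> i j
        then of_nat (snd e j choose n) * c i j ^ (snd e j - n) * F i e else 0)"
    proof (rule sum.cong[OF refl])
      fix e assume e: "e \<in> supp (F i)"
      have fin: "finite {b. b \<le> snd e}" using lF e by (intro finite_below_nat_fun[of M]) (auto simp: lpoly_def)
      have inB: "b0 \<in> {b. b \<le> snd e} \<longleftrightarrow> n \<le> snd e j" by (auto simp: b0_def le_fun_def)
      have "b = b0" if "b \<le> snd e" "b j = n" for b
      proof
        fix l
        show "b l = b0 l" using Frow[OF e, of l] le_funD[OF that(1), of l] that(2) by (cases "l = j") (auto simp: b0_def)
      qed
      then have "(\<Sum>b | b \<le> snd e. (F i e * subst_coeff M (S i) e b) * ?ind (subst_exp N M (S i) e b, b)) =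
         (if n \<le> snd e j then (F i e * subst_coeff M (S i) e b0) * ?ind (subst_exp N M (S i) e b0, b0) else 0)"
        by (intro sum_single_exponent[OF fin inB]) auto
      moreover have "subst_coeff M (S i) e b0 = of_nat (snd e j choose n) * c i j ^ (snd e j - n)"
      proof -
        have "subst_coeff M (S i) e b0 = (\<Prod>l<M. if l = j then of_nat (snd e j choose n) * c i j ^ (snd e j - n) else 1)"
          unfolding subst_coeff_def c_def by (intro prod.cong) (auto simp: b0_def Frow[OF e])
        then show ?thesis using j by simp
      qed
      moreover have "X (Suc i) (subst_exp N M (S i) e b0, b0) = X i e + real (snd e j - n) * \<theta> i j"
      proof -
        have "X (Suc i) (subst_exp N M (S i) e b0, b0) = X i e + (\<Sum>l<M. real (snd e l - b0 l) * \<theta> i l)"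
          unfolding X_def by (rule wgt_expo_subst_exp) (use Frow[OF e] Lj in \<open>metis diff_0_eq_0\<close>)
        also have "(\<Sum>l<M. real (snd e l - b0 l) * \<theta> i l) = (\<Sum>l<M. if l = j then real (snd e j - n) * \<theta> i j else 0)"
          by (intro sum.cong) (auto simp: b0_def Frow[OF e])
        finally show ?thesis using j by simp
      qed
      moreover have "b0 j = n" by (simp add: b0_def)
      ultimately show "(\<Sum>b | b \<le> snd e. (F i e * subst_coeff M (S i) e b) * ?ind (subst_exp N M (S i) e b, b)) =
        (if X i e = x - (real (snd e j) - real n) * \<theta> i j
        then of_nat (snd e j choose n) * c i j ^ (snd e j - n) * F i e else 0)"
        by (cases "n \<le> snd e j") (auto simp: of_nat_diff mult_ac binomial_eq_0)
    qed
    also have "\<dots> = (\<Sum>k\<le>d. of_nat (k choose n) * c i j ^ (k - n) * a i (x - (real k - real n) * \<theta> i j) k)"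
      using a_lin[of "\<lambda>k. of_nat (k choose n) * c i j ^ (k - n)" i "\<lambda>k. x - (real k - real n) * \<theta> i j"] by simp
    finally show ?thesis .
  qed
  \<comment> \<open>If no monomial attains \<open>w\<close>, the sum is empty. Otherwise
    \<open>w\<close> is the least order, and the sum is the initial form evaluated at x = 1 and
    \<open>c i\<close>, which vanishes because \<open>c i\<close> is a zero of the initial
    ideal.\<close>
  have init: "(\<Sum>k\<le>d. a i (w - real k * \<theta> i j) k * c i j ^ k) = 0"
    if w: "\<And>x k. a i x k \<noteq> 0 \<Longrightarrow> w \<le> x + real k * \<theta> i j" for i w
  proof -
    let ?Y = "\<lambda>e. X i e + real (snd e j) * \<theta> i j"
    have sum_eq: "(\<Sum>k\<le>d. a i (w - real k * \<theta> i j) k * c i j ^ k) = (\<Sum>e\<in>supp (F i). if ?Y e = w then c i j ^ snd e j * F i e else 0)"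
      using a_lin[of "\<lambda>k. c i j ^ k" i "\<lambda>k. w - real k * \<theta> i j"]
      by (simp add: mult.commute eq_diff_eq)
    have lb: "w \<le> ?Y e" if e: "e \<in> supp (F i)" for e
      using w[of "X i e" "snd e j"] a_single[OF e] e by (simp add: supp_def)
    have wte: "wt N M \<omega> (fst (S i)) e = ereal (?Y e / R i)" if e: "e \<in> supp (F i)" for e
    proof -
      have "(\<Sum>l<M. real (snd e l) * \<theta> i l) = (\<Sum>l<M. if l = j then real (snd e j) * \<theta> i j else 0)"
        by (intro sum.cong) (auto simp: Frow[OF e])
      then have "(\<Sum>l<M. real (snd e l) * \<theta> i l) = real (snd e j) * \<theta> i j" using j by simp
      moreover have "wt N M \<omega> (fst (S i)) e = ereal ((wgt N \<omega> (expo i e) + (\<Sum>l<M. real (snd e l) * \<theta> i l)) / R i)"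
        by (rule wt_finite) (use Frow[OF e] Lj in metis)
      ultimately show ?thesis by (simp add: X_def)
    qed
    show ?thesis
    proof (cases "\<exists>e\<in>supp (F i). ?Y e = w")
      case False
      then show ?thesis unfolding sum_eq by (intro sum.neutral) auto
    next
      case True
      then obtain e0 where e0: "e0 \<in> supp (F i)" "?Y e0 = w" by blast
      have ord: "ord_w N M \<omega> (fst (S i)) (F i) = ereal (w / R i)"
        unfolding ord_w_def
      proof (rule antisym)
        show "(INF e\<in>supp (F i). wt N M \<omega> (fst (S i)) e) \<le> ereal (w / R i)"
          using wte[OF e0(1)] e0 by (metis INF_lower)
        show "ereal (w / R i) \<le> (INF e\<in>supp (F i). wt N M \<omega> (fst (S i)) e)"
          using lb wte R_pos[of i] by (intro INF_greatest) (auto simp: divide_right_mono less_imp_le)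
      qed
      let ?g = "in_w N M \<omega> (fst (S i)) (F i)"
      have g: "?g e = (if e \<in> supp (F i) \<and> ?Y e = w then F i e else 0)" for e
      proof (cases "e \<in> supp (F i)")
        case True
        then show ?thesis using wte[OF True] R_pos[of i] unfolding in_w_def ord by simp
      qed (simp add: in_w_def supp_def)
      have "0 = eval_one M ?g (c i)"
        using eval_one_S[OF in_w_stage[OF P(1), of i]] by (simp add: F_def)
      also have "\<dots> = (\<Sum>e\<in>supp (F i). ?g e * (\<Prod>l<M. c i l ^ snd e l))"
        unfolding eval_one_def by (rule sum.mono_neutral_left[OF finF]) (auto simp: supp_def g)
      also have "\<dots> = (\<Sum>e\<in>supp (F i). if ?Y e = w then c i j ^ snd e j * F i e else 0)"
      proof (rule sum.cong[OF refl])
        fix e assume e: "e \<in> supp (F i)"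
        have "(\<Prod>l<M. c i l ^ snd e l) = (\<Prod>l<M. if l = j then c i j ^ snd e j else 1)"
          by (intro prod.cong) (auto simp: Frow[OF e])
        then have "(\<Prod>l<M. c i l ^ snd e l) = c i j ^ snd e j" using j by simp
        then show "?g e * (\<Prod>l<M. c i l ^ snd e l) = (if ?Y e = w then c i j ^ snd e j * F i e else 0)"
          using e by (simp add: g)
      qed
      finally show ?thesis unfolding sum_eq by simp
    qed
  qed
  obtain i1 E where E: "finite E" "\<And>e. e \<in> E \<Longrightarrow> 0 \<le> e"
    "\<And>e. e \<in> E \<Longrightarrow> \<exists>x n y k. e = x + real n * \<theta> i1 j - (y + real k * \<theta> i1 j) \<and> a i1 x n \<noteq> 0 \<and> a i1 y k \<noteq> 0"
    "\<And>i. i1 \<le> i \<Longrightarrow> \<theta> i j - \<theta> i1 j \<in> nspan E"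
    "\<And>i. i1 \<le> i \<Longrightarrow> \<exists>x y n k. \<theta> i j = x - y \<and> a i x n \<noteq> 0 \<and> a i y k \<noteq> 0"
    by (rule newton_puiseux_stable[of a d "\<lambda>i. c i j" "\<lambda>i. \<theta> i j", OF fin ne deg rec c_nonzero[OF Lj] \<theta>_less[OF Lj] init])
      (assumption | rule that)+
  have "\<exists>v\<in>vecs N. wgt N \<omega> v = e" if eE: "e \<in> E" for e
  proof -
    obtain x n y k where e: "e = x + real n * \<theta> i1 j - (y + real k * \<theta> i1 j)" "a i1 x n \<noteq> 0" "a i1 y k \<noteq> 0"
      using E(3)[OF eE] by blast
    obtain ex ey where xy: "ex \<in> supp (F i1)" "X i1 ex = x" "ey \<in> supp (F i1)" "X i1 ey = y"
      using a_nz[OF e(2)] a_nz[OF e(3)] by blast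
    let ?v = "expo i1 ex + (\<lambda>l. of_nat n * \<gamma> i1 j l) - (expo i1 ey + (\<lambda>l. of_nat k * \<gamma> i1 j l))"
    have "?v \<in> vecs N" by (intro vecs_closed expo_vecs[OF lF xy(1)] expo_vecs[OF lF xy(3)] \<gamma>_vecs)
    moreover have "wgt N \<omega> ?v = e"
      unfolding wgt_diff wgt_add wgt_scale e(1) using xy by (simp add: X_def \<theta>_def)
    ultimately show ?thesis by blast
  qed
  then obtain vec where vec: "\<And>e. e \<in> E \<Longrightarrow> vec e \<in> vecs N \<and> wgt N \<omega> (vec e) = e" by metis
  define E' where "E' = vec ` E"
  have E': "E' \<subseteq> vecs N" "wgt N \<omega> ` E' = E" using vec by (auto simp: E'_def image_image)
  show thesis
  proof (rule that[of E' i1])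
    show "finite E'" using E(1) by (simp add: E'_def)
    show "E' \<subseteq> vecs N" by (rule E')
    show "0 \<le> wgt N \<omega> e" if "e \<in> E'" for e using E(2) E'(2) that by blast
    show "\<gamma> i j - \<gamma> i1 j \<in> nspan E'" if i: "i1 \<le> i" for i
    proof -
      obtain v where v: "v \<in> nspan E'" "wgt N \<omega> v = \<theta> i j - \<theta> i1 j"
        using nspan_wgt_preimage[of "\<theta> i j - \<theta> i1 j" N \<omega> E'] E(4)[OF i] E'(2) by auto
      have "v = \<gamma> i j - \<gamma> i1 j"
        by (rule wgt_inj[OF nspan_vecs[OF E'(1) v(1)]]) (auto intro!: vecs_closed \<gamma>_vecs simp: v(2) wgt_diff \<theta>_def)
      then show ?thesis using v by simp
    qed
    show "\<Gamma> i j l \<in> \<int>" if i: "i1 \<le> i" and l: "l < N" for i l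
    proof -
      obtain x y n k where xy: "\<theta> i j = x - y" "a i x n \<noteq> 0" "a i y k \<noteq> 0" using E(5)[OF i] by blast
      obtain ex ey where e: "ex \<in> supp (F i)" "X i ex = x" "ey \<in> supp (F i)" "X i ey = y"
        using a_nz[OF xy(2)] a_nz[OF xy(3)] by blast
      \<comment> \<open>Both exponents are integral multiples of \<open>r i\<close>, so cancelling
        \<open>r i\<close> leaves an integral \<open>\<Gamma> i j\<close>.\<close>
      have "\<gamma> i j = expo i ex - expo i ey"
        by (rule wgt_inj) (use xy(1) e in \<open>auto intro!: vecs_closed \<gamma>_vecs expo_vecs[OF lF] simp: wgt_diff X_def \<theta>_def\<close>)
      then have "r i * \<Gamma> i j l = r i * (of_int (fst ex l) - of_int (fst ey l))"
        using l by (simp add: \<gamma>_def fun_eq_iff expo_def right_diff_distrib) metis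
      then have "\<Gamma> i j l = of_int (fst ex l - fst ey l)" using r_pos[of i] by simp
      then show ?thesis by simp
    qed
  qed
qed

end

section \<open>Growth of the exponents and bounded denominators\<close>

lemma wgt_nspan: "v \<in> nspan E \<Longrightarrow> wgt N \<omega> v \<in> nspan (wgt N \<omega> ` E)"
proof (induction rule: nspan.induct)
  case nspan_zero
  then show ?case by (simp only: wgt_zero nspan.nspan_zero)
next
  case (nspan_step x e)
  then show ?case by (simp only: wgt_add) (intro nspan.nspan_step imageI)
qed

lemma nspan_mono: "E \<subseteq> F \<Longrightarrow> v \<in> nspan E \<Longrightarrow> v \<in> nspan F"
  by (rotate_tac, induction rule: nspan.induct) (auto intro: nspan_zero nspan_step)

lemma nspan_rcone:
  assumes "finite G"
  shows "v \<in> nspan G \<Longrightarrow> v \<in> rcone N G"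
proof (induction rule: nspan.induct)
  case nspan_zero
  show ?case unfolding rcone_def by (auto simp: fun_eq_iff intro!: exI[of _ "\<lambda>_. 0"])
next
  case (nspan_step x e)
  then obtain t where t: "\<forall>g\<in>G. 0 \<le> t g" "x = (\<lambda>i. \<Sum>g\<in>G. t g * g i)" by (auto simp: rcone_def)
  let ?t = "t(e := t e + 1)"
  have "e + x = (\<lambda>i. \<Sum>g\<in>G. ?t g * g i)"
  proof
    fix i
    have "(\<Sum>g\<in>G. ?t g * g i) = (\<Sum>g\<in>G. t g * g i + (if g = e then e i else 0))"
      by (intro sum.cong) (auto simp: algebra_simps)
    then show "(e + x) i = (\<Sum>g\<in>G. ?t g * g i)"
      using assms nspan_step(2) by (simp add: sum.distrib t(2))
  qed
  moreover have "\<forall>g\<in>G. 0 \<le> ?t g" using t(1) nspan_step(2) by auto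
  ultimately show ?case unfolding rcone_def by blast
qed

lemma rcone_wgt_nonneg:
  assumes "\<And>g. g \<in> G \<Longrightarrow> 0 \<le> wgt N \<omega> g" "v \<in> rcone N G"
  shows "0 \<le> wgt N \<omega> v"
proof -
  obtain t where t: "\<forall>g\<in>G. 0 \<le> t g" "v = (\<lambda>i. \<Sum>g\<in>G. t g * g i)" using assms(2) by (auto simp: rcone_def)
  have "wgt N \<omega> v = (\<Sum>g\<in>G. real_of_rat (t g) * wgt N \<omega> g)" unfolding t(2) wgt_sum wgt_scale ..
  also have "\<dots> \<ge> 0" using t(1) assms(1) by (intro sum_nonneg mult_nonneg_nonneg) auto
  finally show ?thesis .
qed

context omega_seq
begin

text \<open>The increments of \<theta> are distinct elements of a semigroup with finitely many
  nonnegative generators, which has only finitely many elements below any bound. If the coordinate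
  leaves \<open>L\<close>, the claim is vacuous from then on.\<close>

lemma \<theta>_unbounded:
  assumes j: "j < M"
  shows "\<exists>i0. \<forall>i\<ge>i0. j \<in> L i \<longrightarrow> B < \<theta> i j"
proof (cases "\<forall>i. j \<in> L i")
  case False
  then obtain i0 where "j \<notin> L i0" by blast
  then show ?thesis using L_antimono[of i0] by blast
next
  case True
  obtain i1 E where E: "finite E" "E \<subseteq> vecs N" "\<And>e. e \<in> E \<Longrightarrow> 0 \<le> wgt N \<omega> e"
    "\<And>i. i1 \<le> i \<Longrightarrow> \<gamma> i j - \<gamma> i1 j \<in> nspan E"
    by (rule row_structure[OF j]) (use True in auto)
  have "\<exists>i2\<ge>i1. B < \<theta> i2 j"
  proof (rule ccontr)
    assume "\<not> (\<exists>i2\<ge>i1. B < \<theta> i2 j)"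
    then have le: "\<theta> i j \<le> B" if "i1 \<le> i" for i using that by force
    let ?F = "{x \<in> nspan (wgt N \<omega> ` E). x \<le> B - \<theta> i1 j}"
    have "finite ?F" using E by (intro nspan_finite_below) auto
    moreover have "(\<lambda>i. \<theta> i j - \<theta> i1 j) ` {i1..} \<subseteq> ?F"
    proof
      fix x assume "x \<in> (\<lambda>i. \<theta> i j - \<theta> i1 j) ` {i1..}"
      then obtain i where i: "i1 \<le> i" "x = \<theta> i j - \<theta> i1 j" by auto
      show "x \<in> ?F" using wgt_nspan[OF E(4)[OF i(1)], of N \<omega>] le[OF i(1)] i(2) by (simp add: wgt_diff \<theta>_def)
    qed
    moreover have "inj_on (\<lambda>i. \<theta> i j - \<theta> i1 j) {i1..}"
    proof (rule inj_onI)
      fix i i' assume "\<theta> i j - \<theta> i1 j = \<theta> i' j - \<theta> i1 j"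
      then show "i = i'" using \<theta>_strict[of i i' j] \<theta>_strict[of i' i j] True by (cases i i' rule: linorder_cases) auto
    qed
    ultimately have "finite {i1..}" using finite_subset inj_on_finite by blast
    then show False using infinite_Ici by blast
  qed
  then obtain i2 where i2: "B < \<theta> i2 j" by blast
  have "B < \<theta> i j" if "i2 \<le> i" for i
    using \<theta>_strict[of i2 i j] True i2 that by (cases "i = i2") auto
  then show ?thesis by blast
qed

lemma eventually_all_rows:
  fixes Q :: "nat \<Rightarrow> nat \<Rightarrow> bool"
  assumes "\<And>j. j < M \<Longrightarrow> \<exists>i0. \<forall>i\<ge>i0. Q i j"
  shows "\<exists>i0. \<forall>i\<ge>i0. \<forall>j<M. Q i j"
proof -
  obtain m where m: "\<And>j i. j < M \<Longrightarrow> m j \<le> i \<Longrightarrow> Q i j" using assms by metis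
  have "Q i j" if "(\<Sum>j<M. m j) \<le> i" "j < M" for i j
    using m[OF that(2)] member_le_sum[of j "{..<M}" m] that by auto
  then show ?thesis by blast
qed

lemma dG_eventually_1: "\<exists>i0. \<forall>i\<ge>i0. dG N M (S i) = 1"
proof -
  have "\<exists>i0. \<forall>i\<ge>i0. j \<in> L i \<longrightarrow> (\<forall>l<N. \<Gamma> i j l \<in> \<int>)" if j: "j < M" for j
  proof (cases "\<forall>i. j \<in> L i")
    case False
    then obtain i0 where "j \<notin> L i0" by blast
    then show ?thesis using L_antimono[of i0] by blast
  next
    case True
    then show ?thesis using row_structure[OF j, of "\<exists>i0. \<forall>i\<ge>i0. \<forall>l<N. \<Gamma> i j l \<in> \<int>"] by blast
  qed
  from eventually_all_rows[of "\<lambda>i j. j \<in> L i \<longrightarrow> (\<forall>l<N. \<Gamma> i j l \<in> \<int>)", OF this]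
  obtain i0 where i0: "\<forall>i\<ge>i0. \<forall>j<M. j \<in> L i \<longrightarrow> (\<forall>l<N. \<Gamma> i j l \<in> \<int>)" by blast
  have "dG N M (S i) = 1" if "i0 \<le> i" for i
    using dG_eq_1[of M "fst (S i)" N "\<Gamma> i" "c i"] i0 that L_less[of _ i]
    by (simp add: L_def \<Gamma>_def c_def)
  then show ?thesis by blast
qed

text \<open>With \<open>r i = 1 / K i\<close> and \<open>dG\<close> times \<Gamma> integral,
  \<open>K (Suc i)\<close> clears the denominators of \<open>\<gamma> i\<close>. The products
  \<open>K\<close> become constant once \<open>dG\<close> is 1, and every earlier one divides this
  final value.\<close>

lemma common_denominator_exponents:
  "\<exists>k::nat. 0 < k \<and> (\<forall>i. \<forall>j\<in>L i. \<forall>l<N. of_nat k * \<gamma> i j l \<in> \<int>)"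
proof -
  obtain i0 where i0: "\<And>i. i0 \<le> i \<Longrightarrow> dG N M (S i) = 1" using dG_eventually_1 by blast
  define K where "K n = (\<Prod>l<n. dG N M (S l))" for n
  have KS: "K (Suc i) = K i * dG N M (S i)" for i by (simp add: K_def)
  have rK: "r i = 1 / of_nat (K i)" for i by (simp add: r_def r_seq_def K_def)
  have Kpos: "0 < K i" for i unfolding K_def using dG_S_pos by (simp add: prod_pos)
  have "K n dvd K i0" for n
  proof (cases "n \<le> i0")
    case True
    then show ?thesis unfolding K_def by (intro prod_dvd_prod_subset) auto
  next
    case False
    then have "i0 \<le> n" by simp
    then have "K n = K i0"
    proof (induction rule: dec_induct)
      case (step n)
      then show ?case using i0[of n] by (simp add: K_def)
    qed simp
    then show ?thesis by simp
  qed
  have "of_nat (K i0) * \<gamma> i j l \<in> \<int>" if jl: "j \<in> L i" "l < N" for i j l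
  proof -
    obtain m where m: "K i0 = K (Suc i) * m" using \<open>K (Suc i) dvd K i0\<close> by (elim dvdE)
    have "of_nat (K i0) * \<gamma> i j l = of_nat m * (of_nat (dG N M (S i)) * \<Gamma> i j l)"
      using jl(2) Kpos[of i] by (simp add: m KS \<gamma>_def rK)
    moreover have "of_nat (dG N M (S i)) * \<Gamma> i j l \<in> \<int>"
      using dG_integral[of j M "fst (S i)" l N "\<Gamma> i" "c i"] jl by (simp add: \<Gamma>_def c_def L_def)
    ultimately show ?thesis by simp
  qed
  then show ?thesis using Kpos by blast
qed

text \<open>The first exponent can serve as apex because later ones have larger weight. The finitely
  many exponents before the stable range are simply added as generators.\<close>

lemma exponents_in_cone:
  assumes j: "j < M"
  shows "\<exists>G. finite G \<and> G \<subseteq> vecs N \<and> (\<forall>g\<in>G. 0 \<le> wgt N \<omega> g) \<and> (\<forall>i. j \<in> L i \<longrightarrow> \<gamma> i j - \<gamma> 0 j \<in> nspan G)"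
proof -
  have nonneg: "0 \<le> wgt N \<omega> (\<gamma> i j - \<gamma> 0 j)" if "j \<in> L i" for i
  proof -
    have "\<theta> 0 j \<le> \<theta> i j" using \<theta>_strict[of 0 i j] that by (cases "i = 0") auto
    then show ?thesis by (simp add: wgt_diff \<theta>_def)
  qed
  show ?thesis
  proof (cases "\<forall>i. j \<in> L i")
    case False
    then obtain i0 where i0: "j \<notin> L i0" by blast
    let ?G = "(\<lambda>i. \<gamma> i j - \<gamma> 0 j) ` {i. i < i0 \<and> j \<in> L i}"
    have "i < i0" if "j \<in> L i" for i using L_antimono[of i0 i] i0 that by (meson in_mono not_less)
    then have "\<gamma> i j - \<gamma> 0 j \<in> nspan ?G" if "j \<in> L i" for i using that by (intro nspan_base) auto
    then show ?thesis using nonneg by (intro exI[of _ ?G]) (auto intro!: vecs_closed \<gamma>_vecs)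
  next
    case True
    obtain i1 E where E: "finite E" "E \<subseteq> vecs N" "\<And>e. e \<in> E \<Longrightarrow> 0 \<le> wgt N \<omega> e"
      "\<And>i. i1 \<le> i \<Longrightarrow> \<gamma> i j - \<gamma> i1 j \<in> nspan E"
      by (rule row_structure[OF j]) (use True in auto)
    let ?G = "E \<union> (\<lambda>i. \<gamma> i j - \<gamma> 0 j) ` {..i1}"
    have base: "\<gamma> i j - \<gamma> 0 j \<in> nspan ?G" if "i \<le> i1" for i using that by (intro nspan_base) auto
    have "\<gamma> i j - \<gamma> 0 j \<in> nspan ?G" for i
    proof (cases "i \<le> i1")
      case False
      then have "(\<gamma> i j - \<gamma> i1 j) + (\<gamma> i1 j - \<gamma> 0 j) \<in> nspan ?G"
        by (intro nspan_add base nspan_mono[OF _ E(4)]) auto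
      then show ?thesis by (simp only: diff_add_cancel add_diff_eq)
    qed (rule base)
    then show ?thesis using nonneg E(1-3) True by (intro exI[of _ ?G]) (auto intro!: vecs_closed \<gamma>_vecs)
  qed
qed

section \<open>Support, positivity and convergence of the series\<close>

lemma ser_altdef: "ser N M S j v = (\<Sum>i\<in>{i. j \<in> L i \<and> v = \<gamma> i j}. c i j)"
  unfolding ser_def L_def \<gamma>_def[abs_def] r_def c_def \<Gamma>_def ..

lemma supp_ser: "supp (ser N M S j) \<subseteq> {\<gamma> i j | i. j \<in> L i}"
proof
  fix v assume "v \<in> supp (ser N M S j)"
  then have "(\<Sum>i\<in>{i. j \<in> L i \<and> v = \<gamma> i j}. c i j) \<noteq> 0" by (simp add: supp_def ser_altdef)
  then have "{i. j \<in> L i \<and> v = \<gamma> i j} \<noteq> {}" by force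
  then show "v \<in> {\<gamma> i j | i. j \<in> L i}" by blast
qed

lemma omega_positive_ser:
  assumes j: "j < M"
  shows "omega_positive N \<omega> (ser N M S j)"
proof -
  obtain k :: nat where k: "0 < k" "\<And>i j l. j \<in> L i \<Longrightarrow> l < N \<Longrightarrow> of_nat k * \<gamma> i j l \<in> \<int>"
    using common_denominator_exponents by blast
  obtain G where G: "finite G" "G \<subseteq> vecs N" "\<forall>g\<in>G. 0 \<le> wgt N \<omega> g" "\<And>i. j \<in> L i \<Longrightarrow> \<gamma> i j - \<gamma> 0 j \<in> nspan G"
    using exponents_in_cone[OF j] by blast
  have el: "\<exists>i. j \<in> L i \<and> a = \<gamma> i j" if "a \<in> supp (ser N M S j)" for a
    using supp_ser that by blast
  show ?thesis unfolding omega_positive_def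
  proof (intro conjI)
    show "\<forall>a\<in>supp (ser N M S j). \<forall>i\<ge>N. a i = 0"
      using el \<gamma>_vecs unfolding vecs_def by blast
    show "\<exists>k::nat. 0 < k \<and> (\<forall>a\<in>supp (ser N M S j). \<forall>i<N. of_nat k * a i \<in> \<int>)"
      using k el by blast
    show "\<exists>\<gamma> G. (\<forall>i\<ge>N. \<gamma> i = 0) \<and> finite G \<and> (\<forall>g\<in>G. \<forall>i\<ge>N. g i = 0) \<and>
        (\<forall>v\<in>rcone N G. (\<Sum>i<N. \<omega> i * real_of_rat (v i)) \<ge> 0) \<and>
        (\<forall>a\<in>supp (ser N M S j). (\<lambda>i. a i + \<gamma> i) \<in> rcone N G)"
    proof (intro exI[of _ "\<lambda>i. - \<gamma> 0 j i"] exI[of _ G] conjI ballI)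
      show "\<forall>i\<ge>N. - \<gamma> 0 j i = 0" by (simp add: \<gamma>_def)
      show "finite G" by fact
      show "\<forall>i\<ge>N. g i = 0" if "g \<in> G" for g using G(2) that by (auto simp: vecs_def)
      show "(\<Sum>i<N. \<omega> i * real_of_rat (v i)) \<ge> 0" if "v \<in> rcone N G" for v
        using rcone_wgt_nonneg[of G N \<omega> v] G(3) that by (simp add: wgt_def)
      show "(\<lambda>i. a i + - \<gamma> 0 j i) \<in> rcone N G" if as: "a \<in> supp (ser N M S j)" for a
      proof -
        obtain i where i: "j \<in> L i" "a = \<gamma> i j" using el[OF as] by blast
        have "(\<lambda>i. a i + - \<gamma> 0 j i) = \<gamma> i j - \<gamma> 0 j" by (simp add: i(2) fun_eq_iff)
        then show ?thesis using nspan_rcone[OF G(1) G(4)[OF i(1)]] by (simp only:)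
      qed
    qed
  qed
qed

lemma lookup_trunc: "j < M \<Longrightarrow> lkp (trunc i j) v = (\<Sum>l\<in>{l. l < i \<and> j \<in> L l \<and> v = \<gamma> l j}. c l j)"
proof -
  assume j: "j < M"
  have "lkp (trunc i j) v = (\<Sum>l<i. if \<gamma> l j = v then c l j else 0)"
    by (simp add: trunc_def lookup_sum lookup_single when_def)
  also have "\<dots> = (\<Sum>l\<in>{l. l < i \<and> j \<in> L l \<and> v = \<gamma> l j}. if \<gamma> l j = v then c l j else 0)"
    using c_zero[OF j] by (intro sum.mono_neutral_right) auto
  also have "\<dots> = (\<Sum>l\<in>{l. l < i \<and> j \<in> L l \<and> v = \<gamma> l j}. c l j)" by (intro sum.cong) auto
  finally show ?thesis .
qed

text \<open>All exponents \<gamma> together form a left-finite set since \<theta> is unbounded. For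
  the same reason, terms missing from a long truncation exceed any prescribed weight.\<close>

lemma ser_conv_trunc:
  assumes j: "j < M"
  shows "ser_conv N \<omega> (\<lambda>i. lkp (trunc i j)) (ser N M S j)"
proof (rule ser_convI)
  let ?A = "{\<gamma> i j | i. j \<in> L i}"
  show "left_finite N \<omega> ?A" unfolding left_finite_def
  proof (intro conjI allI)
    show "?A \<subseteq> vecs N" using \<gamma>_vecs by auto
    fix B
    obtain i0 where "\<forall>i\<ge>i0. j \<in> L i \<longrightarrow> B < \<theta> i j" using \<theta>_unbounded[OF j] by blast
    then have "i < i0" if "j \<in> L i" "wgt N \<omega> (\<gamma> i j) \<le> B" for i using that unfolding \<theta>_def by (meson not_less)
    then have "{v \<in> ?A. wgt N \<omega> v \<le> B} \<subseteq> (\<lambda>i. \<gamma> i j) ` {..<i0}" by auto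
    then show "finite {v \<in> ?A. wgt N \<omega> v \<le> B}" by (meson finite_imageI finite_lessThan finite_subset)
  qed
  show "supp (lkp (trunc i j)) \<subseteq> ?A" for i
  proof
    fix v assume "v \<in> supp (lkp (trunc i j))"
    then have "(\<Sum>l\<in>{l. l < i \<and> j \<in> L l \<and> v = \<gamma> l j}. c l j) \<noteq> 0" by (simp add: supp_def lookup_trunc[OF j])
    then have "{l. l < i \<and> j \<in> L l \<and> v = \<gamma> l j} \<noteq> {}" by force
    then show "v \<in> ?A" by blast
  qed
  show "supp (ser N M S j) \<subseteq> ?A" by (rule supp_ser)
  show "\<exists>i0. \<forall>i\<ge>i0. \<forall>v. wgt N \<omega> v \<le> B \<longrightarrow> lkp (trunc i j) v = ser N M S j v" for B
  proof -
    obtain i0 where "\<forall>i\<ge>i0. j \<in> L i \<longrightarrow> B < \<theta> i j" using \<theta>_unbounded[OF j] by blast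
    then have i0: "l < i0" if "j \<in> L l" "wgt N \<omega> (\<gamma> l j) \<le> B" for l using that unfolding \<theta>_def by (meson not_less)
    have "lkp (trunc i j) v = ser N M S j v" if "i0 \<le> i" "wgt N \<omega> v \<le> B" for i v
      unfolding lookup_trunc[OF j] ser_altdef using i0 that by (intro sum.cong) fastforce+
    then show ?thesis by blast
  qed
qed

section \<open>Vanishing at the series\<close>

definition "\<mu> j = (if j \<in> L 0 then \<theta> 0 j else 0)"

lemma \<mu>_le: "j \<in> L i \<Longrightarrow> \<mu> j \<le> \<theta> i j"
  using \<theta>_strict[of 0 i j] L_antimono[of 0 i] by (cases "i = 0") (auto simp: \<mu>_def)

text \<open>The bound must not depend on the stage, so y_j is given the fixed weight
  \<open>\<mu> j\<close>, which is at most every order \<open>\<theta> i j\<close> with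
  \<open>j \<in> L i\<close>. Replacing y_j by itself plus a term of at least this order cannot
  lower the order, and the minimum over \<open>f\<close> is kept.\<close>

lemma stage_order_bound:
  assumes f: "lpoly N M f"
  shows "\<exists>C. \<forall>i. \<forall>e\<in>supp (stage N M S f i). C \<le> wgt N \<omega> (expo i e) + (\<Sum>j<M. real (snd e j) * \<mu> j)"
proof -
  let ?w = "\<lambda>i e. wgt N \<omega> (expo i e) + (\<Sum>j<M. real (snd e j) * \<mu> j)"
  define C where "C = Min (?w 0 ` supp f)"
  have "C \<le> ?w i e" if "e \<in> supp (stage N M S f i)" for i e
    using that
  proof (induction i arbitrary: e)
    case 0
    then show ?case using f unfolding C_def lpoly_def by (intro Min_le) auto
  next
    case (Suc i)
    then have "e \<in> supp (subst_D N M (S i) (stage N M S f i))" by simp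
    then obtain e' where e': "e' \<in> supp (stage N M S f i)" "snd e \<le> snd e'" "fst e = subst_exp N M (S i) e' (snd e)"
      "subst_coeff M (S i) e' (snd e) \<noteq> 0" by (rule supp_subst_D)
    \<comment> \<open>A factor y_j taken from a row outside \<open>L\<close> would bring in a
      positive power of c_j = 0.\<close>
    have jL: "j \<in> L i" if j: "j < M" "snd e' j - snd e j \<noteq> 0" for j
    proof (rule ccontr)
      assume "j \<notin> L i"
      then have "c i j ^ (snd e' j - snd e j) = 0" using c_zero[OF j(1)] j(2) by (simp add: zero_power)
      then have "subst_coeff M (S i) e' (snd e) = 0"
        unfolding subst_coeff_def c_def using j(1) by (intro prod_zero) (auto intro!: bexI[of _ j])
      then show False using e'(4) by simp
    qed
    have "expo (Suc i) e = expo (Suc i) (subst_exp N M (S i) e' (snd e), snd e)" by (simp add: expo_def e'(3))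
    then have "wgt N \<omega> (expo (Suc i) e) = wgt N \<omega> (expo i e') + (\<Sum>j<M. real (snd e' j - snd e j) * \<theta> i j)"
      using wgt_expo_subst_exp[of e' "snd e" i, OF jL] by simp
    moreover have "(\<Sum>j<M. real (snd e' j - snd e j) * \<mu> j) \<le> (\<Sum>j<M. real (snd e' j - snd e j) * \<theta> i j)"
    proof (rule sum_mono)
      fix j assume "j \<in> {..<M}"
      then show "real (snd e' j - snd e j) * \<mu> j \<le> real (snd e' j - snd e j) * \<theta> i j"
        using jL[of j] \<mu>_le[of j i] by (cases "snd e' j - snd e j = 0") (auto intro!: mult_left_mono)
    qed
    moreover have "(\<Sum>j<M. real (snd e' j) * \<mu> j) = (\<Sum>j<M. real (snd e' j - snd e j) * \<mu> j) + (\<Sum>j<M. real (snd e j) * \<mu> j)"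
      unfolding sum.distrib[symmetric] using le_funD[OF e'(2)] by (intro sum.cong) (auto simp: of_nat_diff algebra_simps)
    ultimately show ?case using Suc.IH[OF e'(1)] by linarith
  qed
  then show ?thesis by blast
qed

text \<open>A term containing y_l has order at least C + \<theta> l - \<mu> l at the current stage,
  with \<open>C\<close> uniform. As \<theta> grows, this passes the weight of the supposed leading
  term of the value, which is then left alone in the initial form.\<close>

lemma eval_ser_zero:
  assumes f: "f \<in> I"
  shows "eval_ser M f (ser N M S) = (\<lambda>_. 0)"
proof (rule ccontr)
  let ?\<phi> = "eval_ser M f (ser N M S)"
  assume ne: "?\<phi> \<noteq> (\<lambda>_. 0)"
  have lf: "lpoly N M f" using f ideal by (simp add: is_ideal_def)
  define F where "F i = stage N M S f i" for i
  have lF: "lpoly N M (F i)" for i unfolding F_def by (rule lpoly_stage[OF lf])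
  have conv: "ser_conv N \<omega> (\<lambda>i. eval_ser M f (\<lambda>j. lkp (trunc i j))) ?\<phi>"
    by (rule ser_conv_eval_ser[OF lf ser_conv_trunc])
  have ev: "eval_ser M f (\<lambda>j. lkp (trunc i j)) v = (\<Sum>e\<in>{e\<in>supp (F i). snd e = 0 \<and> expo i e = v}. F i e)" for i v
    unfolding eval_ser_lookup expo_def F_def
    using stage_eval[OF lf, of i "\<lambda>_. 0"] lookup_lpol_eval_zero[OF lpoly_stage[OF lf], of "r i" S i v] by simp
  obtain A where A: "left_finite N \<omega> A" "supp ?\<phi> \<subseteq> A" using ser_conv_supp[OF conv] by blast
  obtain a where a: "a \<in> supp ?\<phi>" using ne by (auto simp: supp_def)
  \<comment> \<open>Left-finiteness leaves finitely many exponents up to the weight of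
    \<open>a\<close>, so a least weight is attained.\<close>
  let ?T = "{v\<in>supp ?\<phi>. wgt N \<omega> v \<le> wgt N \<omega> a}"
  have "finite {v\<in>A. wgt N \<omega> v \<le> wgt N \<omega> a}" using A(1) by (simp add: left_finite_def)
  then have finT: "finite ?T" by (rule finite_subset[rotated]) (use A(2) in blast)
  obtain v0 where v0: "v0 \<in> ?T" "\<And>v. v \<in> ?T \<Longrightarrow> wgt N \<omega> v0 \<le> wgt N \<omega> v"
    using ex_min_if_finite[of "wgt N \<omega> ` ?T"] finT a by (auto simp: not_less)
  then have min: "wgt N \<omega> v0 \<le> wgt N \<omega> v" if "v \<in> supp ?\<phi>" for v
    using v0 that by (cases "wgt N \<omega> v \<le> wgt N \<omega> a") auto
  have v0s: "?\<phi> v0 \<noteq> 0" "v0 \<in> vecs N" using v0(1) A by (auto simp: supp_def left_finite_def)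
  obtain C where C: "\<And>i e. e \<in> supp (F i) \<Longrightarrow> C \<le> wgt N \<omega> (expo i e) + (\<Sum>j<M. real (snd e j) * \<mu> j)"
    using stage_order_bound[OF lf] unfolding F_def by blast
  obtain i0 where i0: "\<forall>i\<ge>i0. \<forall>v. wgt N \<omega> v \<le> wgt N \<omega> v0 \<longrightarrow> eval_ser M f (\<lambda>j. lkp (trunc i j)) v = ?\<phi> v"
    using ser_conv_eventually[OF conv] ..
  \<comment> \<open>The threshold is what makes C + \<theta> - \<mu> exceed the weight of
    \<open>v0\<close>.\<close>
  have "\<exists>i0. \<forall>i\<ge>i0. \<forall>j<M. j \<in> L i \<longrightarrow> wgt N \<omega> v0 - C + \<mu> j < \<theta> i j"
    by (rule eventually_all_rows) (rule \<theta>_unbounded)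
  then obtain i1 where i1: "\<forall>i\<ge>i1. \<forall>j<M. j \<in> L i \<longrightarrow> wgt N \<omega> v0 - C + \<mu> j < \<theta> i j" ..
  define i where "i = max i0 i1"
  have coef: "(\<Sum>e\<in>{e\<in>supp (F i). snd e = 0 \<and> expo i e = v}. F i e) = ?\<phi> v" if "wgt N \<omega> v \<le> wgt N \<omega> v0" for v
    using i0 that unfolding ev[symmetric] by (simp add: i_def)
  have big: "wgt N \<omega> v0 - C + \<mu> j < \<theta> i j" if "j < M" "j \<in> L i" for j using i1 that by (simp add: i_def)
  have "(\<Sum>e\<in>{e\<in>supp (F i). snd e = 0 \<and> expo i e = v0}. F i e) \<noteq> 0" using coef[of v0] v0s by simp
  then have "{e\<in>supp (F i). snd e = 0 \<and> expo i e = v0} \<noteq> {}" by (metis (no_types, lifting) sum.empty)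
  then obtain e0 where e0: "e0 \<in> supp (F i)" "snd e0 = 0" "expo i e0 = v0" by blast
  have wt0: "wt N M \<omega> (fst (S i)) e0 = ereal (wgt N \<omega> v0 / R i)"
    using wt_finite[of e0 i] e0 by simp
  have larger: "ereal (wgt N \<omega> v0 / R i) < wt N M \<omega> (fst (S i)) e" if e: "e \<in> supp (F i)" "e \<noteq> e0" for e
  proof (cases "\<exists>l<M. snd e l \<noteq> 0 \<and> l \<notin> L i")
    case True
    then have "wt N M \<omega> (fst (S i)) e = \<infinity>" using wt_infinite by blast
    then show ?thesis by simp
  next
    case False
    then have wte: "wt N M \<omega> (fst (S i)) e = ereal ((wgt N \<omega> (expo i e) + (\<Sum>l<M. real (snd e l) * \<theta> i l)) / R i)"
      by (intro wt_finite) blast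
    \<comment> \<open>Terms free of y are terms of the value at the truncation, which agrees with
      \<open>?\<phi>\<close> up to the weight of \<open>v0\<close> and therefore has only
      \<open>v0\<close> there. For any other term a single factor y_l already supplies the required
      gain, and the remaining factors do not lose.\<close>
    have "wgt N \<omega> v0 < wgt N \<omega> (expo i e) + (\<Sum>l<M. real (snd e l) * \<theta> i l)"
    proof (cases "snd e = 0")
      case True
      have "wgt N \<omega> v0 < wgt N \<omega> (expo i e)"
      proof (rule ccontr)
        assume le: "\<not> wgt N \<omega> v0 < wgt N \<omega> (expo i e)"
        have "e' = e" if "snd e' = 0" "expo i e' = expo i e" for e'
          using expo_inj[OF that(2)] that(1) True by (intro prod_eqI) simp_all
        then have "{e'\<in>supp (F i). snd e' = 0 \<and> expo i e' = expo i e} = {e}"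
          using e(1) True by blast
        then have "?\<phi> (expo i e) = F i e" using coef[of "expo i e"] le by simp
        then have "expo i e \<in> supp ?\<phi>" using e by (simp add: supp_def)
        then have "wgt N \<omega> v0 = wgt N \<omega> (expo i e)" using min le by force
        then have "expo i e0 = expo i e" using wgt_inj[OF v0s(2) expo_vecs[OF lF e(1)]] e0 by simp
        then have "e0 = e" using expo_inj[of i e0 e] e0(2) True by (intro prod_eqI) simp_all
        then show False using e(2) by simp
      qed
      then show ?thesis using True by simp
    next
      case False2: False
      then obtain l where l: "snd e l \<noteq> 0" by (auto simp: fun_eq_iff)
      then have lM: "l < M" using lF[of i] e(1) unfolding lpoly_def by (metis not_less)
      then have lL: "l \<in> L i" using False l by blast
      have nonneg: "0 \<le> real (snd e j) * (\<theta> i j - \<mu> j)" if "j < M" for j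
        using False that \<mu>_le[of j i] by (cases "snd e j = 0") auto
      have "1 * (\<theta> i l - \<mu> l) \<le> real (snd e l) * (\<theta> i l - \<mu> l)"
        using l \<mu>_le[OF lL] by (intro mult_right_mono) auto
      also have "\<dots> \<le> (\<Sum>j<M. real (snd e j) * (\<theta> i j - \<mu> j))"
        using nonneg lM by (intro member_le_sum) auto
      finally have "\<theta> i l - \<mu> l \<le> (\<Sum>j<M. real (snd e j) * \<theta> i j) - (\<Sum>j<M. real (snd e j) * \<mu> j)"
        by (simp add: right_diff_distrib sum_subtractf)
      then show ?thesis using C[OF e(1)] big[OF lM lL] by linarith
    qed
    then show ?thesis unfolding wte using R_pos[of i] by (simp add: divide_strict_right_mono)
  qed
  have ord: "ord_w N M \<omega> (fst (S i)) (F i) = ereal (wgt N \<omega> v0 / R i)"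
    unfolding ord_w_def
  proof (rule antisym)
    show "(INF e\<in>supp (F i). wt N M \<omega> (fst (S i)) e) \<le> ereal (wgt N \<omega> v0 / R i)"
      using wt0 e0(1) by (metis INF_lower)
    show "ereal (wgt N \<omega> v0 / R i) \<le> (INF e\<in>supp (F i). wt N M \<omega> (fst (S i)) e)"
      using larger wt0 by (intro INF_greatest) (metis order.order_iff_strict)
  qed
  let ?g = "in_w N M \<omega> (fst (S i)) (F i)"
  have "supp ?g = {e0}"
  proof -
    have "?g e \<noteq> 0 \<longleftrightarrow> e = e0" for e
      using wt0 e0(1) larger[of e] unfolding in_w_def ord by (cases "e = e0"; cases "F i e = 0") (auto simp: supp_def)
    then show ?thesis by (auto simp: supp_def)
  qed
  then have "is_monomial ?g \<and> (\<forall>e\<in>supp ?g. \<forall>j<M. j \<notin> Lam M (fst (S i)) \<longrightarrow> snd e j = 0)"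
    using e0 by (auto simp: is_monomial_def)
  then show False using in_tau_S[of i] in_w_stage[OF f, of i] unfolding in_tau_def F_def by blast
qed

end

theorem theorem15p1:
  fixes N M :: nat and \<omega> :: "nat \<Rightarrow> real"
    and I :: "'k::field_char_0 lpol set" and S :: "nat \<Rightarrow> 'k wset"
  assumes "alg_closed TYPE('k)"
    and "0 < N" and "0 < M"
    and "\<forall>q :: nat \<Rightarrow> rat. (\<Sum>i<N. real_of_rat (q i) * \<omega> i) = 0 \<longrightarrow> (\<forall>i<N. q i = 0)"
    and "is_ideal N M I"
    and "admissible N M I"
    and "omega_sequence N M \<omega> I S"
  shows "omega_solution N M \<omega> I (ser N M S)"
proof -
  interpret omega_seq N M \<omega> I S
    using assms elimination_polynomial[OF assms(1,5,6)] by unfold_locales blast+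
  show ?thesis
    unfolding omega_solution_def using omega_positive_ser eval_ser_zero by blast
qed

end
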